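(* Let $n\ge2$ and $3/4<r<1$. The fixed points $v_n^+$ and $v_n^-$ are unstable in $V_H^{2r}$.
   Context: Consider $u_t-u_{xx}\in H_0(u)$ for $x\in(0,1)$, $t>0$, with $u(0,t)=u(1,t)=0$, $u(x,0)=u_0(x)$, where $H_0(u)=\{-1\}$ if $u<0$, $H_0(0)=[-1,1]$, $H_0(u)=\{1\}$ if $u>0$. A strong solution with initial datum $u_0\in L^2(0,1)$ is $u\in C([0,\infty),L^2(0,1))$ with $u(0)=u_0$, absolutely continuous on every $[T_1,T_2]\subset(0,\infty)$, with $u(t)\in H^2(0,1)\cap H_0^1(0,1)$ for a.a. $t$, and such that there is $g\in L^2_{loc}(0,\infty;L^2(0,1))$ (square integrable on $(0,T)$ for each $T>0$) with $g(t)(x)\in H_0(u(t)(x))$ for a.a. $x\in(0,1)$, for a.a. $t$, and $\frac{du}{dt}(t)-u_{xx}(t)=g(t)$ for a.a. $t>0$. For $n\ge1$, $v_n^+(x)=(-1)^k\left(-\frac{(x-k/n)^2}{2}+\frac{x-k/n}{2n}\right)$ for $x\in[\frac kn,\frac{k+1}n]$, $k=0,\dots,n-1$, and $v_n^-=-v_n^+$; these are fixed points (constant-in-time strong solutions). $A_H u=-u_{xx}$ in $L^2(0,1)$ with domain $H^2(0,1)\cap H_0^1(0,1)$; $V_H^{2r}=D(A_H^r)$ with norm $\|A_H^r u\|_{L^2}$. A fixed point $v$ is stable in $V_H^{2r}$ if for every $\varepsilon>0$ there is $\gamma>0$ such that every strong solution $u$ with $u(0)\in V_H^{2r}$ and $\|u(0)-v\|_{V_H^{2r}}\le\gamma$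 satisfies $\|u(t)-v\|_{V_H^{2r}}\le\varepsilon$ for all $t\ge0$; it is unstable if it is not stable. *)

theory Defs
  imports "HOL-Analysis.Analysis"
begin

section \<open>The Hilbert space $L^2(0,1)$\<close>

abbreviation leb01 :: "real measure" where
  "leb01 \<equiv> lebesgue_on {0<..<1}"

definition square_integrable :: "(real \<Rightarrow> real) \<Rightarrow> bool" where
  "square_integrable f \<longleftrightarrow> f \<in> borel_measurable leb01 \<and> integrable leb01 (\<lambda>x. (f x)\<^sup>2)"

definition L2_rel :: "(real \<Rightarrow> real) \<Rightarrow> (real \<Rightarrow> real) \<Rightarrow> bool" where
  "L2_rel f g \<longleftrightarrow> square_integrable f \<and> square_integrable g \<and> (AE x in leb01. f x = g x)"

lemma square_integrable_0: "square_integrable (\<lambda>x. 0)"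
  by (simp add: square_integrable_def)

lemma square_integrable_mult:
  assumes "square_integrable f" "square_integrable g"
  shows "integrable leb01 (\<lambda>x. f x * g x)"
proof (rule Bochner_Integration.integrable_bound)
  show "integrable leb01 (\<lambda>x. (f x)\<^sup>2 + (g x)\<^sup>2)"
    using assms by (auto simp: square_integrable_def)
  show "(\<lambda>x. f x * g x) \<in> borel_measurable leb01"
    using assms by (auto simp: square_integrable_def)
  have "\<bar>a * b\<bar> \<le> a\<^sup>2 + b\<^sup>2" for a b :: real
  proof -
    have "2 * (\<bar>a\<bar> * \<bar>b\<bar>) \<le> a\<^sup>2 + b\<^sup>2"
      using sum_squares_bound[of "\<bar>a\<bar>" "\<bar>b\<bar>"] by (simp add: mult.assoc)
    moreover have "0 \<le> \<bar>a\<bar> * \<bar>b\<bar>" by simp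
    ultimately show ?thesis unfolding abs_mult by linarith
  qed
  then show "AE x in leb01. norm (f x * g x) \<le> norm ((f x)\<^sup>2 + (g x)\<^sup>2)"
    by (auto intro!: AE_I2 simp: order_trans)
qed

lemma square_integrable_add:
  assumes "square_integrable f" "square_integrable g"
  shows "square_integrable (\<lambda>x. f x + g x)"
  using assms square_integrable_mult[OF assms]
  by (auto simp: square_integrable_def power2_sum mult.assoc)

lemma square_integrable_cmult:
  assumes "square_integrable f"
  shows "square_integrable (\<lambda>x. c * f x)"
  using assms by (auto simp: square_integrable_def power_mult_distrib)

lemma square_integrable_minus:
  assumes "square_integrable f"
  shows "square_integrable (\<lambda>x. - f x)"
  using square_integrable_cmult[OF assms, of "-1"] by simp

lemma square_integrable_diff:
  assumes "square_integrable f" "square_integrable g"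
  shows "square_integrable (\<lambda>x. f x - g x)"
  using square_integrable_add[OF assms(1) square_integrable_minus[OF assms(2)]] by simp

quotient_type L2 = "real \<Rightarrow> real" / partial: L2_rel
proof (rule part_equivpI)
  show "\<exists>f. L2_rel f f"
    by (rule exI[of _ "\<lambda>x. 0"]) (simp add: L2_rel_def square_integrable_0)
  show "symp L2_rel"
    by (auto simp: symp_def L2_rel_def elim: AE_mp)
  show "transp L2_rel"
    by (auto simp: transp_def L2_rel_def elim: AE_mp)
qed

instantiation L2 :: real_inner
begin

lift_definition zero_L2 :: L2 is "\<lambda>x. 0"
  by (simp add: L2_rel_def square_integrable_0)

lift_definition plus_L2 :: "L2 \<Rightarrow> L2 \<Rightarrow> L2" is "\<lambda>f g x. f x + g x"
  unfolding L2_rel_def by (auto intro: square_integrable_add elim!: AE_mp)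

lift_definition uminus_L2 :: "L2 \<Rightarrow> L2" is "\<lambda>f x. - f x"
  unfolding L2_rel_def by (auto intro: square_integrable_minus elim!: AE_mp)

lift_definition minus_L2 :: "L2 \<Rightarrow> L2 \<Rightarrow> L2" is "\<lambda>f g x. f x - g x"
  unfolding L2_rel_def by (auto intro: square_integrable_diff elim!: AE_mp)

lift_definition scaleR_L2 :: "real \<Rightarrow> L2 \<Rightarrow> L2" is "\<lambda>c f x. c * f x"
  unfolding L2_rel_def by (auto intro: square_integrable_cmult elim!: AE_mp)

lift_definition inner_L2 :: "L2 \<Rightarrow> L2 \<Rightarrow> real" is "\<lambda>f g. LINT x|leb01. f x * g x"
  by (rule integral_cong_AE)
     (auto simp: L2_rel_def square_integrable_def elim!: AE_mp)

definition norm_L2 :: "L2 \<Rightarrow> real" where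
  "norm_L2 f = sqrt (inner f f)"

definition dist_L2 :: "L2 \<Rightarrow> L2 \<Rightarrow> real" where
  "dist_L2 f g = norm (f - g)"

definition sgn_L2 :: "L2 \<Rightarrow> L2" where
  "sgn_L2 f = inverse (norm f) *\<^sub>R f"

definition uniformity_L2 :: "(L2 \<times> L2) filter" where
  "uniformity_L2 = (INF e\<in>{0<..}. principal {(f, g). dist f g < e})"

definition open_L2 :: "L2 set \<Rightarrow> bool" where
  "open_L2 S \<longleftrightarrow> (\<forall>f\<in>S. \<forall>\<^sub>F (f', g) in uniformity. f' = f \<longrightarrow> g \<in> S)"

instance
proof
  fix f g h :: L2 and a b c :: real
  show "f + g + h = f + (g + h)"
    by transfer (auto simp: L2_rel_def add.assoc intro: square_integrable_add)
  show "f + g = g + f"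
    by transfer (auto simp: L2_rel_def add.commute intro: square_integrable_add)
  show "0 + f = f"
    by transfer (auto simp: L2_rel_def)
  show "- f + f = 0"
    by transfer (auto simp: L2_rel_def square_integrable_0)
  show "f - g = f + - g"
    by transfer (auto simp: L2_rel_def intro: square_integrable_diff)
  show "a *\<^sub>R (f + g) = a *\<^sub>R f + a *\<^sub>R g"
    by transfer (auto simp: L2_rel_def distrib_left
        intro: square_integrable_add square_integrable_cmult)
  show "(a + b) *\<^sub>R f = a *\<^sub>R f + b *\<^sub>R f"
    by transfer (auto simp: L2_rel_def distrib_right
        intro: square_integrable_add square_integrable_cmult)
  show "a *\<^sub>R b *\<^sub>R f = (a * b) *\<^sub>R f"
    by transfer (auto simp: L2_rel_def mult.assoc intro: square_integrable_cmult)
  show "1 *\<^sub>R f = f"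
    by transfer (auto simp: L2_rel_def)
  show "dist f g = norm (f - g)"
    by (rule dist_L2_def)
  show "sgn f = inverse (norm f) *\<^sub>R f"
    by (rule sgn_L2_def)
  show "(uniformity :: (L2 \<times> L2) filter) = (INF e\<in>{0<..}. principal {(x, y). dist x y < e})"
    by (rule uniformity_L2_def)
  show "inner f g = inner g f"
    by transfer (simp add: mult.commute)
  show "inner (f + g) h = inner f h + inner g h"
    by transfer (auto simp: L2_rel_def distrib_right square_integrable_mult)
  show "inner (a *\<^sub>R f) g = a * inner f g"
    by transfer (auto simp: mult.assoc)
  show "0 \<le> inner f f"
    by transfer simp
  show "inner f f = 0 \<longleftrightarrow> f = 0"
  proof transfer
    fix f assume "L2_rel f f"
    then have f: "square_integrable f" by (simp add: L2_rel_def)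
    have "(LINT x|leb01. f x * f x) = 0 \<longleftrightarrow> (AE x in leb01. f x * f x = 0)"
      using square_integrable_mult[OF f f] by (intro integral_nonneg_eq_0_iff_AE) auto
    then show "(LINT x|leb01. f x * f x) = 0 \<longleftrightarrow> L2_rel f (\<lambda>x. 0)"
      using f by (simp add: L2_rel_def square_integrable_0)
  qed
  show "norm f = sqrt (inner f f)"
    by (rule norm_L2_def)
next
  fix S :: "L2 set"
  show "open S \<longleftrightarrow> (\<forall>x\<in>S. \<forall>\<^sub>F (x', y) in uniformity. x' = x \<longrightarrow> y \<in> S)"
    by (rule open_L2_def)
qed

end

text \<open>\<open>abs_L2 f\<close> is the class of a square integrable function \<open>f\<close>,
  and \<open>rep_L2 u\<close> is a representative of the class \<open>u\<close>.\<close>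

lemma L2_rel_rep_abs:
  assumes "square_integrable f"
  shows "AE x in leb01. rep_L2 (abs_L2 f) x = f x"
proof -
  have "L2_rel f f"
    using assms by (simp add: L2_rel_def)
  then have "L2_rel (rep_L2 (abs_L2 f)) f"
    by (rule Quotient_rep_abs[OF Quotient_L2])
  then show ?thesis
    by (simp add: L2_rel_def)
qed


section \<open>Sobolev spaces\<close>

text \<open>The space $C_c^\infty(0,1)$.\<close>

definition test_function :: "(real \<Rightarrow> real) \<Rightarrow> bool" where
  "test_function \<phi> \<longleftrightarrow>
     (\<forall>k x. (deriv ^^ k) \<phi> differentiable at x) \<and>
     (\<exists>a b. 0 < a \<and> b < 1 \<and> (\<forall>x. x \<notin> {a..b} \<longrightarrow> \<phi> x = 0))"

definition has_weak_deriv :: "L2 \<Rightarrow> L2 \<Rightarrow> bool" where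
  "has_weak_deriv u w \<longleftrightarrow>
     (\<forall>\<phi>. test_function \<phi> \<longrightarrow> inner u (abs_L2 (deriv \<phi>)) = - inner w (abs_L2 \<phi>))"

definition weak_deriv :: "L2 \<Rightarrow> L2" where
  "weak_deriv u = (THE w. has_weak_deriv u w)"

definition H1 :: "L2 set" where
  "H1 = {u. \<exists>w. has_weak_deriv u w}"

definition H2 :: "L2 set" where
  "H2 = {u \<in> H1. weak_deriv u \<in> H1}"

text \<open>$H_0^1(0,1)$ is the closure of $C_c^\infty(0,1)$ in the norm of $H^1(0,1)$.\<close>

definition H10 :: "L2 set" where
  "H10 = {u \<in> H1. \<exists>\<phi> :: nat \<Rightarrow> real \<Rightarrow> real. (\<forall>j. test_function (\<phi> j)) \<and>
     (\<lambda>j. abs_L2 (\<phi> j)) \<longlonglongrightarrow> u \<and> (\<lambda>j. abs_L2 (deriv (\<phi> j))) \<longlonglongrightarrow> weak_deriv u}"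


section \<open>The Dirichlet Laplacian and its fractional powers\<close>

definition A_H_dom :: "L2 set" where
  "A_H_dom = H2 \<inter> H10"

definition A_H :: "L2 \<Rightarrow> L2" where
  "A_H u = - weak_deriv (weak_deriv u)"

text \<open>\<open>A_H\<close> is self-adjoint and positive with compact resolvent, so \<open>L2\<close> has an
  orthonormal basis of eigenvectors $e_k$ with eigenvalues $\mu_k > 0$, and
  $A_H^r u = \sum_k \mu_k^r \langle u, e_k\rangle e_k$, with domain the set of all $u$ for which
  this series converges. Equivalently, \<open>w\<close> is $A_H^r u$ iff $w \in L^2(0,1)$ has the component
  $\mu^r \langle u, e\rangle$ along every eigenvector $e$, where
  $\mu$ is the eigenvalue of $e$.\<close>

definition is_A_H_pow :: "real \<Rightarrow> L2 \<Rightarrow> L2 \<Rightarrow> bool" where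
  "is_A_H_pow r u w \<longleftrightarrow>
     (\<forall>\<mu> e. e \<in> A_H_dom \<and> A_H e = \<mu> *\<^sub>R e \<longrightarrow> inner w e = \<mu> powr r * inner u e)"

definition A_H_pow_dom :: "real \<Rightarrow> L2 set" where
  "A_H_pow_dom r = {u. \<exists>w. is_A_H_pow r u w}"

definition A_H_pow :: "real \<Rightarrow> L2 \<Rightarrow> L2" where
  "A_H_pow r u = (THE w. is_A_H_pow r u w)"

definition V_H :: "real \<Rightarrow> L2 set" where
  "V_H s = A_H_pow_dom (s / 2)"

definition V_H_norm :: "real \<Rightarrow> L2 \<Rightarrow> real" where
  "V_H_norm s u = norm (A_H_pow (s / 2) u)"


section \<open>Strong solutions and stability\<close>

definition H0 :: "real \<Rightarrow> real set" where
  "H0 y = (if y < 0 then {-1} else if y = 0 then {-1..1} else {1})"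

definition absolutely_continuous_on :: "real \<Rightarrow> real \<Rightarrow> (real \<Rightarrow> 'a::metric_space) \<Rightarrow> bool" where
  "absolutely_continuous_on a b f \<longleftrightarrow>
     (\<forall>\<epsilon>>0. \<exists>\<delta>>0. \<forall>(m::nat) (s :: nat \<Rightarrow> real) (t :: nat \<Rightarrow> real).
        (\<forall>i<m. a \<le> s i \<and> s i \<le> t i \<and> t i \<le> b) \<and>
        disjoint_family_on (\<lambda>i. {s i<..<t i}) {..<m} \<and> (\<Sum>i<m. t i - s i) < \<delta>
        \<longrightarrow> (\<Sum>i<m. dist (f (s i)) (f (t i))) < \<epsilon>)"

text \<open>\<open>L2\<close> is separable, so Borel measurability of \<open>g\<close> is strong measurability.\<close>

definition strong_solution :: "L2 \<Rightarrow> (real \<Rightarrow> L2) \<Rightarrow> bool" where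
  "strong_solution u0 u \<longleftrightarrow>
     continuous_on {0..} u \<and> u 0 = u0 \<and>
     (\<forall>T1 T2. 0 < T1 \<and> T1 \<le> T2 \<longrightarrow> absolutely_continuous_on T1 T2 u) \<and>
     (AE t in lebesgue_on {0<..}. u t \<in> H2 \<inter> H10) \<and>
     (\<exists>g :: real \<Rightarrow> L2.
        (\<forall>T>0. g \<in> borel_measurable (lebesgue_on {0<..<T}) \<and>
               integrable (lebesgue_on {0<..<T}) (\<lambda>t. (norm (g t))\<^sup>2)) \<and>
        (AE t in lebesgue_on {0<..}. AE x in leb01. rep_L2 (g t) x \<in> H0 (rep_L2 (u t) x)) \<and>
        (AE t in lebesgue_on {0<..}. \<exists>u'. (u has_vector_derivative u') (at t) \<and>
            u' - weak_deriv (weak_deriv (u t)) = g t))"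

definition fixed_point :: "L2 \<Rightarrow> bool" where
  "fixed_point v \<longleftrightarrow> strong_solution v (\<lambda>t. v)"

definition stable_in_V_H :: "real \<Rightarrow> L2 \<Rightarrow> bool" where
  "stable_in_V_H s v \<longleftrightarrow> fixed_point v \<and>
     (\<forall>\<epsilon>>0. \<exists>\<gamma>>0. \<forall>u. strong_solution (u 0) u \<and> u 0 \<in> V_H s \<and> V_H_norm s (u 0 - v) \<le> \<gamma> \<longrightarrow>
        (\<forall>t\<ge>0. u t \<in> V_H s \<and> V_H_norm s (u t - v) \<le> \<epsilon>))"

definition unstable_in_V_H :: "real \<Rightarrow> L2 \<Rightarrow> bool" where
  "unstable_in_V_H s v \<longleftrightarrow> fixed_point v \<and> \<not> stable_in_V_H s v"


section \<open>The fixed points\<close>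

text \<open>For \<open>x\<close> in \<open>[k/n, (k+1)/n)\<close> the floor below is \<open>k\<close>; the formulas of adjacent intervals
  agree (both are \<open>0\<close>) at the common end point.\<close>

definition v_fun :: "nat \<Rightarrow> real \<Rightarrow> real" where
  "v_fun n x = (let k = nat \<lfloor>real n * x\<rfloor> in
     (-1) ^ k * (- (x - real k / real n)\<^sup>2 / 2 + (x - real k / real n) / (2 * real n)))"

lemma v_fun_eq:
  assumes "k < n" "x \<in> {real k / real n .. real (k + 1) / real n}"
  shows "v_fun n x = (-1) ^ k * (- (x - real k / real n)\<^sup>2 / 2 + (x - real k / real n) / (2 * real n))"
proof (cases "x = real (k + 1) / real n")
  case True
  have n: "real n > 0" using assms by simp
  have "real n * x = real (k + 1)" using True n by simp
  then have "\<lfloor>real n * x\<rfloor> = int (k + 1)" by (metis floor_of_nat)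
  then have "nat \<lfloor>real n * x\<rfloor> = k + 1" by simp
  moreover have "x - real k / real n = 1 / real n" using True n by (simp add: field_simps)
  ultimately show ?thesis using True by (simp add: v_fun_def Let_def power2_eq_square)
next
  case False
  have n: "real n > 0" using assms by simp
  have "real k \<le> real n * x" "real n * x < real (k + 1)"
    using assms False n by (auto simp: field_simps)
  then have "\<lfloor>real n * x\<rfloor> = int k" by (simp add: floor_eq_iff)
  then show ?thesis by (simp add: v_fun_def Let_def)
qed

definition v_plus :: "nat \<Rightarrow> L2" where
  "v_plus n = abs_L2 (v_fun n)"

definition v_minus :: "nat \<Rightarrow> L2" where
  "v_minus n = - v_plus n"

end

(* The perturbation u0 = v + w0, where - w0'' is 2 on a short interval J to the right of p = 1/n and 0
   elsewhere, is a subsolution: w0 grows linearly in the length of J, which is enough to make u0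
   positive on J. For subsolutions a solution with u(t) >= u0 is obtained by monotone iteration,
   with the lower semicontinuous selection of H_0 and the positivity of the heat semigroup.

   If v were stable, then w = u - v would stay small in V_H^{2r}, hence in C^1 because 2r > 3/2. Pair w
   with the tent function G = green p, which satisfies G'' = - delta_p. The diffusion contributes
   - w(t,p). Since v vanishes at p with slope - 1/(2n), the sign of u differs from that of v
   on an interval of length close to 2 n w(t,p), and as G(p) = (1 - 1/n)/n the reaction contributes
   almost 4 (1 - 1/n) w(t,p) >= 2 w(t,p). So the pairing grows at least at the rate w(t,p)/2 >= w0(p)/2 > 0,
   although it is bounded.

   Everything is computed in the basis of sines. That the mild solution is a strong one, i.e.
   differentiable in L^2 for almost all t, follows from the one-dimensional Lebesgue differentiation
   theorem applied to every coefficient of u' and to the squared norm of u'. *)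

theory Submission
  imports Defs "HOL-Real_Asymp.Real_Asymp"
begin

subsection \<open>Lebesgue differentiation on the line\<close>

lemma indefinite_integral_exceptional_set_negligible:
  fixes f :: "real \<Rightarrow> real"
  assumes f: "f integrable_on {a..b}" and e: "e > 0"
  defines "F \<equiv> (\<lambda>t. integral {a..t} f)"
  shows "negligible {x \<in> {a<..<b}. \<forall>d>0. \<exists>y\<in>{a..b}. y \<noteq> x \<and> \<bar>y - x\<bar> < d \<and>
           \<bar>F y - F x - (y - x) * f x\<bar> > e * \<bar>y - x\<bar>}"
    (is "negligible ?B")
  unfolding negligible_outer_le
proof (intro allI impI)
  fix \<epsilon> :: real assume \<epsilon>: "\<epsilon> > 0"
  have F_diff: "F y - F x = integral {x..y} f" if "a \<le> x" "x \<le> y" "y \<le> b" for x y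
  proof -
    have "f integrable_on {a..y}"
      using f that by (auto intro: integrable_on_subinterval)
    then have "integral {a..x} f + integral {x..y} f = integral {a..y} f"
      using that by (intro Henstock_Kurzweil_Integration.integral_combine) auto
    then show ?thesis by (simp add: F_def)
  qed
  have f': "f integrable_on cbox a b" and e\<epsilon>: "e * \<epsilon> > 0" using f e \<epsilon> by auto
  obtain \<gamma> where \<gamma>: "gauge \<gamma>"
    and hen: "\<And>p. \<lbrakk>p tagged_partial_division_of (cbox a b); \<gamma> fine p\<rbrakk> \<Longrightarrow>
             sum (\<lambda>(x,k). norm (measure lborel k *\<^sub>R f x - integral k f)) p < e * \<epsilon>"
    using Henstock_lemma[OF f' e\<epsilon>] by blast
  define I where "I = (\<lambda>(x, y). {min x y..max x (y::real)})"
  define K where "K = {(x, y). x \<in> ?B \<and> y \<in> {a..b} \<and> y \<noteq> x \<and> I (x, y) \<subseteq> \<gamma> x \<and>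
           \<bar>F y - F x - (y - x) * f x\<bar> > e * \<bar>y - x\<bar>}"
  define c where "c = (\<lambda>(x, y). (x + y) / (2::real))"
  define r where "r = (\<lambda>(x, y). \<bar>y - x\<bar> / (2::real))"
  have cball_I: "cball (c i) (r i) = I i" for i
    by (cases i) (auto simp: c_def r_def I_def dist_real_def abs_if field_simps split: if_splits)
  have r: "0 < r i" if "i \<in> K" for i
    using that by (auto simp: K_def r_def)
  have fine: "\<exists>i. i \<in> K \<and> x \<in> cball (c i) (r i) \<and> r i < d" if x: "x \<in> ?B" and d: "0 < d" for x d
  proof -
    have "x \<in> \<gamma> x" "open (\<gamma> x)" using \<gamma> by (auto simp: gauge_def)
    then obtain d' where d': "d' > 0" "ball x d' \<subseteq> \<gamma> x" by (meson openE)
    obtain y where y: "y \<in> {a..b}" "y \<noteq> x" "\<bar>y - x\<bar> < min d d'"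
        "\<bar>F y - F x - (y - x) * f x\<bar> > e * \<bar>y - x\<bar>"
      using x[unfolded mem_Collect_eq, THEN conjunct2, rule_format, of "min d d'"] d d'(1) by auto
    have "I (x, y) \<subseteq> ball x d'"
      using y(3) by (auto simp: I_def dist_real_def abs_if split: if_splits)
    then have "(x, y) \<in> K" using y x d' by (auto simp: K_def)
    moreover have "r (x, y) < d" using y(3) by (auto simp: r_def)
    moreover have "x \<in> cball (c (x, y)) (r (x, y))" unfolding cball_I by (auto simp: I_def)
    ultimately show ?thesis by blast
  qed
  obtain C where C: "countable C" "C \<subseteq> K"
     "pairwise (\<lambda>i j. disjnt (cball (c i) (r i)) (cball (c j) (r j))) C"
     "negligible (?B - (\<Union>i\<in>C. cball (c i) (r i)))"
    by (rule Vitali_covering_theorem_cballs[of K r ?B c, OF r fine]) (assumption | rule that)+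
  have bound: "measure lebesgue (\<Union>i\<in>D. cball (c i) (r i)) \<le> \<epsilon>" if D: "D \<subseteq> C" "finite D" for D
  proof -
    have DK: "D \<subseteq> K" using D C by auto
    have disj: "I i \<inter> I j = {}" if "i \<in> D" "j \<in> D" "i \<noteq> j" for i j
      using C(3) D(1) that by (auto simp: pairwise_def disjnt_def cball_I)
    define T where "T = (\<lambda>i. (fst i, I i))"
    have injT: "inj_on T D"
    proof (rule inj_onI)
      fix i j assume "i \<in> D" "j \<in> D" "T i = T j"
      moreover have "I i \<noteq> {}" by (cases i) (auto simp: I_def)
      ultimately show "i = j" using disj[of i j] by (auto simp: T_def)
    qed
    have part: "T ` D tagged_partial_division_of (cbox a b)"
      unfolding tagged_partial_division_of_def
    proof (intro conjI allI impI)
      show "finite (T ` D)" using D by simp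
      fix x k assume "(x, k) \<in> T ` D"
      then obtain y where xy: "(x, y) \<in> D" "k = I (x, y)" by (auto simp: T_def)
      with DK have "x \<in> {a<..<b}" "y \<in> {a..b}" by (auto simp: K_def)
      then show "x \<in> k" "k \<subseteq> cbox a b" using xy by (auto simp: I_def)
      show "\<exists>a b. k = cbox a b" using xy by (auto simp: I_def)
    next
      fix x1 K1 x2 K2
      assume h: "(x1, K1) \<in> T ` D \<and> (x2, K2) \<in> T ` D \<and> (x1, K1) \<noteq> (x2, K2)"
      then obtain i j where "i \<in> D" "j \<in> D" "(x1, K1) = T i" "(x2, K2) = T j" by auto
      with h disj[of i j] have "K1 \<inter> K2 = {}" by (auto simp: T_def)
      then show "interior K1 \<inter> interior K2 = {}"
        using interior_subset by blast
    qed
    have "I i \<subseteq> \<gamma> (fst i)" if "i \<in> D" for i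
      using DK that by (cases i) (auto simp: K_def)
    then have "\<gamma> fine T ` D"
      by (auto simp: fine_def T_def)
    note h = hen[OF part this]
    have "e * (\<Sum>i\<in>D. measure lebesgue (cball (c i) (r i))) =
        (\<Sum>i\<in>D. e * measure lebesgue (cball (c i) (r i)))"
      by (simp add: sum_distrib_left)
    also have "\<dots> \<le> (\<Sum>i\<in>D. norm (measure lborel (I i) *\<^sub>R f (fst i) - integral (I i) f))"
    proof (rule sum_mono)
      fix i assume "i \<in> D"
      obtain x y where i: "i = (x, y)" by (cases i)
      have xy: "(x, y) \<in> K" using \<open>i \<in> D\<close> DK i by auto
      then have "a \<le> x" "x \<le> b" "a \<le> y" "y \<le> b" and
        lt: "e * \<bar>y - x\<bar> < \<bar>F y - F x - (y - x) * f x\<bar>" by (auto simp: K_def)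
      moreover have "norm (measure lborel (I i) *\<^sub>R f x - integral (I i) f) = \<bar>F y - F x - (y - x) * f x\<bar>"
      proof (cases "x \<le> y")
        case True
        then show ?thesis using F_diff[of x y] calculation
          by (simp add: i I_def min_def max_def abs_minus_commute algebra_simps)
      next
        case False
        then show ?thesis using F_diff[of y x] calculation
          by (simp add: i I_def min_def max_def algebra_simps)
      qed
      moreover have "measure lebesgue (cball (c i) (r i)) = \<bar>y - x\<bar>"
        unfolding cball_I by (auto simp: i I_def min_def max_def)
      ultimately show "e * measure lebesgue (cball (c i) (r i)) \<le>
          norm (measure lborel (I i) *\<^sub>R f (fst i) - integral (I i) f)"
        using i by simp
    qed
    also have "\<dots> = sum (\<lambda>(x,k). norm (measure lborel k *\<^sub>R f x - integral k f)) (T ` D)"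
      by (subst sum.reindex[OF injT]) (simp add: T_def)
    also have "\<dots> \<le> e * \<epsilon>" using h by simp
    finally have "(\<Sum>i\<in>D. measure lebesgue (cball (c i) (r i))) \<le> \<epsilon>"
      using e by simp
    moreover have "measure lebesgue (\<Union>i\<in>D. cball (c i) (r i)) \<le>
        (\<Sum>i\<in>D. measure lebesgue (cball (c i) (r i)))"
      using D by (intro measure_UNION_le) auto
    ultimately show ?thesis by simp
  qed
  let ?T = "(\<Union>i\<in>C. cball (c i) (r i))"
  define N where "N = ?B - ?T"
  have N: "negligible N" using C(4) by (simp add: N_def)
  have T: "?T \<in> lmeasurable" "measure lebesgue ?T \<le> \<epsilon>"
    using fmeasurable_UN_bound[OF C(1), of "\<lambda>i. cball (c i) (r i)" lebesgue \<epsilon>]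
      measure_UN_bound[OF C(1), of "\<lambda>i. cball (c i) (r i)" lebesgue \<epsilon>] bound by auto
  show "\<exists>T. ?B \<subseteq> T \<and> T \<in> lmeasurable \<and> measure lebesgue T \<le> \<epsilon>"
  proof (intro exI[of _ "?T \<union> N"] conjI)
    show "?T \<union> N \<in> lmeasurable"
      using T(1) negligible_imp_measurable[OF N] by (rule fmeasurable.Un)
    have "measure lebesgue (?T \<union> N) \<le> measure lebesgue ?T + measure lebesgue N"
      using fmeasurableD[OF T(1)] negligible_imp_sets[OF N] by (rule measure_Un_le)
    then show "measure lebesgue (?T \<union> N) \<le> \<epsilon>"
      using T negligible_imp_measure0[OF N] by linarith
  qed (auto simp: N_def)
qed

theorem indefinite_integral_has_derivative_AE:
  fixes f :: "real \<Rightarrow> real"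
  assumes f: "f integrable_on {a..b}"
  shows "\<exists>N. negligible N \<and>
    (\<forall>t\<in>{a<..<b} - N. ((\<lambda>t. integral {a..t} f) has_real_derivative f t) (at t))"
proof -
  define F where "F = (\<lambda>t. integral {a..t} f)"
  define B where "B = (\<lambda>e. {x \<in> {a<..<b}. \<forall>d>0. \<exists>y\<in>{a..b}. y \<noteq> x \<and> \<bar>y - x\<bar> < d \<and>
           \<bar>F y - F x - (y - x) * f x\<bar> > e * \<bar>y - x\<bar>})"
  define N where "N = (\<Union>m. B (1 / real (Suc m)))"
  have "negligible N"
    unfolding N_def
  proof (rule negligible_countable_Union)
    fix S assume "S \<in> range (\<lambda>m. B (1 / real (Suc m)))"
    then obtain m where "S = B (1 / real (Suc m))" by blast
    moreover have "negligible (B (1 / real (Suc m)))"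
      unfolding B_def F_def by (rule indefinite_integral_exceptional_set_negligible[OF f]) simp
    ultimately show "negligible S" by (simp only:)
  qed simp
  moreover have "(F has_real_derivative f t) (at t)" if t: "t \<in> {a<..<b} - N" for t
    unfolding has_field_derivative_def has_derivative_within_alt
  proof (intro conjI allI impI)
    show "bounded_linear ((*) (f t))" by (rule bounded_linear_mult_right)
    fix e :: real assume "e > 0"
    then obtain m where m: "1 / real (Suc m) < e" using nat_approx_posE by blast
    from t have "t \<notin> B (1 / real (Suc m))" by (auto simp: N_def)
    then obtain d where d: "d > 0" and
      le: "\<And>y. y \<in> {a..b} \<Longrightarrow> y \<noteq> t \<Longrightarrow> \<bar>y - t\<bar> < d \<Longrightarrow>
        \<bar>F y - F t - (y - t) * f t\<bar> \<le> 1 / real (Suc m) * \<bar>y - t\<bar>"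
      using t unfolding B_def mem_Collect_eq DiffD1[OF t] not_all not_imp not_ex by (meson DiffD1 not_less)
    show "\<exists>d>0. \<forall>y\<in>UNIV. norm (y - t) < d \<longrightarrow> norm (F y - F t - f t * (y - t)) \<le> e * norm (y - t)"
    proof (intro exI[of _ "Min {d, t - a, b - t}"] conjI ballI impI)
      show "0 < Min {d, t - a, b - t}" using d t by auto
      fix y assume y: "norm (y - t) < Min {d, t - a, b - t}"
      show "norm (F y - F t - f t * (y - t)) \<le> e * norm (y - t)"
      proof (cases "y = t")
        case False
        have "\<bar>F y - F t - (y - t) * f t\<bar> \<le> 1 / real (Suc m) * \<bar>y - t\<bar>"
          using y False by (intro le) auto
        also have "\<dots> \<le> e * \<bar>y - t\<bar>" using m by (intro mult_right_mono) auto
        finally show ?thesis by (simp add: mult.commute)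
      qed simp
    qed
  qed
  ultimately show ?thesis unfolding F_def by blast
qed

subsection \<open>Smooth cut-off functions\<close>

definition flat :: "real poly \<Rightarrow> real \<Rightarrow> real" where
  "flat p x = (if x > 0 then poly p (1 / x) * exp (- 1 / x) else 0)"

lemma poly_times_exp_minus_tendsto_0: "((\<lambda>x. poly p x * exp (- x)) \<longlongrightarrow> (0::real)) at_top"
proof -
  have "((\<lambda>x. \<Sum>i\<le>degree p. coeff p i * (x ^ i / exp x)) \<longlongrightarrow> (\<Sum>i\<le>degree p. coeff p i * 0)) at_top"
    by (intro tendsto_intros tendsto_power_div_exp_0)
  moreover have "poly p x * exp (- x) = (\<Sum>i\<le>degree p. coeff p i * (x ^ i / exp x))" for x
    unfolding poly_altdef sum_distrib_right by (simp add: exp_minus divide_inverse mult.assoc)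
  ultimately show ?thesis by simp
qed

lemma flat_has_derivative:
  "(flat p has_real_derivative flat (monom 1 2 * (p - pderiv p)) x) (at x)"
proof -
  consider "x > 0" | "x < 0" | "x = 0" by linarith
  then show ?thesis
  proof cases
    case 1
    have "((\<lambda>x. poly p (1 / x) * exp (- 1 / x)) has_real_derivative
        flat (monom 1 2 * (p - pderiv p)) x) (at x)"
      using 1
      by (auto intro!: derivative_eq_intros DERIV_chain2[OF poly_DERIV] exI
          simp: flat_def poly_monom field_simps power2_eq_square)
    moreover have "eventually (\<lambda>y. flat p y = poly p (1 / y) * exp (- 1 / y)) (nhds x)"
      using eventually_nhds_in_open[of "{0<..}" x] 1 by (auto simp: flat_def elim!: eventually_mono)
    ultimately show ?thesis by (subst DERIV_cong_ev[OF refl _ refl])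
  next
    case 2
    have "eventually (\<lambda>y. flat p y = 0) (nhds x)"
      using eventually_nhds_in_open[of "{..<0}" x] 2 by (auto simp: flat_def elim!: eventually_mono)
    moreover have "flat (monom 1 2 * (p - pderiv p)) x = 0" using 2 by (simp add: flat_def)
    ultimately show ?thesis by (simp cong: DERIV_cong_ev)
  next
    case 3
    have "((\<lambda>h. poly (monom 1 1 * p) (1 / h) * exp (- (1 / h))) \<longlongrightarrow> 0) (at_right 0)"
      by (rule filterlim_compose[OF poly_times_exp_minus_tendsto_0])
        (simp add: filterlim_inverse_at_top_right divide_inverse)
    then have r: "((\<lambda>h. flat p h / h) \<longlongrightarrow> 0) (at_right 0)"
      by (rule Lim_transform_eventually)
        (auto simp: flat_def poly_monom eventually_at_right_less elim!: eventually_mono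
          intro!: eventually_at_rightI[of 0 1])
    have l: "((\<lambda>h. flat p h / h) \<longlongrightarrow> 0) (at_left 0)"
      by (rule Lim_transform_eventually[OF tendsto_const])
        (auto simp: flat_def intro!: eventually_at_leftI[of "-1" 0])
    have "((\<lambda>h. flat p h / h) \<longlongrightarrow> 0) (at 0)"
      using l r by (simp add: filterlim_at_split)
    then show ?thesis using 3 by (simp add: DERIV_def flat_def)
  qed
qed

inductive elementary :: "(real \<Rightarrow> real) \<Rightarrow> bool" where
  const: "elementary (\<lambda>x. c)"
| flat: "elementary (\<lambda>x. flat p (c * x + d))"
| sin: "elementary (\<lambda>x. sin (c * x + d))"
| add: "elementary f \<Longrightarrow> elementary g \<Longrightarrow> elementary (\<lambda>x. f x + g x)"
| mult: "elementary f \<Longrightarrow> elementary g \<Longrightarrow> elementary (\<lambda>x. f x * g x)"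

lemma elementary_derivative:
  "elementary f \<Longrightarrow> \<exists>f'. elementary f' \<and> (\<forall>x. (f has_real_derivative f' x) (at x))"
proof (induction rule: elementary.induct)
  case (const c)
  show ?case by (intro exI[of _ "\<lambda>x. 0"]) (auto intro: elementary.const)
next
  case (flat p c d)
  have "((\<lambda>x. flat p (c * x + d)) has_real_derivative flat (monom 1 2 * (p - pderiv p)) (c * x + d) * c) (at x)" for x
    by (rule DERIV_chain2[OF flat_has_derivative]) (auto intro!: derivative_eq_intros)
  then show ?case
    by (intro exI[of _ "\<lambda>x. flat (monom 1 2 * (p - pderiv p)) (c * x + d) * c"])
      (auto intro: elementary.intros)
next
  case (sin c d)
  have "((\<lambda>x. sin (c * x + d)) has_real_derivative c * sin (c * x + (d + pi / 2))) (at x)" for x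
    by (auto intro!: derivative_eq_intros simp: sin_add cos_add algebra_simps)
  then show ?case
    by (intro exI[of _ "\<lambda>x. c * sin (c * x + (d + pi / 2))"]) (auto intro: elementary.intros)
next
  case (add f g)
  then obtain f' g' where "elementary f'" "elementary g'"
    "\<And>x. (f has_real_derivative f' x) (at x)" "\<And>x. (g has_real_derivative g' x) (at x)" by blast
  then show ?case
    by (intro exI[of _ "\<lambda>x. f' x + g' x"]) (auto intro: elementary.intros intro!: derivative_intros)
next
  case (mult f g)
  then obtain f' g' where *: "elementary f'" "elementary g'"
    "\<And>x. (f has_real_derivative f' x) (at x)" "\<And>x. (g has_real_derivative g' x) (at x)" by blast
  then have "((\<lambda>x. f x * g x) has_real_derivative f' x * g x + g' x * f x) (at x)" for x
    by (intro DERIV_mult) auto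
  then show ?case using * mult
    by (intro exI[of _ "\<lambda>x. f' x * g x + g' x * f x"]) (auto intro: elementary.intros)
qed

lemma elementary_deriv: "elementary f \<Longrightarrow> elementary (deriv f)"
  using elementary_derivative[of f] by (metis DERIV_imp_deriv ext)

lemma elementary_has_deriv: "elementary f \<Longrightarrow> (f has_real_derivative deriv f x) (at x)"
  using elementary_derivative[of f] by (metis DERIV_imp_deriv)

lemma elementary_test_function:
  assumes "elementary f" "0 < a" "b < 1" "\<And>x. x \<notin> {a..b} \<Longrightarrow> f x = 0"
  shows "test_function f"
proof -
  have "elementary ((deriv ^^ k) f)" for k
    by (induction k) (auto simp: assms elementary_deriv)
  then have "(deriv ^^ k) f differentiable at x" for k x
    using elementary_has_deriv real_differentiable_def by blast
  then show ?thesis using assms by (auto simp: test_function_def)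
qed

lemma test_function_has_deriv:
  assumes "test_function f"
  shows "(f has_real_derivative deriv f x) (at x)" "(deriv f has_real_derivative deriv (deriv f) x) (at x)"
proof -
  have "((deriv ^^ 0) f) differentiable at x" "((deriv ^^ 1) f) differentiable at x"
    using assms unfolding test_function_def by blast+
  then show "(f has_real_derivative deriv f x) (at x)" "(deriv f has_real_derivative deriv (deriv f) x) (at x)"
    by (simp_all add: DERIV_deriv_iff_real_differentiable)
qed

lemma test_function_boundary:
  assumes "test_function f" shows "f 0 = 0" "f 1 = 0"
  using assms unfolding test_function_def by auto

lemma flat_1_bounds: "0 \<le> flat 1 x" "flat 1 x \<le> 1"
  by (auto simp: flat_def)

lemma flat_1_tendsto:
  assumes "c > 0" shows "(\<lambda>j. flat 1 (real j * c - d)) \<longlonglongrightarrow> 1"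
proof -
  have *: "filterlim (\<lambda>j. real j * c - d) at_top sequentially"
    using assms by real_asymp
  have "(\<lambda>j. exp (- 1 / (real j * c - d))) \<longlonglongrightarrow> 1"
    using assms by real_asymp
  then show ?thesis
    by (rule Lim_transform_eventually)
      (use filterlim_at_top_dense[THEN iffD1, OF *, rule_format, of 0] in
        \<open>auto simp: flat_def elim!: eventually_mono\<close>)
qed

subsection \<open>Square integrable functions and their classes\<close>

lemma finite_measure_leb01: "finite_measure leb01"
  by (rule finite_measure_lebesgue_on) auto

lemma integrable_leb01_bounded:
  fixes f :: "real \<Rightarrow> real"
  assumes "f \<in> borel_measurable leb01" "\<And>x. x \<in> {0<..<1} \<Longrightarrow> \<bar>f x\<bar> \<le> C"
  shows "integrable leb01 f"
  using assms by (intro finite_measure.integrable_const_bound[OF finite_measure_leb01, of _ C]) auto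

lemma square_integrable_bounded:
  assumes "f \<in> borel_measurable leb01" "\<And>x. x \<in> {0<..<1} \<Longrightarrow> \<bar>f x\<bar> \<le> C"
  shows "square_integrable f"
proof -
  have "\<bar>(f x)\<^sup>2\<bar> \<le> C\<^sup>2" if "x \<in> {0<..<1}" for x
    using assms(2)[OF that] by (metis abs_ge_zero abs_power2 power2_abs power_mono)
  then show ?thesis
    using assms by (auto simp: square_integrable_def intro!: integrable_leb01_bounded[of _ "C\<^sup>2"])
qed

lemma borel_measurable_leb01:
  fixes f :: "real \<Rightarrow> real"
  shows "f \<in> borel_measurable borel \<Longrightarrow> f \<in> borel_measurable leb01"
  by (simp add: measurable_completion measurable_restrict_space1)

lemma continuous_on_measurable_leb01:
  fixes f :: "real \<Rightarrow> real"
  assumes "continuous_on {0..1} f" shows "f \<in> borel_measurable leb01"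
  by (rule continuous_imp_measurable_on_sets_lebesgue)
    (auto intro: continuous_on_subset[OF assms])

lemma square_integrable_continuous:
  fixes f :: "real \<Rightarrow> real"
  assumes "continuous_on {0..1} f" shows "square_integrable f"
proof -
  have "bounded (f ` {0..1})"
    by (intro compact_imp_bounded compact_continuous_image assms) auto
  then obtain C where "\<forall>x\<in>{0..1}. \<bar>f x\<bar> \<le> C"
    unfolding bounded_iff by auto
  then show ?thesis
    by (intro square_integrable_bounded[of _ C] continuous_on_measurable_leb01 assms) auto
qed

lemma square_integrable_imp_integrable: "square_integrable f \<Longrightarrow> integrable leb01 f"
  using square_integrable_mult[of f "\<lambda>x. 1"] square_integrable_continuous[of "\<lambda>x. 1"] by simp

lemma L2_cases:
  obtains f where "square_integrable f" "u = abs_L2 f"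
proof -
  have "L2_rel (rep_L2 u) (rep_L2 u)"
    by (rule Quotient_rep_reflp[OF Quotient_L2])
  moreover have "abs_L2 (rep_L2 u) = u" by (rule Quotient_abs_rep[OF Quotient_L2])
  ultimately show ?thesis using that by (auto simp: L2_rel_def)
qed

lemma abs_L2_eqI:
  assumes "square_integrable f" "square_integrable g" "AE x in leb01. f x = g x"
  shows "abs_L2 f = abs_L2 g"
  using assms by (intro Quotient_rel_abs[OF Quotient_L2]) (simp add: L2_rel_def)

lemma abs_L2_eqD:
  assumes "square_integrable f" "square_integrable g" "abs_L2 f = abs_L2 g"
  shows "AE x in leb01. f x = g x"
  using assms Quotient_rel[OF Quotient_L2, of f g] by (simp add: L2_rel_def)

lemma square_integrable_rep: "square_integrable (rep_L2 u)"
  using Quotient_rep_reflp[OF Quotient_L2, of u] by (simp add: L2_rel_def)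

lemma abs_rep_L2: "abs_L2 (rep_L2 u) = u"
  by (rule Quotient_abs_rep[OF Quotient_L2])

lemma abs_L2_add:
  assumes "square_integrable f" "square_integrable g"
  shows "abs_L2 f + abs_L2 g = abs_L2 (\<lambda>x. f x + g x)"
  using assms by (intro plus_L2.abs_eq) (auto simp: L2_rel_def)

lemma abs_L2_diff:
  assumes "square_integrable f" "square_integrable g"
  shows "abs_L2 f - abs_L2 g = abs_L2 (\<lambda>x. f x - g x)"
  using assms by (intro minus_L2.abs_eq) (auto simp: L2_rel_def)

lemma abs_L2_uminus:
  assumes "square_integrable f"
  shows "- abs_L2 f = abs_L2 (\<lambda>x. - f x)"
  using assms by (intro uminus_L2.abs_eq) (auto simp: L2_rel_def)

lemma abs_L2_scaleR:
  assumes "square_integrable f"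
  shows "c *\<^sub>R abs_L2 f = abs_L2 (\<lambda>x. c * f x)"
  using assms by (intro scaleR_L2.abs_eq) (auto simp: L2_rel_def)

lemma abs_L2_0: "abs_L2 (\<lambda>x. 0) = 0"
  by (simp add: zero_L2_def)

lemma square_integrable_sum:
  assumes "\<And>i. i \<in> I \<Longrightarrow> square_integrable (f i)"
  shows "square_integrable (\<lambda>x. \<Sum>i\<in>I. f i x)"
  using assms
  by (induction I rule: infinite_finite_induct) (auto simp: square_integrable_0 intro: square_integrable_add)

lemma abs_L2_sum:
  assumes "\<And>i. i \<in> I \<Longrightarrow> square_integrable (f i)"
  shows "(\<Sum>i\<in>I. abs_L2 (f i)) = abs_L2 (\<lambda>x. \<Sum>i\<in>I. f i x)"
  using assms
  by (induction I rule: infinite_finite_induct)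
    (auto simp: abs_L2_0 abs_L2_add square_integrable_sum)

lemma inner_abs_L2:
  assumes "square_integrable f" "square_integrable g"
  shows "inner (abs_L2 f) (abs_L2 g) = (LINT x|leb01. f x * g x)"
  using assms by (intro inner_L2.abs_eq) (auto simp: L2_rel_def)

lemma norm_abs_L2:
  assumes "square_integrable f"
  shows "(norm (abs_L2 f))\<^sup>2 = (LINT x|leb01. (f x)\<^sup>2)"
  using inner_abs_L2[OF assms assms] unfolding power2_norm_eq_inner by (simp add: power2_eq_square)

lemma abs_L2_tendsto:
  assumes f: "\<And>j. f j \<in> borel_measurable leb01" "\<And>j x. x \<in> {0<..<1} \<Longrightarrow> \<bar>f j x\<bar> \<le> C"
    and g: "g \<in> borel_measurable leb01"
    and lim: "AE x in leb01. (\<lambda>j. f j x) \<longlonglongrightarrow> g x"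
  shows "square_integrable g" "(\<lambda>j. abs_L2 (f j)) \<longlonglongrightarrow> abs_L2 g"
proof -
  have sf: "square_integrable (f j)" for j
    using f by (intro square_integrable_bounded[of _ C]) auto
  have gC: "AE x in leb01. \<bar>g x\<bar> \<le> C"
    using lim AE_space
  proof eventually_elim
    case (elim x)
    then have "(\<lambda>j. \<bar>f j x\<bar>) \<longlonglongrightarrow> \<bar>g x\<bar>" by (intro tendsto_rabs) auto
    then show ?case using f(2)[of x] elim by (intro LIMSEQ_le_const2[of _ "\<bar>g x\<bar>" C]) auto
  qed
  then have "AE x in leb01. norm ((g x)\<^sup>2) \<le> C\<^sup>2"
  proof eventually_elim
    case (elim x)
    then show ?case by (metis abs_ge_zero norm_power power_mono real_norm_def)
  qed
  then show sg: "square_integrable g"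
    using g by (auto simp: square_integrable_def
        intro!: finite_measure.integrable_const_bound[OF finite_measure_leb01, of _ "C\<^sup>2"])
  have "(\<lambda>j. LINT x|leb01. (f j x - g x)\<^sup>2) \<longlonglongrightarrow> (LINT x|leb01. 0)"
  proof (rule integral_dominated_convergence[where w="\<lambda>x. (2 * C)\<^sup>2"])
    show "integrable leb01 (\<lambda>x. (2 * C)\<^sup>2)"
      using finite_measure.integrable_const[OF finite_measure_leb01] by blast
    show "AE x in leb01. (\<lambda>j. (f j x - g x)\<^sup>2) \<longlonglongrightarrow> 0"
      using lim by eventually_elim (auto intro!: tendsto_eq_intros)
    show "AE x in leb01. norm ((f j x - g x)\<^sup>2) \<le> (2 * C)\<^sup>2" for j
      using gC AE_space
    proof eventually_elim
      case (elim x)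
      then have "\<bar>f j x - g x\<bar> \<le> 2 * C" using f(2)[of x j] by auto
      then show ?case by (metis abs_ge_zero norm_power power_mono real_norm_def)
    qed
  qed (use f g in auto)
  then have "(\<lambda>j. (norm (abs_L2 (f j) - abs_L2 g))\<^sup>2) \<longlonglongrightarrow> 0"
    by (simp add: abs_L2_diff sf sg norm_abs_L2 square_integrable_diff)
  then have "(\<lambda>j. norm (abs_L2 (f j) - abs_L2 g)) \<longlonglongrightarrow> 0"
    using tendsto_real_sqrt[of "\<lambda>j. (norm (abs_L2 (f j) - abs_L2 g))\<^sup>2" 0] by simp
  then show "(\<lambda>j. abs_L2 (f j)) \<longlonglongrightarrow> abs_L2 g"
    by (simp add: LIM_zero_iff tendsto_norm_zero_iff)
qed

lemma test_function_square_integrable: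
  assumes "test_function f"
  shows "square_integrable f" "square_integrable (deriv f)"
  using test_function_has_deriv[OF assms]
  by (auto intro!: square_integrable_continuous continuous_at_imp_continuous_on DERIV_isCont)

lemma elementary_continuous_on: "elementary f \<Longrightarrow> continuous_on S f"
  using elementary_has_deriv by (auto intro!: continuous_at_imp_continuous_on DERIV_isCont)

subsection \<open>Uniqueness of weak derivatives\<close>

lemma orthogonal_test_functions_imp_0:
  assumes u: "\<And>\<phi>. test_function \<phi> \<Longrightarrow> inner u (abs_L2 \<phi>) = 0"
  shows "u = 0"
proof -
  obtain f where f: "square_integrable f" "u = abs_L2 f" by (rule L2_cases)
  have fi: "integrable leb01 f" using f by (simp add: square_integrable_imp_integrable)
  have int0: "integral {a..b} f = 0" if ab: "0 < a" "b < 1" for a b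
  proof -
    define \<phi> where "\<phi> = (\<lambda>(j::nat) x. flat 1 (real j * (x - a)) * flat 1 (real j * (b - x)))"
    have el: "elementary (\<phi> j)" for j
    proof -
      have "elementary (\<lambda>x. flat 1 (real j * x + (- real j * a)) * flat 1 (- real j * x + real j * b))"
        by (intro elementary.intros)
      then show ?thesis by (simp add: \<phi>_def algebra_simps)
    qed
    have "test_function (\<phi> j)" for j
      by (rule elementary_test_function[OF el ab])
        (auto simp: \<phi>_def flat_def zero_less_mult_iff)
    then have "inner u (abs_L2 (\<phi> j)) = 0" for j by (rule u)
    moreover
    have 1: "\<phi> j \<in> borel_measurable leb01" for j
      by (intro continuous_on_measurable_leb01 elementary_continuous_on el)
    have 2: "\<bar>\<phi> j x\<bar> \<le> 1" for j x
      using flat_1_bounds by (auto simp: \<phi>_def abs_mult intro!: mult_le_one)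
    have "(\<lambda>j. \<phi> j x) \<longlonglongrightarrow> indicator {a<..<b} x" for x
    proof (cases "x \<in> {a<..<b}")
      case True
      then have "(\<lambda>j. \<phi> j x) \<longlonglongrightarrow> 1 * 1"
        unfolding \<phi>_def using flat_1_tendsto[of "x - a" 0] flat_1_tendsto[of "b - x" 0]
        by (intro tendsto_mult) auto
      then show ?thesis using True by simp
    next
      case False
      then have "\<phi> j x = 0" for j by (auto simp: \<phi>_def flat_def zero_less_mult_iff)
      then show ?thesis using False by simp
    qed
    then have 3: "AE x in leb01. (\<lambda>j. \<phi> j x) \<longlonglongrightarrow> indicator {a<..<b} x" by simp
    have "indicat_real {a<..<b} \<in> borel_measurable leb01" by (intro borel_measurable_leb01) simp
    note i = abs_L2_tendsto[of \<phi> 1, OF 1 2 this 3]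
    ultimately have "inner u (abs_L2 (indicator {a<..<b})) = 0"
      using tendsto_inner[OF tendsto_const i(2), of u] by (simp add: LIMSEQ_const_iff)
    then have "(LINT x|leb01. f x * indicator {a<..<b} x) = 0"
      by (simp add: f inner_abs_L2 i)
    moreover have "integrable leb01 (\<lambda>x. f x * indicator {a<..<b} x)"
      using square_integrable_mult[OF f(1) i(1)] .
    ultimately have "integral {0<..<1} (\<lambda>x. f x * indicator {a<..<b} x) = 0"
      by (simp add: lebesgue_integral_eq_integral)
    moreover have "integral {0<..<1} (\<lambda>x. f x * indicator {a<..<b} x) = integral {a<..<b} f"
    proof -
      have "(\<lambda>x. f x * indicat_real {a<..<b} x) = (\<lambda>x. if x \<in> {a<..<b} then f x else 0)"
        by (auto simp: indicator_def)
      moreover have "{a<..<b} \<inter> {0<..<1} = {a<..<b}" using ab by auto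
      ultimately show ?thesis by (simp only: integral_restrict_Int)
    qed
    moreover have "integral {a<..<b} f = integral {a..b} f"
      using integral_open_interval[of a b f] by simp
    ultimately show ?thesis by simp
  qed
  define \<alpha> where "\<alpha> m = 1 / real (m + 2)" for m
  have \<alpha>: "0 < \<alpha> m" for m by (simp add: \<alpha>_def)
  have negl: "negligible {x\<in>{\<alpha> m<..<1 - \<alpha> m}. f x \<noteq> 0}" for m
  proof -
    have "f integrable_on {0<..<1}"
      using fi by (intro integrable_on_lebesgue_on) auto
    then have "f integrable_on {\<alpha> m..1 - \<alpha> m}"
      by (rule integrable_on_subinterval) (use \<alpha>[of m] in auto)
    from indefinite_integral_has_derivative_AE[OF this] obtain N where N: "negligible N"
      "\<And>t. t\<in>{\<alpha> m<..<1 - \<alpha> m} - N \<Longrightarrow> ((\<lambda>t. integral {\<alpha> m..t} f) has_real_derivative f t) (at t)"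
      by blast
    have "f t = 0" if t: "t\<in>{\<alpha> m<..<1 - \<alpha> m} - N" for t
    proof -
      have "((\<lambda>t. 0) has_real_derivative f t) (at t)"
      proof (rule has_field_derivative_transform_within_open[OF N(2)[OF t], of "{\<alpha> m<..<1 - \<alpha> m}"])
        fix x assume "x \<in> {\<alpha> m<..<1 - \<alpha> m}"
        then have "x < 1" using \<alpha>[of m] by simp
        then show "integral {\<alpha> m..x} f = 0" using \<alpha>[of m] by (intro int0)
      qed (use t in auto)
      then show ?thesis using DERIV_unique DERIV_const by blast
    qed
    then show ?thesis by (intro negligible_subset[OF N(1)]) auto
  qed
  have "{x\<in>{0<..<1}. f x \<noteq> 0} = (\<Union>m. {x\<in>{\<alpha> m<..<1 - \<alpha> m}. f x \<noteq> 0})"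
  proof (intro equalityI subsetI)
    fix x assume x: "x \<in> {x\<in>{0<..<1}. f x \<noteq> 0}"
    then obtain m where "1 / real (Suc m) < min x (1 - x)" using nat_approx_posE[of "min x (1 - x)"] by auto
    moreover have "\<alpha> m \<le> 1 / real (Suc m)" unfolding \<alpha>_def by (intro divide_left_mono) auto
    ultimately show "x \<in> (\<Union>m. {x\<in>{\<alpha> m<..<1 - \<alpha> m}. f x \<noteq> 0})"
      using x by (auto intro!: exI[of _ m])
  next
    fix x assume "x \<in> (\<Union>m. {x\<in>{\<alpha> m<..<1 - \<alpha> m}. f x \<noteq> 0})"
    then show "x \<in> {x\<in>{0<..<1}. f x \<noteq> 0}"
      using \<alpha> by (auto intro: less_trans)
  qed
  moreover have "negligible (\<Union>m. {x\<in>{\<alpha> m<..<1 - \<alpha> m}. f x \<noteq> 0})"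
    using negl by (intro negligible_countable_Union) auto
  ultimately have "negligible {x\<in>{0<..<1}. f x \<noteq> 0}" by simp
  then have "AE x in lebesgue. x \<in> {0<..<1} \<longrightarrow> f x = 0"
    by (intro AE_I'[of "{x\<in>{0<..<1}. f x \<noteq> 0}"]) (auto simp: negligible_iff_null_sets)
  then have "AE x in leb01. f x = 0" by (simp add: AE_restrict_space_iff)
  then show ?thesis using f by (auto simp: abs_L2_0[symmetric] intro!: abs_L2_eqI square_integrable_0)
qed

lemma weak_deriv_eqI:
  assumes "has_weak_deriv u w" shows "weak_deriv u = w"
  unfolding weak_deriv_def
proof (rule the_equality[where P="has_weak_deriv u", OF assms])
  fix w' assume "has_weak_deriv u w'"
  then have "w' - w = 0"
    using assms by (intro orthogonal_test_functions_imp_0) (simp add: has_weak_deriv_def inner_diff_left)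
  then show "w' = w" by simp
qed

subsection \<open>Completeness of $L^2(0,1)$ and orthonormal bases\<close>

lemma L2_convergent_of_geometric:
  fixes X :: "nat \<Rightarrow> L2"
  assumes X: "\<And>k. norm (X (Suc k) - X k) \<le> (1 / 2) ^ k"
  shows "convergent X"
proof -
  define f where "f = (\<lambda>k. rep_L2 (X k))"
  define d where "d = (\<lambda>k x. \<bar>f (Suc k) x - f k x\<bar>)"
  define S where "S = (\<lambda>N x. \<Sum>k<N. d k x)"
  have sf: "square_integrable (f k)" for k by (simp add: f_def square_integrable_rep)
  have [measurable]: "f k \<in> borel_measurable leb01" for k
    using sf by (simp add: square_integrable_def)
  have [measurable]: "d k \<in> borel_measurable leb01" for k by (simp add: d_def)
  have sd: "square_integrable (d k)" for k
    using square_integrable_diff[OF sf sf, of "Suc k" k] by (simp add: square_integrable_def d_def)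
  have nd: "norm (abs_L2 (d k)) \<le> (1 / 2) ^ k" for k
  proof -
    have "(norm (abs_L2 (d k)))\<^sup>2 = (norm (abs_L2 (f (Suc k)) - abs_L2 (f k)))\<^sup>2"
      using norm_abs_L2[OF sd[of k]] by (simp add: norm_abs_L2 sf abs_L2_diff square_integrable_diff d_def)
    then have "norm (abs_L2 (d k)) = norm (X (Suc k) - X k)"
      by (simp add: f_def abs_rep_L2)
    then show ?thesis using X by simp
  qed
  have sS: "square_integrable (S N)" for N
    unfolding S_def by (intro square_integrable_sum sd)
  have [measurable]: "S N \<in> borel_measurable leb01" for N
    using sS by (simp add: square_integrable_def)
  have "norm (abs_L2 (S N)) \<le> 2" for N
  proof -
    have "norm (abs_L2 (S N)) = norm (\<Sum>k<N. abs_L2 (d k))"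
      unfolding S_def by (subst abs_L2_sum) (auto intro: sd)
    also have "\<dots> \<le> (\<Sum>k<N. (1 / 2) ^ k)"
      by (intro sum_norm_le nd)
    also have "\<dots> \<le> (\<Sum>k. (1 / 2) ^ k)"
      by (intro sum_le_suminf) (auto intro: summable_geometric)
    also have "\<dots> = 2" by (subst suminf_geometric) auto
    finally show ?thesis .
  qed
  then have "(norm (abs_L2 (S N)))\<^sup>2 \<le> 2\<^sup>2" for N
    by (intro power_mono) auto
  then have "(LINT x|leb01. (S N x)\<^sup>2) \<le> 4" for N
    by (simp add: norm_abs_L2 sS)
  then have nn: "(\<integral>\<^sup>+x. ennreal ((S N x)\<^sup>2) \<partial>leb01) \<le> ennreal 4" for N
    using sS[of N] by (subst nn_integral_eq_integral) (auto simp: square_integrable_def simp del: ennreal_numeral intro!: ennreal_leI)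
  have S0: "0 \<le> S N x" for N x by (auto simp: S_def d_def intro: sum_nonneg)
  have Smono: "S N x \<le> S M x" if "N \<le> M" for N M x
    unfolding S_def using that by (intro sum_mono2) (auto simp: d_def)
  define G where "G = (\<lambda>x. SUP N. ennreal ((S N x)\<^sup>2))"
  have inc: "incseq (\<lambda>N. ennreal ((S N x)\<^sup>2))" for x
    by (intro incseq_SucI ennreal_leI power_mono Smono S0) auto
  have "(\<integral>\<^sup>+x. G x \<partial>leb01) = (SUP N. \<integral>\<^sup>+x. ennreal ((S N x)\<^sup>2) \<partial>leb01)"
    unfolding G_def using inc
    by (intro nn_integral_monotone_convergence_SUP) (auto simp: incseq_def le_fun_def)
  also have "\<dots> \<le> ennreal 4" by (intro SUP_least nn)
  finally have G4: "(\<integral>\<^sup>+x. G x \<partial>leb01) \<le> ennreal 4" .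
  have [measurable]: "G \<in> borel_measurable leb01" unfolding G_def by measurable
  have "(\<integral>\<^sup>+x. G x \<partial>leb01) \<noteq> \<infinity>" using G4 by (auto simp: top_unique)
  then have Gfin: "AE x in leb01. G x \<noteq> \<infinity>"
    by (intro nn_integral_PInf_AE) auto
  have summ: "summable (\<lambda>k. d k x)" and Sle: "ennreal ((\<Sum>k. d k x)\<^sup>2) \<le> G x" if "G x \<noteq> \<infinity>" for x
  proof -
    have le: "(S N x)\<^sup>2 \<le> enn2real (G x)" for N
    proof -
      have "ennreal ((S N x)\<^sup>2) \<le> G x" unfolding G_def by (rule SUP_upper) simp
      then show ?thesis using that by (metis ennreal_enn2real_if ennreal_le_iff enn2real_nonneg infinity_ennreal_def)
    qed
    show s: "summable (\<lambda>k. d k x)"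
    proof (rule summableI_nonneg_bounded)
      show "(\<Sum>k<N. d k x) \<le> sqrt (enn2real (G x))" for N
        using le[of N] by (intro real_le_rsqrt) (simp add: S_def)
    qed (simp add: d_def)
    have "(\<lambda>N. ennreal ((S N x)\<^sup>2)) \<longlonglongrightarrow> ennreal ((\<Sum>k. d k x)\<^sup>2)"
      using summable_LIMSEQ[OF s] unfolding S_def by (intro tendsto_ennrealI tendsto_power)
    then show "ennreal ((\<Sum>k. d k x)\<^sup>2) \<le> G x"
      by (rule LIMSEQ_le_const2) (auto simp: G_def intro!: SUP_upper exI[of _ 0])
  qed
  define D where "D = (\<lambda>x. \<Sum>k. d k x)"
  have [measurable]: "D \<in> borel_measurable leb01" unfolding D_def by measurable
  have D2: "integrable leb01 (\<lambda>x. (D x)\<^sup>2)"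
  proof (rule integrableI_bounded)
    have "(\<integral>\<^sup>+x. ennreal (norm ((D x)\<^sup>2)) \<partial>leb01) \<le> (\<integral>\<^sup>+x. G x \<partial>leb01)"
      using Gfin by (intro nn_integral_mono_AE) (auto simp: D_def Sle elim!: eventually_mono)
    also have "\<dots> \<le> ennreal 4" by (rule G4)
    finally show "(\<integral>\<^sup>+x. ennreal (norm ((D x)\<^sup>2)) \<partial>leb01) < \<infinity>" by (auto simp: le_less_trans)
  qed simp
  define F where "F = (\<lambda>x. lim (\<lambda>k. f k x))"
  have F[measurable]: "F \<in> borel_measurable leb01" unfolding F_def by measurable
  have lim: "(\<lambda>k. f k x) \<longlonglongrightarrow> F x" and bd: "\<bar>f N x - F x\<bar> \<le> D x" if "G x \<noteq> \<infinity>" for x N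
  proof -
    have sm: "summable (\<lambda>k. f (Suc k) x - f k x)"
      using summ[OF that] by (intro summable_rabs_cancel[of "\<lambda>k. f (Suc k) x - f k x"]) (simp add: d_def)
    have "convergent (\<lambda>n. \<Sum>k<n. f (Suc k) x - f k x)"
      using sm by (simp add: summable_iff_convergent)
    then have "convergent (\<lambda>n. f n x - f 0 x)" by (simp add: sum_lessThan_telescope[of "\<lambda>k. f k x"])
    then have "convergent (\<lambda>n. (f n x - f 0 x) + f 0 x)" by (intro convergent_add convergent_const)
    then show l: "(\<lambda>k. f k x) \<longlonglongrightarrow> F x" by (simp add: F_def convergent_LIMSEQ_iff)
    have "\<bar>f M x - f N x\<bar> \<le> D x" if "N \<le> M" for M
    proof -
      have "f M x - f N x = (\<Sum>k=N..<M. f (Suc k) x - f k x)"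
        using that by (simp add: sum_Suc_diff'[of N M "\<lambda>k. f k x"])
      also have "\<bar>\<dots>\<bar> \<le> (\<Sum>k=N..<M. d k x)" unfolding d_def by (rule sum_abs)
      also have "\<dots> \<le> D x" unfolding D_def
        by (intro sum_le_suminf summ \<open>G x \<noteq> \<infinity>\<close>) (auto simp: d_def)
      finally show ?thesis .
    qed
    then have "\<bar>F x - f N x\<bar> \<le> D x"
      by (intro LIMSEQ_le_const2[OF tendsto_rabs[OF tendsto_diff[OF l tendsto_const]]]) auto
    then show "\<bar>f N x - F x\<bar> \<le> D x" by (simp add: abs_minus_commute)
  qed
  have bd2: "(f N x - F x)\<^sup>2 \<le> (D x)\<^sup>2" if "G x \<noteq> \<infinity>" for x N
    using bd[OF that, of N] by (metis abs_ge_zero power2_abs power_mono)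
  have "integrable leb01 (\<lambda>x. (f 0 x - F x)\<^sup>2)"
    by (rule Bochner_Integration.integrable_bound[OF D2])
      (use Gfin in \<open>auto elim!: eventually_mono simp: bd2\<close>)
  then have "square_integrable (\<lambda>x. f 0 x - F x)" by (simp add: square_integrable_def)
  from square_integrable_diff[OF sf[of 0] this] have sF: "square_integrable F" by simp
  have "(\<lambda>k. LINT x|leb01. (f k x - F x)\<^sup>2) \<longlonglongrightarrow> (LINT x|leb01. 0)"
  proof (rule integral_dominated_convergence[where w="\<lambda>x. (D x)\<^sup>2"])
    show "AE x in leb01. (\<lambda>k. (f k x - F x)\<^sup>2) \<longlonglongrightarrow> 0"
      using Gfin
    proof eventually_elim
      case (elim x)
      have "(\<lambda>k. (f k x - F x)\<^sup>2) \<longlonglongrightarrow> (F x - F x)\<^sup>2"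
        by (intro tendsto_intros lim elim)
      then show ?case by simp
    qed
    show "AE x in leb01. norm ((f k x - F x)\<^sup>2) \<le> (D x)\<^sup>2" for k
      using Gfin by eventually_elim (simp add: bd2)
  qed (use D2 in auto)
  then have "(\<lambda>k. (norm (X k - abs_L2 F))\<^sup>2) \<longlonglongrightarrow> 0"
  proof -
    have "X k - abs_L2 F = abs_L2 (\<lambda>x. f k x - F x)" for k
      using abs_L2_diff[OF sf[of k] sF] by (simp add: f_def abs_rep_L2)
    then show ?thesis using \<open>_ \<longlonglongrightarrow> (LINT x|leb01. 0)\<close>
      by (simp add: norm_abs_L2 square_integrable_diff sf sF)
  qed
  then have "(\<lambda>k. norm (X k - abs_L2 F)) \<longlonglongrightarrow> 0"
    using tendsto_real_sqrt[of "\<lambda>k. (norm (X k - abs_L2 F))\<^sup>2" 0] by simp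
  then have "X \<longlonglongrightarrow> abs_L2 F"
    by (simp add: LIM_zero_iff tendsto_norm_zero_iff)
  then show ?thesis by (rule convergentI)
qed

instance L2 :: complete_space
proof
  fix X :: "nat \<Rightarrow> L2" assume X: "Cauchy X"
  then have "\<forall>k. \<exists>N. \<forall>m\<ge>N. \<forall>n\<ge>N. norm (X m - X n) < (1 / 2) ^ k"
    by (auto simp: Cauchy_iff)
  then obtain N where N: "\<And>k m n. m \<ge> N k \<Longrightarrow> n \<ge> N k \<Longrightarrow> norm (X m - X n) < (1 / 2) ^ k"
    by metis
  define M where "M = (\<lambda>k. (\<Sum>i\<le>k. N i) + k)"
  have M: "strict_mono M" by (auto simp: strict_mono_Suc_iff M_def)
  have NM: "N k \<le> M k" "N k \<le> M (Suc k)" for k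
    using member_le_sum[of k "{..k}" N] by (auto simp: M_def)
  have "convergent (\<lambda>k. X (M k))"
    by (rule L2_convergent_of_geometric) (intro less_imp_le N NM)
  then obtain L where "(\<lambda>k. X (M k)) \<longlonglongrightarrow> L" by (auto simp: convergent_def)
  then have "X \<longlonglongrightarrow> L" using Cauchy_converges_subseq[OF X M, of L] by (simp add: o_def)
  then show "convergent X" by (rule convergentI)
qed

instance L2 :: banach ..

locale orthonormal_basis =
  fixes e :: "nat \<Rightarrow> 'a :: {real_inner, banach}"
  assumes orthonormal: "inner (e i) (e j) = (if i = j then 1 else 0)"
    and total: "(\<And>k. inner u (e k) = 0) \<Longrightarrow> u = 0"
begin

lemma inner_sum_basis: "finite I \<Longrightarrow> inner (\<Sum>i\<in>I. c i *\<^sub>R e i) (e k) = (if k \<in> I then c k else 0)"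
  by (simp add: inner_sum_left orthonormal if_distrib sum.delta cong: if_cong)

lemma norm_sum_basis: "finite I \<Longrightarrow> (norm (\<Sum>i\<in>I. c i *\<^sub>R e i))\<^sup>2 = (\<Sum>i\<in>I. (c i)\<^sup>2)"
  unfolding power2_norm_eq_inner
  by (subst inner_sum_right) (simp add: inner_sum_basis power2_eq_square)

lemma riesz_fischer:
  assumes "summable (\<lambda>k. (c k)\<^sup>2)"
  obtains w where "\<And>k. inner w (e k) = c k" "(\<lambda>k. c k *\<^sub>R e k) sums w"
proof -
  have "summable (\<lambda>k. c k *\<^sub>R e k)"
    unfolding summable_Cauchy
  proof (intro allI impI)
    fix \<epsilon> :: real assume \<epsilon>: "\<epsilon> > 0"
    then obtain N where N: "\<And>m n. m \<ge> N \<Longrightarrow> norm (\<Sum>k=m..<n. (c k)\<^sup>2) < \<epsilon>\<^sup>2"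
      using assms unfolding summable_Cauchy by (meson zero_less_power)
    have "norm (\<Sum>k=m..<n. c k *\<^sub>R e k) < \<epsilon>" if "m \<ge> N" for m n
    proof -
      have "(norm (\<Sum>k=m..<n. c k *\<^sub>R e k))\<^sup>2 < \<epsilon>\<^sup>2"
        using N[OF that, of n] by (simp add: norm_sum_basis sum_nonneg)
      then show ?thesis using \<epsilon> by (simp add: power_less_imp_less_base)
    qed
    then show "\<exists>N. \<forall>m\<ge>N. \<forall>n. norm (\<Sum>k=m..<n. c k *\<^sub>R e k) < \<epsilon>" by blast
  qed
  then obtain w where w: "(\<lambda>k. c k *\<^sub>R e k) sums w" by (auto simp: summable_def)
  have "inner w (e k) = c k" for k
  proof -
    have "(\<lambda>n. inner (\<Sum>i<n. c i *\<^sub>R e i) (e k)) \<longlonglongrightarrow> inner w (e k)"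
      using w unfolding sums_def by (intro tendsto_inner tendsto_const)
    moreover have "(\<lambda>n. inner (\<Sum>i<n. c i *\<^sub>R e i) (e k)) \<longlonglongrightarrow> c k"
      by (rule tendsto_eventually, rule eventually_sequentiallyI[of "Suc k"]) (simp add: inner_sum_basis)
    ultimately show ?thesis by (rule LIMSEQ_unique)
  qed
  then show ?thesis using that w by blast
qed

lemma bessel: "(\<Sum>k<n. (inner u (e k))\<^sup>2) \<le> (norm u)\<^sup>2"
proof -
  let ?s = "\<Sum>k<n. inner u (e k) *\<^sub>R e k"
  have us: "inner u ?s = (\<Sum>k<n. (inner u (e k))\<^sup>2)"
    by (simp add: inner_sum_right power2_eq_square)
  have "0 \<le> inner (u - ?s) (u - ?s)" by simp
  also have "\<dots> = inner u u - 2 * inner u ?s + inner ?s ?s"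
    by (simp add: inner_diff_left inner_diff_right inner_commute)
  also have "inner ?s ?s = (\<Sum>k<n. (inner u (e k))\<^sup>2)"
    using norm_sum_basis[of "{..<n}" "\<lambda>k. inner u (e k)"] by (simp only: power2_norm_eq_inner finite_lessThan)
  finally show ?thesis by (simp add: us power2_norm_eq_inner)
qed

lemma summable_coeff: "summable (\<lambda>k. (inner u (e k))\<^sup>2)"
  by (rule summableI_nonneg_bounded[of _ "(norm u)\<^sup>2"]) (auto intro: bessel)

lemma eqI: "(\<And>k. inner u (e k) = inner w (e k)) \<Longrightarrow> u = w"
  using total[of "u - w"] by (simp add: inner_diff_left)

lemma expansion: "(\<lambda>k. inner u (e k) *\<^sub>R e k) sums u"
proof -
  obtain w where "\<And>k. inner w (e k) = inner u (e k)" "(\<lambda>k. inner u (e k) *\<^sub>R e k) sums w"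
    using riesz_fischer[OF summable_coeff] by blast
  then show ?thesis using eqI[of w u] by simp
qed

lemma parseval: "(\<lambda>k. inner u (e k) * inner w (e k)) sums inner u w"
proof -
  have "(\<lambda>k. inner (inner u (e k) *\<^sub>R e k) w) sums inner u w"
    by (rule bounded_linear.sums[OF bounded_linear_inner_left expansion])
  then show ?thesis by (simp add: inner_commute)
qed

lemma parseval_norm: "(\<lambda>k. (inner u (e k))\<^sup>2) sums (norm u)\<^sup>2"
  using parseval[of u u] unfolding power2_norm_eq_inner by (simp add: power2_eq_square)

end

subsection \<open>The sine basis\<close>

definition freq :: "nat \<Rightarrow> real" where "freq k = real (Suc k) * pi"

definition mu :: "nat \<Rightarrow> real" where "mu k = (freq k)\<^sup>2"

definition sine :: "nat \<Rightarrow> real \<Rightarrow> real" where "sine k x = sqrt 2 * sin (freq k * x)"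

definition cosine :: "nat \<Rightarrow> real \<Rightarrow> real" where "cosine k x = sqrt 2 * cos (freq k * x)"

abbreviation Sine :: "nat \<Rightarrow> L2" where "Sine k \<equiv> abs_L2 (sine k)"

abbreviation Cosine :: "nat \<Rightarrow> L2" where "Cosine k \<equiv> abs_L2 (cosine k)"

lemma freq_pos [simp]: "0 < freq k" by (simp add: freq_def)

lemma freq_nz [simp]: "freq k \<noteq> 0" using freq_pos[of k] by linarith

lemma freq_ge: "real (Suc k) \<le> freq k"
  unfolding freq_def using pi_gt3 by (intro mult_le_cancel_left1[THEN iffD2]) auto

lemma freq_ge_1: "1 \<le> freq k" using freq_ge[of k] by simp

lemma mu_pos [simp]: "0 < mu k" by (simp add: mu_def)

lemma mu_nz [simp]: "mu k \<noteq> 0" using mu_pos[of k] by linarith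

lemma mu_ge: "(real (Suc k))\<^sup>2 \<le> mu k"
  unfolding mu_def using freq_ge[of k] by (intro power_mono) auto

lemma mu_ge_1: "1 \<le> mu k"
  using freq_ge_1[of k] by (simp add: mu_def one_le_power)

lemma summable_inverse_mu: "summable (\<lambda>k. 1 / mu k)"
proof (rule summable_comparison_test')
  show "summable (\<lambda>k. inverse (real (Suc k) ^ 2))"
    by (rule iffD2[OF summable_Suc_iff inverse_power_summable]) simp
  show "norm (1 / mu k) \<le> inverse (real (Suc k) ^ 2)" if "k \<ge> 0" for k
    using frac_le[of 1 1 "real (Suc k) ^ 2" "mu k"] mu_ge[of k] mu_pos[of k] by (simp add: inverse_eq_divide abs_of_pos del: of_nat_Suc)
qed

lemma sine_bound: "\<bar>sine k x\<bar> \<le> 2"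
proof -
  have "\<bar>sin (freq k * x)\<bar> \<le> 1" by simp
  then have "\<bar>sine k x\<bar> \<le> sqrt 2 * 1" unfolding sine_def abs_mult by (intro mult_mono) auto
  moreover have "sqrt 2 \<le> 2" by (rule real_le_lsqrt) auto
  ultimately show ?thesis by simp
qed

lemma cosine_bound: "\<bar>cosine k x\<bar> \<le> 2"
proof -
  have "\<bar>cos (freq k * x)\<bar> \<le> 1" by simp
  then have "\<bar>cosine k x\<bar> \<le> sqrt 2 * 1" unfolding cosine_def abs_mult by (intro mult_mono) auto
  moreover have "sqrt 2 \<le> 2" by (rule real_le_lsqrt) auto
  ultimately show ?thesis by simp
qed

lemma sine_deriv: "(sine k has_real_derivative freq k * cosine k x) (at x)"
  unfolding sine_def[abs_def] cosine_def by (auto intro!: derivative_eq_intros)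

lemma cosine_deriv: "(cosine k has_real_derivative - freq k * sine k x) (at x)"
  unfolding cosine_def[abs_def] sine_def by (auto intro!: derivative_eq_intros)

lemma sine_boundary [simp]: "sine k 0 = 0" "sine k 1 = 0"
  by (auto simp: sine_def freq_def simp del: of_nat_Suc)

lemma continuous_on_sine [continuous_intros]: "continuous_on S (sine k)"
  unfolding sine_def[abs_def] by (intro continuous_intros)

lemma continuous_on_cosine [continuous_intros]: "continuous_on S (cosine k)"
  unfolding cosine_def[abs_def] by (intro continuous_intros)

lemma borel_measurable_sine [measurable]: "sine k \<in> borel_measurable borel"
  by (intro borel_measurable_continuous_onI continuous_intros)

lemma elementary_sine: "elementary (sine k)"
  using elementary.mult[OF elementary.const[of "sqrt 2"] elementary.sin[of "freq k" 0]]
  by (simp add: sine_def[abs_def])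

lemma square_integrable_sine: "square_integrable (sine k)" "square_integrable (cosine k)"
  by (auto intro!: square_integrable_continuous continuous_intros)

lemma LINT_leb01_eqI:
  fixes f :: "real \<Rightarrow> real"
  assumes "integrable leb01 f" "(f has_integral I) {0..1}"
  shows "(LINT x|leb01. f x) = I"
proof -
  have "(LINT x|leb01. f x) = integral {0<..<1} f"
    by (rule lebesgue_integral_eq_integral) (use assms in auto)
  also have "\<dots> = integral {0..1} f" using integral_open_interval[of 0 1 f] by simp
  finally show ?thesis using assms by (simp add: integral_unique)
qed

lemma LINT_leb01_FTC:
  fixes F f :: "real \<Rightarrow> real"
  assumes "\<And>x. x \<in> {0..1} \<Longrightarrow> (F has_real_derivative f x) (at x)" "continuous_on {0..1} f"
  shows "(LINT x|leb01. f x) = F 1 - F 0"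
proof (rule LINT_leb01_eqI)
  show "integrable leb01 f"
    using assms by (intro square_integrable_imp_integrable square_integrable_continuous)
  show "(f has_integral F 1 - F 0) {0..1}"
    using assms by (intro fundamental_theorem_of_calculus)
      (auto simp flip: has_real_derivative_iff_has_vector_derivative intro: DERIV_subset)
qed

lemma sin_freq_diff [simp]: "sin (freq i - freq j) = 0" "sin (freq i + freq j) = 0"
proof -
  have "freq i - freq j = real_of_int (int i - int j) * pi" "freq i + freq j = real_of_int (int i + int j + 2) * pi"
    by (simp_all add: freq_def algebra_simps)
  then show "sin (freq i - freq j) = 0" "sin (freq i + freq j) = 0"
    by (metis sin_times_pi_eq_0 Ints_of_int)+
qed

lemma sine_mult: "sine i x * sine j x = 2 * (sin (freq i * x) * sin (freq j * x))"
proof -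
  have "sine i x * sine j x = (sqrt 2 * sqrt 2) * (sin (freq i * x) * sin (freq j * x))"
    unfolding sine_def by (simp only: mult_ac)
  then show ?thesis by simp
qed

lemma inner_Sine_Sine: "inner (Sine i) (Sine j) = (if i = j then 1 else 0)"
proof -
  have "inner (Sine i) (Sine j) = (LINT x|leb01. sine i x * sine j x)"
    by (intro inner_abs_L2 square_integrable_sine)
  also have "\<dots> = (if i = j then 1 else 0)"
  proof (cases "i = j")
    case True
    let ?F = "\<lambda>x. x - sin (2 * freq i * x) / (2 * freq i)"
    have "(LINT x|leb01. sine i x * sine j x) = ?F 1 - ?F 0"
    proof (rule LINT_leb01_FTC)
      fix x
      have "sine i x * sine j x = 1 - cos (2 * freq i * x)"
        unfolding True sine_mult using cos_double_sin[of "freq j * x"]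
        by (simp add: power2_eq_square mult.assoc)
      then show "(?F has_real_derivative sine i x * sine j x) (at x)"
        by (auto intro!: derivative_eq_intros)
    qed (intro continuous_intros)
    moreover have "sin (2 * freq i) = 0"
      using sin_freq_diff(2)[of i i] by (simp only: mult_2)
    ultimately show ?thesis using True by simp
  next
    case False
    then have ne: "freq i - freq j \<noteq> 0" by (simp add: freq_def)
    have ne': "freq i + freq j \<noteq> 0" using freq_pos[of i] freq_pos[of j] by linarith
    let ?F = "\<lambda>x. sin ((freq i - freq j) * x) / (freq i - freq j) - sin ((freq i + freq j) * x) / (freq i + freq j)"
    have "(LINT x|leb01. sine i x * sine j x) = ?F 1 - ?F 0"
    proof (rule LINT_leb01_FTC)
      fix x
      have "sine i x * sine j x = cos ((freq i - freq j) * x) - cos ((freq i + freq j) * x)"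
        by (simp add: sine_mult cos_add cos_diff left_diff_distrib distrib_right)
      then show "(?F has_real_derivative sine i x * sine j x) (at x)"
        using ne ne' by (auto intro!: derivative_eq_intros)
    qed (intro continuous_intros)
    then show ?thesis using False by simp
  qed
  finally show ?thesis .
qed

definition sine_poly :: "(real \<Rightarrow> real) \<Rightarrow> bool" where
  "sine_poly p \<longleftrightarrow> (\<exists>N b. (\<forall>k\<ge>N. b k = 0) \<and> (\<forall>x. p x = (\<Sum>k<N. b k * sine k x)))"

lemma sine_poly_sine: "sine_poly (\<lambda>x. c * sine k x)"
  unfolding sine_poly_def
  by (rule exI[of _ "Suc k"], rule exI[of _ "\<lambda>i. if i = k then c else 0"])
    (simp add: if_distrib[of "\<lambda>y. y * _"] cong: if_cong)

lemma sine_poly_add: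
  assumes "sine_poly p" "sine_poly q" shows "sine_poly (\<lambda>x. p x + q x)"
proof -
  obtain N b M c where N: "\<forall>k\<ge>N. b k = 0" "\<forall>x. p x = (\<Sum>k<N. b k * sine k x)"
    and M: "\<forall>k\<ge>M. c k = 0" "\<forall>x. q x = (\<Sum>k<M. c k * sine k x)"
    using assms unfolding sine_poly_def by metis
  have "p x = (\<Sum>k<max N M. b k * sine k x)" for x
    unfolding N(2)[rule_format] using N(1) by (intro sum.mono_neutral_left) auto
  moreover have "q x = (\<Sum>k<max N M. c k * sine k x)" for x
    unfolding M(2)[rule_format] using M(1) by (intro sum.mono_neutral_left) auto
  ultimately have "p x + q x = (\<Sum>k<max N M. (b k + c k) * sine k x)" for x
    by (simp add: sum.distrib distrib_right)
  moreover have "\<forall>k\<ge>max N M. b k + c k = 0" using N M by auto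
  ultimately show ?thesis unfolding sine_poly_def
    by (intro exI[of _ "max N M"] exI[of _ "\<lambda>k. b k + c k"]) simp
qed

lemma sine_poly_sum:
  assumes "\<And>i. i \<in> I \<Longrightarrow> sine_poly (p i)" shows "sine_poly (\<lambda>x. \<Sum>i\<in>I. p i x)"
  using assms
proof (induction I rule: infinite_finite_induct)
  case (insert i I)
  then show ?case by (auto intro: sine_poly_add)
qed (use sine_poly_sine[of 0] in auto)

lemma sine_poly_cmult:
  assumes "sine_poly p" shows "sine_poly (\<lambda>x. c * p x)"
proof -
  obtain N b where "\<forall>x. p x = (\<Sum>k<N. b k * sine k x)" using assms unfolding sine_poly_def by metis
  then have "(\<lambda>x. c * p x) = (\<lambda>x. \<Sum>k<N. (c * b k) * sine k x)"
    by (simp add: sum_distrib_left mult.assoc)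
  then show ?thesis using sine_poly_sum[OF sine_poly_sine] by simp
qed

lemma sine_poly_times_cos:
  assumes "sine_poly p" shows "sine_poly (\<lambda>x. p x * cos (pi * x))"
proof -
  obtain N b where N: "\<forall>x. p x = (\<Sum>k<N. b k * sine k x)" using assms unfolding sine_poly_def by metis
  have "sine_poly (\<lambda>x. b k * sine k x * cos (pi * x))" for k
  proof -
    define s where "s = (\<lambda>x. if k = 0 then 0 * sine 0 x else (b k / 2) * sine (k - 1) x)"
    have "sine_poly s" unfolding s_def using sine_poly_sine[of 0 0] sine_poly_sine[of "b k / 2" "k - 1"] by (cases "k = 0") simp_all
    moreover have "b k * sine k x * cos (pi * x) = (b k / 2) * sine (Suc k) x + s x" for x
    proof -
      have "sin (freq (Suc k) * x) = sin (freq k * x + pi * x)"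
        by (simp add: freq_def algebra_simps)
      moreover have "s x = (b k / 2) * (sqrt 2 * sin (freq k * x - pi * x))"
        by (cases k) (auto simp: s_def sine_def freq_def algebra_simps)
      ultimately show ?thesis by (simp add: sine_def sin_add sin_diff algebra_simps)
    qed
    ultimately show ?thesis using sine_poly_add[OF sine_poly_sine[of "b k / 2" "Suc k"]] by simp
  qed
  then have "sine_poly (\<lambda>x. \<Sum>k<N. b k * sine k x * cos (pi * x))" by (intro sine_poly_sum)
  then show ?thesis using N by (simp add: sum_distrib_right)
qed

lemma sine_poly_sin_times_poly_cos: "sine_poly (\<lambda>x. sin (pi * x) * (\<Sum>i\<le>n. a i * cos (pi * x) ^ i))"
proof -
  have "sine_poly (\<lambda>x. sin (pi * x) * cos (pi * x) ^ i)" for i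
  proof (induction i)
    case 0
    have "sin (pi * x) = (1 / sqrt 2) * sine 0 x" for x by (simp add: sine_def freq_def)
    then show ?case using sine_poly_sine[of "1 / sqrt 2" 0] by simp
  next
    case (Suc i)
    show ?case using sine_poly_times_cos[OF Suc] by (simp add: mult_ac)
  qed
  then have "sine_poly (\<lambda>x. \<Sum>i\<le>n. a i * (sin (pi * x) * cos (pi * x) ^ i))"
    by (intro sine_poly_sum sine_poly_cmult)
  then show ?thesis by (simp add: sum_distrib_left mult.left_commute)
qed

lemma sine_poly_approximation:
  assumes q: "continuous_on {0..1} q" and \<epsilon>: "\<epsilon> > 0"
  shows "\<exists>p. sine_poly p \<and> (\<forall>x\<in>{0..1}. \<bar>p x - sin (pi * x) * q x\<bar> \<le> \<epsilon> * sin (pi * x))"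
proof -
  define Q where "Q = (\<lambda>y. q (arccos y / pi))"
  have arc: "arccos y / pi \<in> {0..1}" if "y \<in> {-1..1}" for y
    using that arccos_lbound[of y] arccos_ubound[of y] by auto
  have "continuous_on {-1..1} Q"
    unfolding Q_def using arc
    by (intro continuous_on_compose2[OF q] continuous_intros continuous_on_arccos') auto
  then obtain g where g: "real_polynomial_function g" "\<And>y. y \<in> {-1..1} \<Longrightarrow> \<bar>Q y - g y\<bar> < \<epsilon>"
    using Stone_Weierstrass_real_polynomial_function[of "{-1..1}" Q \<epsilon>] \<epsilon> by auto
  then obtain a n where an: "g = (\<lambda>x. \<Sum>i\<le>n. a i * x ^ i)"
    using real_polynomial_function_iff_sum by blast
  have "\<bar>sin (pi * x) * g (cos (pi * x)) - sin (pi * x) * q x\<bar> \<le> \<epsilon> * sin (pi * x)" if x: "x \<in> {0..1}" for x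
  proof -
    have "arccos (cos (pi * x)) = pi * x" using x by (intro arccos_cos) (auto simp: mult_left_le)
    then have "Q (cos (pi * x)) = q x" by (simp add: Q_def)
    then have "\<bar>g (cos (pi * x)) - q x\<bar> \<le> \<epsilon>"
      using g(2)[of "cos (pi * x)"] by (simp add: abs_minus_commute)
    moreover have "0 \<le> sin (pi * x)" using x by (intro sin_ge_zero) (auto simp: mult_left_le)
    ultimately have "sin (pi * x) * \<bar>g (cos (pi * x)) - q x\<bar> \<le> sin (pi * x) * \<epsilon>"
      by (intro mult_left_mono)
    moreover have "\<bar>sin (pi * x) * g (cos (pi * x)) - sin (pi * x) * q x\<bar> =
        sin (pi * x) * \<bar>g (cos (pi * x)) - q x\<bar>"
      using abs_mult[of "sin (pi * x)" "g (cos (pi * x)) - q x"] \<open>0 \<le> sin (pi * x)\<close>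
      by (simp add: right_diff_distrib)
    ultimately show ?thesis by (simp add: mult.commute)
  qed
  then show ?thesis using sine_poly_sin_times_poly_cos[of a n] unfolding an by blast
qed

lemma Sine_total:
  assumes u: "\<And>k. inner u (Sine k) = 0" shows "u = 0"
proof -
  obtain f where f: "square_integrable f" "u = abs_L2 f" by (rule L2_cases)
  have [measurable]: "f \<in> borel_measurable leb01" using f by (simp add: square_integrable_def)
  have fi: "integrable leb01 f" using f by (simp add: square_integrable_imp_integrable)
  have sine0: "(LINT x|leb01. f x * sine k x) = 0" for k
    using u[of k] by (simp add: f inner_abs_L2 square_integrable_sine)
  have si: "integrable leb01 (\<lambda>x. f x * sine k x)" for k
    by (intro square_integrable_mult f square_integrable_sine)
  have poly0: "(LINT x|leb01. f x * p x) = 0" "integrable leb01 (\<lambda>x. f x * p x)" if sp: "sine_poly p" for p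
  proof -
    obtain N b where p: "\<And>x. p x = (\<Sum>k<N. b k * sine k x)" using sp unfolding sine_poly_def by blast
    have "f x * p x = (\<Sum>k<N. b k * (f x * sine k x))" for x
      unfolding p sum_distrib_left by (intro sum.cong) simp_all
    then show "(LINT x|leb01. f x * p x) = 0" "integrable leb01 (\<lambda>x. f x * p x)"
      using si sine0 by simp_all
  qed
  have cont0: "(LINT x|leb01. f x * (sin (pi * x) * q x)) = 0" if q: "continuous_on {0..1} q" for q
  proof (rule ccontr)
    let ?I = "LINT x|leb01. f x * (sin (pi * x) * q x)"
    assume ne: "?I \<noteq> 0"
    define L where "L = (LINT x|leb01. \<bar>f x\<bar>)"
    have L: "0 \<le> L" by (simp add: L_def)
    define \<epsilon> where "\<epsilon> = \<bar>?I\<bar> / (2 * (L + 1))"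
    have \<epsilon>: "\<epsilon> > 0" unfolding \<epsilon>_def using ne L by (intro divide_pos_pos) (simp_all add: add_nonneg_pos)
    obtain p where p: "sine_poly p" "\<And>x. x\<in>{0..1} \<Longrightarrow> \<bar>p x - sin (pi * x) * q x\<bar> \<le> \<epsilon> * sin (pi * x)"
      using sine_poly_approximation[OF q \<epsilon>] by blast
    have qi: "integrable leb01 (\<lambda>x. f x * (sin (pi * x) * q x))"
      by (intro square_integrable_mult f square_integrable_continuous continuous_intros q)
    have "?I = (LINT x|leb01. f x * (sin (pi * x) * q x) - f x * p x)"
      using poly0[OF p(1)] qi by simp
    also have "\<bar>\<dots>\<bar> \<le> (LINT x|leb01. \<bar>f x * (sin (pi * x) * q x) - f x * p x\<bar>)"
      by (rule integral_abs_bound)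
    also have "\<dots> \<le> (LINT x|leb01. \<epsilon> * \<bar>f x\<bar>)"
    proof (rule integral_mono)
      fix x assume x: "x \<in> space leb01"
      have "\<bar>f x * (sin (pi * x) * q x) - f x * p x\<bar> = \<bar>f x\<bar> * \<bar>p x - sin (pi * x) * q x\<bar>"
        using abs_mult[of "f x" "p x - sin (pi * x) * q x"] by (simp add: right_diff_distrib abs_minus_commute)
      also have "\<dots> \<le> \<bar>f x\<bar> * \<epsilon>"
      proof (intro mult_left_mono)
        have "\<epsilon> * sin (pi * x) \<le> \<epsilon>" using \<epsilon> by (intro mult_left_le) auto
        then show "\<bar>p x - sin (pi * x) * q x\<bar> \<le> \<epsilon>" using p(2)[of x] x by auto
      qed simp
      finally show "\<bar>f x * (sin (pi * x) * q x) - f x * p x\<bar> \<le> \<epsilon> * \<bar>f x\<bar>" by (simp add: mult.commute)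
    qed (use poly0[OF p(1)] qi fi in auto)
    also have "\<dots> = \<epsilon> * L" by (simp add: L_def)
    also have "\<dots> \<le> \<bar>?I\<bar> / 2"
    proof -
      have "\<epsilon> * L \<le> \<epsilon> * (L + 1)" using \<epsilon> by simp
      also have "\<dots> = \<bar>?I\<bar> / 2" using L by (simp add: \<epsilon>_def field_simps add_nonneg_eq_0_iff)
      finally show ?thesis .
    qed
    finally show False using ne by simp
  qed
  define h where "h = (\<lambda>x. f x * sin (pi * x))"
  have sin_meas: "(\<lambda>x. sin (pi * x)) \<in> borel_measurable leb01"
    by (intro borel_measurable_leb01) measurable
  have [measurable]: "h \<in> borel_measurable leb01"
    unfolding h_def by (intro borel_measurable_times sin_meas) measurable
  have "integrable leb01 (\<lambda>x. (h x)\<^sup>2)"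
  proof (rule Bochner_Integration.integrable_bound)
    show "integrable leb01 (\<lambda>x. (f x)\<^sup>2)" using f by (simp add: square_integrable_def)
    show "AE x in leb01. norm ((h x)\<^sup>2) \<le> norm ((f x)\<^sup>2)"
      by (auto simp: h_def power_mult_distrib abs_square_le_1 intro!: AE_I2 mult_left_le)
    show "(\<lambda>x. (h x)\<^sup>2) \<in> borel_measurable leb01" by measurable
  qed
  then have sh: "square_integrable h" by (simp add: square_integrable_def)
  have "abs_L2 h = 0"
  proof (rule orthogonal_test_functions_imp_0)
    fix \<phi> assume "test_function \<phi>"
    then have "continuous_on {0..1} \<phi>" "square_integrable \<phi>"
      using test_function_has_deriv test_function_square_integrable
      by (auto intro!: continuous_at_imp_continuous_on DERIV_isCont)
    then show "inner (abs_L2 h) (abs_L2 \<phi>) = 0"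
      using cont0 by (simp add: inner_abs_L2 sh) (simp add: h_def mult.assoc)
  qed
  then have "AE x in leb01. h x = 0"
    using abs_L2_eqD[OF sh square_integrable_0] by (simp add: abs_L2_0)
  then have "AE x in leb01. f x = 0"
    using AE_space
  proof eventually_elim
    case (elim x)
    then have "0 < sin (pi * x)" by (intro sin_gt_zero) auto
    then show ?case using elim by (simp add: h_def)
  qed
  then show ?thesis using f by (auto simp: abs_L2_0[symmetric] intro!: abs_L2_eqI square_integrable_0)
qed

interpretation Sine: orthonormal_basis Sine
  by unfold_locales (auto simp: inner_Sine_Sine intro: Sine_total)

subsection \<open>Spectral description of the Dirichlet Laplacian\<close>

lemma freq_nonneg [simp]: "0 \<le> freq k" "\<bar>freq k\<bar> = freq k"
  using freq_pos[of k] by linarith+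

lemma has_weak_deriv_C1:
  assumes "\<And>x. (f has_real_derivative f' x) (at x)" "continuous_on {0..1} f'"
  shows "has_weak_deriv (abs_L2 f) (abs_L2 f')"
  unfolding has_weak_deriv_def
proof (intro allI impI)
  fix \<phi> assume \<phi>: "test_function \<phi>"
  have cf: "continuous_on {0..1} f"
    using assms(1) by (auto intro!: continuous_at_imp_continuous_on DERIV_isCont)
  have c\<phi>: "continuous_on {0..1} \<phi>" "continuous_on {0..1} (deriv \<phi>)"
    using test_function_has_deriv[OF \<phi>] by (auto intro!: continuous_at_imp_continuous_on DERIV_isCont)
  have s: "square_integrable f" "square_integrable f'" "square_integrable \<phi>" "square_integrable (deriv \<phi>)"
    using cf c\<phi> assms by (auto intro: square_integrable_continuous)
  have "(LINT x|leb01. f x * deriv \<phi> x + f' x * \<phi> x) = f 1 * \<phi> 1 - f 0 * \<phi> 0"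
  proof (rule LINT_leb01_FTC)
    fix x
    show "((\<lambda>x. f x * \<phi> x) has_real_derivative f x * deriv \<phi> x + f' x * \<phi> x) (at x)"
      using DERIV_mult[OF assms(1)[of x] test_function_has_deriv(1)[OF \<phi>, of x]] by (simp add: mult.commute add.commute)
  qed (intro continuous_intros cf c\<phi> assms)
  then show "inner (abs_L2 f) (abs_L2 (deriv \<phi>)) = - inner (abs_L2 f') (abs_L2 \<phi>)"
    using test_function_boundary[OF \<phi>] square_integrable_mult[OF s(1,4)] square_integrable_mult[OF s(2,3)]
    by (simp add: inner_abs_L2 s)
qed

lemma has_weak_deriv_Sine: "has_weak_deriv (Sine k) (freq k *\<^sub>R Cosine k)"
  unfolding abs_L2_scaleR[OF square_integrable_sine(2)]
  by (intro has_weak_deriv_C1 sine_deriv continuous_intros)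

lemma has_weak_deriv_Cosine: "has_weak_deriv (Cosine k) (- freq k *\<^sub>R Sine k)"
  unfolding abs_L2_scaleR[OF square_integrable_sine(1)]
  by (intro has_weak_deriv_C1 cosine_deriv continuous_intros)

lemma has_weak_deriv_scaleR: "has_weak_deriv u w \<Longrightarrow> has_weak_deriv (c *\<^sub>R u) (c *\<^sub>R w)"
  by (simp add: has_weak_deriv_def)

lemma has_weak_deriv_sums:
  assumes "\<And>k. has_weak_deriv (a k) (b k)" "a sums u" "b sums w"
  shows "has_weak_deriv u w"
  unfolding has_weak_deriv_def
proof (intro allI impI)
  fix \<phi> assume \<phi>: "test_function \<phi>"
  have "(\<lambda>k. inner (a k) (abs_L2 (deriv \<phi>))) sums inner u (abs_L2 (deriv \<phi>))"
    by (rule bounded_linear.sums[OF bounded_linear_inner_left assms(2)])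
  moreover have "(\<lambda>k. - inner (b k) (abs_L2 \<phi>)) sums - inner w (abs_L2 \<phi>)"
    by (intro sums_minus bounded_linear.sums[OF bounded_linear_inner_left assms(3)])
  moreover have "inner (a k) (abs_L2 (deriv \<phi>)) = - inner (b k) (abs_L2 \<phi>)" for k
    using assms(1)[of k] \<phi> by (simp add: has_weak_deriv_def)
  ultimately show "inner u (abs_L2 (deriv \<phi>)) = - inner w (abs_L2 \<phi>)"
    using sums_unique2 by simp
qed

definition compact_elementary :: "(real \<Rightarrow> real) \<Rightarrow> bool" where
  "compact_elementary \<phi> \<longleftrightarrow> elementary \<phi> \<and> (\<exists>a b. 0 < a \<and> b < 1 \<and> (\<forall>x. x \<notin> {a..b} \<longrightarrow> \<phi> x = 0))"

definition H10_limit :: "L2 \<Rightarrow> L2 \<Rightarrow> bool" where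
  "H10_limit u w \<longleftrightarrow> (\<forall>\<epsilon>>0. \<exists>\<phi>. compact_elementary \<phi> \<and>
     norm (abs_L2 \<phi> - u) < \<epsilon> \<and> norm (abs_L2 (deriv \<phi>) - w) < \<epsilon>)"

lemma compact_elementary_test_function: "compact_elementary \<phi> \<Longrightarrow> test_function \<phi>"
  unfolding compact_elementary_def using elementary_test_function by blast

lemma compact_elementary_add:
  assumes "compact_elementary \<phi>" "compact_elementary \<psi>"
  shows "compact_elementary (\<lambda>x. \<phi> x + \<psi> x)"
proof -
  obtain a b c d where "0 < a" "b < 1" "\<forall>x. x \<notin> {a..b} \<longrightarrow> \<phi> x = 0"
    "0 < c" "d < 1" "\<forall>x. x \<notin> {c..d} \<longrightarrow> \<psi> x = 0"
    using assms unfolding compact_elementary_def by blast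
  then have "0 < min a c \<and> max b d < 1 \<and> (\<forall>x. x \<notin> {min a c..max b d} \<longrightarrow> \<phi> x + \<psi> x = 0)"
    by (auto simp: min_le_iff_disj le_max_iff_disj)
  then show ?thesis using assms unfolding compact_elementary_def
    by (blast intro: elementary.add)
qed

lemma compact_elementary_cmult:
  assumes "compact_elementary \<phi>" shows "compact_elementary (\<lambda>x. c * \<phi> x)"
proof -
  obtain a b where *: "0 < a" "b < 1" "\<forall>x. x \<notin> {a..b} \<longrightarrow> \<phi> x = 0" and el: "elementary \<phi>"
    using assms unfolding compact_elementary_def by blast
  have "\<forall>x. x \<notin> {a..b} \<longrightarrow> c * \<phi> x = 0" using * by simp
  then show ?thesis unfolding compact_elementary_def
    by (intro conjI elementary.mult[OF elementary.const el] exI[of _ a] exI[of _ b] *)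
qed

lemma H10_limit_add:
  assumes "H10_limit u w" "H10_limit u' w'" shows "H10_limit (u + u') (w + w')"
  unfolding H10_limit_def
proof (intro allI impI)
  fix \<epsilon> :: real assume "\<epsilon> > 0"
  then have e2: "\<epsilon> / 2 > 0" by simp
  obtain \<phi> where \<phi>: "compact_elementary \<phi>" "norm (abs_L2 \<phi> - u) < \<epsilon> / 2" "norm (abs_L2 (deriv \<phi>) - w) < \<epsilon> / 2"
    using assms(1)[unfolded H10_limit_def, rule_format, OF e2] by blast
  obtain \<psi> where \<psi>: "compact_elementary \<psi>" "norm (abs_L2 \<psi> - u') < \<epsilon> / 2" "norm (abs_L2 (deriv \<psi>) - w') < \<epsilon> / 2"
    using assms(2)[unfolded H10_limit_def, rule_format, OF e2] by blast
  note s = test_function_square_integrable[OF compact_elementary_test_function]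
  have d: "deriv (\<lambda>x. \<phi> x + \<psi> x) = (\<lambda>x. deriv \<phi> x + deriv \<psi> x)"
    using \<phi>(1) \<psi>(1) unfolding compact_elementary_def
    by (intro ext DERIV_imp_deriv DERIV_add elementary_has_deriv) auto
  have "norm (abs_L2 (\<lambda>x. \<phi> x + \<psi> x) - (u + u')) < \<epsilon>"
    using norm_add_less[OF \<phi>(2) \<psi>(2)] s[OF \<phi>(1)] s[OF \<psi>(1)]
    by (simp add: abs_L2_add[symmetric] algebra_simps)
  moreover have "norm (abs_L2 (deriv (\<lambda>x. \<phi> x + \<psi> x)) - (w + w')) < \<epsilon>"
    using norm_add_less[OF \<phi>(3) \<psi>(3)] s[OF \<phi>(1)] s[OF \<psi>(1)]
    unfolding d by (simp add: abs_L2_add[symmetric] algebra_simps)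
  ultimately show "\<exists>\<phi>. compact_elementary \<phi> \<and> norm (abs_L2 \<phi> - (u + u')) < \<epsilon> \<and>
      norm (abs_L2 (deriv \<phi>) - (w + w')) < \<epsilon>"
    using compact_elementary_add[OF \<phi>(1) \<psi>(1)] by blast
qed

lemma H10_limit_0: "H10_limit 0 0"
proof -
  have "compact_elementary (\<lambda>x. 0)"
    unfolding compact_elementary_def using elementary.const[of 0]
    by (auto intro!: exI[of _ "1/2"])
  moreover have "deriv (\<lambda>x. 0::real) = (\<lambda>x. 0)" by (simp add: deriv_const[abs_def] fun_eq_iff)
  ultimately show ?thesis unfolding H10_limit_def
    by (auto intro!: exI[of _ "\<lambda>x. 0"] simp: abs_L2_0)
qed

lemma H10_limit_scaleR:
  assumes "H10_limit u w" shows "H10_limit (c *\<^sub>R u) (c *\<^sub>R w)"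
  unfolding H10_limit_def
proof (intro allI impI)
  fix \<epsilon> :: real assume "\<epsilon> > 0"
  then have e2: "\<epsilon> / (\<bar>c\<bar> + 1) > 0" by simp
  obtain \<phi> where \<phi>: "compact_elementary \<phi>" "norm (abs_L2 \<phi> - u) < \<epsilon> / (\<bar>c\<bar> + 1)"
      "norm (abs_L2 (deriv \<phi>) - w) < \<epsilon> / (\<bar>c\<bar> + 1)"
    using assms(1)[unfolded H10_limit_def, rule_format, OF e2] by blast
  note s = test_function_square_integrable[OF compact_elementary_test_function[OF \<phi>(1)]]
  have d: "deriv (\<lambda>x. c * \<phi> x) = (\<lambda>x. c * deriv \<phi> x)"
    using \<phi>(1) unfolding compact_elementary_def
    by (intro ext DERIV_imp_deriv DERIV_cmult elementary_has_deriv) auto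
  have small: "norm (c *\<^sub>R v) < \<epsilon>" if "norm v < \<epsilon> / (\<bar>c\<bar> + 1)" for v :: L2
  proof -
    have "norm (c *\<^sub>R v) \<le> (\<bar>c\<bar> + 1) * norm v" by (simp add: distrib_right)
    also have "\<dots> < (\<bar>c\<bar> + 1) * (\<epsilon> / (\<bar>c\<bar> + 1))"
      using that by (intro mult_strict_left_mono) auto
    also have "\<dots> = \<epsilon>" by (simp add: add_nonneg_eq_0_iff)
    finally show ?thesis .
  qed
  have "norm (abs_L2 (\<lambda>x. c * \<phi> x) - c *\<^sub>R u) < \<epsilon>"
    using small[OF \<phi>(2)] s by (simp add: abs_L2_scaleR[symmetric] scaleR_diff_right)
  moreover have "norm (abs_L2 (deriv (\<lambda>x. c * \<phi> x)) - c *\<^sub>R w) < \<epsilon>"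
    unfolding d using small[OF \<phi>(3)] s by (simp add: abs_L2_scaleR[symmetric] scaleR_diff_right)
  ultimately show "\<exists>\<phi>. compact_elementary \<phi> \<and> norm (abs_L2 \<phi> - c *\<^sub>R u) < \<epsilon> \<and>
      norm (abs_L2 (deriv \<phi>) - c *\<^sub>R w) < \<epsilon>"
    using compact_elementary_cmult[OF \<phi>(1)] by blast
qed

lemma H10_limit_sum:
  assumes "\<And>i. i \<in> I \<Longrightarrow> H10_limit (u i) (w i)"
  shows "H10_limit (\<Sum>i\<in>I. u i) (\<Sum>i\<in>I. w i)"
  using assms by (induction I rule: infinite_finite_induct) (auto intro: H10_limit_0 H10_limit_add)

lemma H10_limit_closed:
  assumes "\<And>n. H10_limit (u n) (w n)" "u \<longlonglongrightarrow> u'" "w \<longlonglongrightarrow> w'"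
  shows "H10_limit u' w'"
  unfolding H10_limit_def
proof (intro allI impI)
  fix \<epsilon> :: real assume "\<epsilon> > 0"
  then have e2: "\<epsilon> / 2 > 0" by simp
  have "\<forall>\<^sub>F n in sequentially. dist (u n) u' < \<epsilon> / 2 \<and> dist (w n) w' < \<epsilon> / 2"
    using tendstoD[OF assms(2) e2] tendstoD[OF assms(3) e2] by eventually_elim simp
  then obtain n where n: "norm (u n - u') < \<epsilon> / 2" "norm (w n - w') < \<epsilon> / 2"
    unfolding eventually_sequentially dist_norm by blast
  obtain \<phi> where \<phi>: "compact_elementary \<phi>" "norm (abs_L2 \<phi> - u n) < \<epsilon> / 2" "norm (abs_L2 (deriv \<phi>) - w n) < \<epsilon> / 2"
    using assms(1)[of n, unfolded H10_limit_def, rule_format, OF e2] by blast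
  show "\<exists>\<phi>. compact_elementary \<phi> \<and> norm (abs_L2 \<phi> - u') < \<epsilon> \<and> norm (abs_L2 (deriv \<phi>) - w') < \<epsilon>"
    using norm_add_less[OF \<phi>(2) n(1)] norm_add_less[OF \<phi>(3) n(2)] \<phi>(1) by auto
qed

lemma H10_limit_sequence:
  assumes "H10_limit u w"
  obtains \<phi> where "\<And>j. test_function (\<phi> j)" "(\<lambda>j. abs_L2 (\<phi> j)) \<longlonglongrightarrow> u" "(\<lambda>j. abs_L2 (deriv (\<phi> j))) \<longlonglongrightarrow> w"
proof -
  have "\<exists>\<phi>. compact_elementary \<phi> \<and> norm (abs_L2 \<phi> - u) < inverse (real (Suc j)) \<and>
      norm (abs_L2 (deriv \<phi>) - w) < inverse (real (Suc j))" for j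
    using assms unfolding H10_limit_def by (metis inverse_positive_iff_positive of_nat_0_less_iff zero_less_Suc)
  then obtain \<phi> where \<phi>: "\<And>j. compact_elementary (\<phi> j)"
     "\<And>j. norm (abs_L2 (\<phi> j) - u) < inverse (real (Suc j))"
     "\<And>j. norm (abs_L2 (deriv (\<phi> j)) - w) < inverse (real (Suc j))" by metis
  have "(\<lambda>j. abs_L2 (\<phi> j) - u) \<longlonglongrightarrow> 0" "(\<lambda>j. abs_L2 (deriv (\<phi> j)) - w) \<longlonglongrightarrow> 0"
    using \<phi>(2,3)[THEN less_imp_le]
    by (auto intro!: Lim_null_comparison[OF always_eventually LIMSEQ_inverse_real_of_nat] simp del: of_nat_Suc)
  then show ?thesis using that[of \<phi>] \<phi>(1) compact_elementary_test_function by (auto simp: LIM_zero_iff)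
qed

lemma H10_I: "H10_limit u w \<Longrightarrow> has_weak_deriv u w \<Longrightarrow> u \<in> H10"
  unfolding H10_def H1_def by (auto simp: weak_deriv_eqI elim!: H10_limit_sequence)

lemma flat_deriv_bound:
  assumes "y > 0" shows "\<bar>(y + 1) * flat (monom 1 2) y\<bar> \<le> 1 / y + 1 / y\<^sup>2" "\<bar>(y + 1) * flat (monom 1 2) y\<bar> \<le> 3"
proof -
  define z where "z = 1 / y"
  have z: "z > 0" using assms by (simp add: z_def)
  have eq: "(y + 1) * flat (monom 1 2) y = (z + z\<^sup>2) * exp (- z)"
    using assms by (simp add: flat_def poly_monom z_def field_simps power2_eq_square)
  have e: "1 + z + z\<^sup>2 / 2 \<le> exp z" using z by (intro exp_lower_Taylor_quadratic) simp
  have "(z + z\<^sup>2) * exp (- z) \<le> (z + z\<^sup>2) * 1" using z by (intro mult_left_mono) auto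
  then show "\<bar>(y + 1) * flat (monom 1 2) y\<bar> \<le> 1 / y + 1 / y\<^sup>2"
    unfolding eq using z by (simp add: z_def power_one_over abs_mult)
  have "z + z\<^sup>2 \<le> 3 * exp z" using e z zero_le_power2[of z] by linarith
  then show "\<bar>(y + 1) * flat (monom 1 2) y\<bar> \<le> 3"
    unfolding eq using z by (simp add: abs_mult exp_minus field_simps)
qed

lemma H10_limit_Sine: "H10_limit (Sine k) (freq k *\<^sub>R Cosine k)"
proof -
  let ?D = "flat (monom 1 2)"
  define cut where "cut = (\<lambda>j x. flat 1 (real j * x - 1) * flat 1 (real j * (1 - x) - 1))"
  define cut' where "cut' = (\<lambda>j x. real j * ?D (real j * x - 1) * flat 1 (real j * (1 - x) - 1)
      - real j * ?D (real j * (1 - x) - 1) * flat 1 (real j * x - 1))"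
  define \<phi> where "\<phi> = (\<lambda>j x. cut j x * sine k x)"
  define \<phi>' where "\<phi>' = (\<lambda>j x. cut' j x * sine k x + cut j x * (freq k * cosine k x))"
  have fl: "(flat 1 has_real_derivative ?D x) (at x)" for x
    using flat_has_derivative[of 1 x] by simp
  have dcut: "(cut j has_real_derivative cut' j x) (at x)" for j x
    unfolding cut_def cut'_def by (auto intro!: derivative_eq_intros DERIV_chain2[OF fl])
  have "(\<phi> j has_real_derivative \<phi>' j x) (at x)" for j x
    unfolding \<phi>_def \<phi>'_def by (auto intro!: derivative_eq_intros dcut sine_deriv)
  then have deriv_\<phi>: "deriv (\<phi> j) = \<phi>' j" for j by (intro ext DERIV_imp_deriv)
  have el: "elementary (\<phi> j)" for j
  proof -
    have "elementary (\<lambda>x. flat 1 (real j * x + - 1) * flat 1 (- real j * x + (real j - 1)) * sine k x)"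
      by (intro elementary.intros elementary_sine)
    then show ?thesis by (simp add: \<phi>_def cut_def algebra_simps)
  qed
  have ce: "compact_elementary (\<phi> j)" for j
  proof (cases "j = 0")
    case True
    have "\<phi> j x = 0" for x using True by (simp add: \<phi>_def cut_def flat_def)
    then show ?thesis unfolding compact_elementary_def
      by (intro conjI el exI[of _ "1/2"]) simp_all
  next
    case False
    then show ?thesis using el unfolding compact_elementary_def
      by (intro conjI exI[of _ "1 / real j"] exI[of _ "1 - 1 / real j"])
        (auto simp: \<phi>_def cut_def flat_def field_simps)
  qed
  have cut_bd: "0 \<le> cut j x" "cut j x \<le> 1" for j x
    using flat_1_bounds by (auto simp: cut_def intro!: mult_le_one mult_nonneg_nonneg)
  have sin_x: "\<bar>sine k x\<bar> \<le> 2 * freq k * x" if "0 \<le> x" for x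
  proof -
    have "\<bar>sin (freq k * x)\<bar> \<le> freq k * x"
      using abs_sin_x_le_abs_x[of "freq k * x"] that by (simp add: abs_mult)
    then have "sqrt 2 * \<bar>sin (freq k * x)\<bar> \<le> 2 * (freq k * x)"
      by (intro mult_mono real_le_lsqrt) auto
    then show ?thesis by (simp add: sine_def abs_mult)
  qed
  have sin_1x: "\<bar>sine k x\<bar> \<le> 2 * freq k * (1 - x)" if "x \<le> 1" for x
  proof -
    have "sin (freq k * (1 - x)) = - cos (freq k) * sin (freq k * x)"
      using sine_boundary(2)[of k] by (simp add: sine_def sin_diff right_diff_distrib)
    moreover have "\<bar>cos (freq k)\<bar> = 1"
      using sine_boundary(2)[of k] by (intro sin_zero_abs_cos_one) (simp add: sine_def)
    ultimately have "\<bar>sine k x\<bar> = \<bar>sine k (1 - x)\<bar>" by (simp add: sine_def abs_mult)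
    then show ?thesis using sin_x[of "1 - x"] that by simp
  qed
  have D0: "?D y = 0" if "y \<le> 0" for y using that by (simp add: flat_def)
  have piece: "\<bar>real j * ?D (real j * t - 1) * s\<bar> \<le> 6 * freq k"
    "real j * t - 1 > 0 \<Longrightarrow> \<bar>real j * ?D (real j * t - 1) * s\<bar> \<le>
        2 * freq k * (1 / (real j * t - 1) + 1 / (real j * t - 1)\<^sup>2)"
    if "\<bar>s\<bar> \<le> 2 * freq k * t" for j t s
  proof -
    let ?y = "real j * t - 1"
    have "\<bar>real j * ?D ?y * s\<bar> \<le> real j * \<bar>?D ?y\<bar> * (2 * freq k * t)"
      using that unfolding abs_mult by (intro mult_mono) auto
    also have "\<dots> = 2 * freq k * ((?y + 1) * \<bar>?D ?y\<bar>)" by (simp add: mult_ac)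
    finally have *: "\<bar>real j * ?D ?y * s\<bar> \<le> 2 * freq k * ((?y + 1) * \<bar>?D ?y\<bar>)" .
    have **: "(?y + 1) * \<bar>?D ?y\<bar> = \<bar>(?y + 1) * ?D ?y\<bar>" if "?y > 0"
      using that abs_mult[of "?y + 1" "?D ?y"] abs_of_pos[of "?y + 1"] by linarith
    show 2: "\<bar>real j * ?D ?y * s\<bar> \<le> 2 * freq k * (1 / ?y + 1 / ?y\<^sup>2)" if "?y > 0"
    proof -
      have "2 * freq k * ((?y + 1) * \<bar>?D ?y\<bar>) \<le> 2 * freq k * (1 / ?y + 1 / ?y\<^sup>2)"
        unfolding **[OF that] using flat_deriv_bound(1)[OF that] by (intro mult_left_mono) auto
      then show ?thesis by (rule order_trans[OF *])
    qed
    show "\<bar>real j * ?D ?y * s\<bar> \<le> 6 * freq k"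
    proof (cases "?y > 0")
      case True
      have "2 * freq k * ((?y + 1) * \<bar>?D ?y\<bar>) \<le> 2 * freq k * 3"
        unfolding **[OF True] using flat_deriv_bound(2)[OF True] by (intro mult_left_mono) auto
      also have "\<dots> = 6 * freq k" by simp
      finally show ?thesis by (rule order_trans[OF *])
    qed (use D0[of ?y] in \<open>simp add: less_imp_le\<close>)
  qed
  have piece_lim: "(\<lambda>j. real j * ?D (real j * t - 1) * s) \<longlonglongrightarrow> 0" if "\<bar>s\<bar> \<le> 2 * freq k * t" "t > 0" for t s
  proof (rule Lim_null_comparison)
    have "filterlim (\<lambda>j. real j * t - 1) at_top sequentially" using that(2) by real_asymp
    then have "eventually (\<lambda>j. real j * t - 1 > 0) sequentially"
      by (simp only: filterlim_at_top_dense)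
    then show "\<forall>\<^sub>F j in sequentially. norm (real j * ?D (real j * t - 1) * s) \<le>
        2 * freq k * (1 / (real j * t - 1) + 1 / (real j * t - 1)\<^sup>2)"
      by eventually_elim (use piece(2)[OF that(1)] in auto)
    show "(\<lambda>j. 2 * freq k * (1 / (real j * t - 1) + 1 / (real j * t - 1)\<^sup>2)) \<longlonglongrightarrow> 0"
      using that(2) by real_asymp
  qed
  have cut_lim: "(\<lambda>j. cut j x) \<longlonglongrightarrow> 1" if "x \<in> {0<..<1}" for x
  proof -
    have "(\<lambda>j. cut j x) \<longlonglongrightarrow> 1 * 1"
      unfolding cut_def using that by (intro tendsto_mult flat_1_tendsto) auto
    then show ?thesis by simp
  qed
  have cut's: "cut' j x * sine k x = real j * ?D (real j * x - 1) * sine k x * flat 1 (real j * (1 - x) - 1)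
      - real j * ?D (real j * (1 - x) - 1) * sine k x * flat 1 (real j * x - 1)" for j x
    by (simp add: cut'_def algebra_simps)
  have meas: "\<phi> j \<in> borel_measurable leb01" "\<phi>' j \<in> borel_measurable leb01" for j
    using elementary_continuous_on[OF el] elementary_continuous_on[OF elementary_deriv[OF el]]
    by (auto intro!: continuous_on_measurable_leb01 simp flip: deriv_\<phi>)
  have 1: "(\<lambda>j. abs_L2 (\<phi> j)) \<longlonglongrightarrow> Sine k"
  proof (rule abs_L2_tendsto(2)[where C=2, OF meas(1)])
    show "\<bar>\<phi> j x\<bar> \<le> 2" for j x
      using mult_mono[OF cut_bd(2)[of j x] sine_bound[of k x]] cut_bd(1)[of j x] by (simp add: \<phi>_def abs_mult)
    have "(\<lambda>j. \<phi> j x) \<longlonglongrightarrow> sine k x" if "x \<in> {0<..<1}" for x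
      unfolding \<phi>_def using tendsto_mult[OF cut_lim[OF that] tendsto_const] by simp
    then show "AE x in leb01. (\<lambda>j. \<phi> j x) \<longlonglongrightarrow> sine k x"
      using AE_space by (auto elim!: eventually_mono)
  qed (auto intro!: borel_measurable_leb01)
  have 2: "(\<lambda>j. abs_L2 (\<phi>' j)) \<longlonglongrightarrow> abs_L2 (\<lambda>x. freq k * cosine k x)"
  proof (rule abs_L2_tendsto(2)[where C="14 * freq k", OF meas(2)])
    fix j and x :: real assume x: "x \<in> {0<..<1}"
    have "\<bar>real j * ?D (real j * x - 1) * sine k x * flat 1 (real j * (1 - x) - 1)\<bar> \<le> 6 * freq k * 1"
      unfolding abs_mult[of _ "flat 1 _"] using flat_1_bounds x by (intro mult_mono piece sin_x) auto
    moreover have "\<bar>real j * ?D (real j * (1 - x) - 1) * sine k x * flat 1 (real j * x - 1)\<bar> \<le> 6 * freq k * 1"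
      unfolding abs_mult[of _ "flat 1 _"] using flat_1_bounds x by (intro mult_mono piece sin_1x) auto
    moreover have "\<bar>cut j x * (freq k * cosine k x)\<bar> \<le> 1 * (freq k * 2)"
      unfolding abs_mult[of "cut j x"] using cut_bd cosine_bound[of k x] by (intro mult_mono) (auto simp: abs_mult)
    ultimately show "\<bar>\<phi>' j x\<bar> \<le> 14 * freq k"
      unfolding \<phi>'_def cut's by linarith
  next
    have "(\<lambda>j. \<phi>' j x) \<longlonglongrightarrow> (0 * 1 - 0 * 1) + 1 * (freq k * cosine k x)" if x: "x \<in> {0<..<1}" for x
      unfolding \<phi>'_def cut's using x
      by (intro tendsto_add tendsto_diff tendsto_mult[OF cut_lim[OF x] tendsto_const]
          tendsto_mult[OF piece_lim flat_1_tendsto] sin_x sin_1x) auto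
    then show "AE x in leb01. (\<lambda>j. \<phi>' j x) \<longlonglongrightarrow> freq k * cosine k x"
      using AE_space by (auto elim!: eventually_mono)
  qed (auto intro!: continuous_on_measurable_leb01 continuous_intros)
  show ?thesis unfolding H10_limit_def
  proof (intro allI impI)
    fix \<epsilon> :: real assume e: "\<epsilon> > 0"
    have "\<forall>\<^sub>F j in sequentially. dist (abs_L2 (\<phi> j)) (Sine k) < \<epsilon> \<and>
        dist (abs_L2 (\<phi>' j)) (freq k *\<^sub>R Cosine k) < \<epsilon>"
      unfolding abs_L2_scaleR[OF square_integrable_sine(2)]
      using tendstoD[OF 1 e] tendstoD[OF 2 e] by eventually_elim simp
    then obtain j where "norm (abs_L2 (\<phi> j) - Sine k) < \<epsilon>" "norm (abs_L2 (\<phi>' j) - freq k *\<^sub>R Cosine k) < \<epsilon>"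
      unfolding eventually_sequentially dist_norm by blast
    then show "\<exists>\<phi>. compact_elementary \<phi> \<and> norm (abs_L2 \<phi> - Sine k) < \<epsilon> \<and>
        norm (abs_L2 (deriv \<phi>) - freq k *\<^sub>R Cosine k) < \<epsilon>"
      using ce deriv_\<phi> by (intro exI[of _ "\<phi> j"]) simp
  qed
qed

lemma norm_Cosine: "norm (Cosine k) \<le> 2"
proof -
  have "(norm (Cosine k))\<^sup>2 = (LINT x|leb01. (cosine k x)\<^sup>2)" by (intro norm_abs_L2 square_integrable_sine)
  also have "\<dots> \<le> (LINT x|leb01. 2\<^sup>2)"
  proof (rule integral_mono)
    show "integrable leb01 (\<lambda>x. (cosine k x)\<^sup>2)"
      using square_integrable_sine(2)[of k] by (simp add: square_integrable_def)
    show "integrable leb01 (\<lambda>x. 2\<^sup>2::real)" by (rule integrable_leb01_bounded[of _ "2\<^sup>2"]) auto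
    show "(cosine k x)\<^sup>2 \<le> 2\<^sup>2" for x
      using cosine_bound[of k x] by (metis abs_ge_zero power2_abs power_mono)
  qed
  also have "(LINT x|leb01. 2\<^sup>2) = (2\<^sup>2::real)"
    by (rule LINT_leb01_eqI[OF integrable_leb01_bounded[of _ "2\<^sup>2"]]) (auto simp: has_integral_const_real[of _ 0 1, simplified])
  finally show ?thesis by (rule power2_le_imp_le) simp
qed

text \<open>The series for \<open>u\<close> may be differentiated twice, since
  $|f_k|/\omega_k \le f_k^2 + 1/\omega_k^2$ is summable.\<close>

lemma A_H_domI:
  assumes f: "\<And>k. inner f (Sine k) = mu k * inner u (Sine k)"
  shows "u \<in> H2" "u \<in> H10" "weak_deriv (weak_deriv u) = - f"
proof -
  let ?w = "\<lambda>k. (inner u (Sine k) * freq k) *\<^sub>R Cosine k"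
  have "summable ?w"
  proof (rule summable_comparison_test')
    show "summable (\<lambda>k. 2 * ((inner f (Sine k))\<^sup>2 + 1 / mu k))"
      by (intro summable_mult summable_add Sine.summable_coeff summable_inverse_mu)
    fix k
    define a b where "a = \<bar>inner f (Sine k)\<bar>" and "b = 1 / freq k"
    have "inner u (Sine k) * freq k = inner f (Sine k) / freq k"
      by (simp add: f mu_def power2_eq_square)
    then have "\<bar>inner u (Sine k) * freq k\<bar> = a * b"
      using freq_pos[of k] by (simp add: a_def b_def abs_mult abs_divide abs_of_pos)
    also have "\<dots> \<le> a\<^sup>2 + b\<^sup>2"
    proof -
      have "2 * a * b \<le> a\<^sup>2 + b\<^sup>2" by (rule sum_squares_bound)
      moreover have "0 \<le> a * b" by (simp add: a_def b_def less_imp_le)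
      ultimately show ?thesis by simp
    qed
    finally have "\<bar>inner u (Sine k) * freq k\<bar> \<le> (inner f (Sine k))\<^sup>2 + 1 / mu k"
      by (simp add: a_def b_def mu_def power_divide)
    then have "\<bar>inner u (Sine k) * freq k\<bar> * norm (Cosine k) \<le> ((inner f (Sine k))\<^sup>2 + 1 / mu k) * 2"
      using norm_Cosine[of k] by (intro mult_mono) auto
    then show "norm (?w k) \<le> 2 * ((inner f (Sine k))\<^sup>2 + 1 / mu k)" by simp
  qed
  then obtain w where w: "?w sums w" by (auto simp: summable_def)
  have uw: "has_weak_deriv u w"
  proof (rule has_weak_deriv_sums[OF _ Sine.expansion w])
    show "has_weak_deriv (inner u (Sine k) *\<^sub>R Sine k) (?w k)" for k
      using has_weak_deriv_scaleR[OF has_weak_deriv_Sine] by simp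
  qed
  have wf: "has_weak_deriv w (- f)"
  proof (rule has_weak_deriv_sums[OF _ w sums_minus[OF Sine.expansion]])
    show "has_weak_deriv (?w k) (- (inner f (Sine k) *\<^sub>R Sine k))" for k
      using has_weak_deriv_scaleR[OF has_weak_deriv_Cosine, of "inner u (Sine k) * freq k" k]
      by (simp add: f mu_def power2_eq_square mult_ac)
  qed
  show "u \<in> H2" using uw wf by (auto simp: H2_def H1_def weak_deriv_eqI)
  show "weak_deriv (weak_deriv u) = - f" using uw wf by (simp add: weak_deriv_eqI)
  have "H10_limit u w"
  proof (rule H10_limit_closed)
    show "H10_limit (\<Sum>k<n. inner u (Sine k) *\<^sub>R Sine k) (\<Sum>k<n. ?w k)" for n
      using H10_limit_scaleR[OF H10_limit_Sine] by (intro H10_limit_sum) simp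
    show "(\<lambda>n. \<Sum>k<n. inner u (Sine k) *\<^sub>R Sine k) \<longlonglongrightarrow> u" "(\<lambda>n. \<Sum>k<n. ?w k) \<longlonglongrightarrow> w"
      using Sine.expansion[of u] w by (simp_all add: sums_def)
  qed
  then show "u \<in> H10" using uw by (rule H10_I)
qed

lemma A_H_coeff:
  assumes u: "u \<in> A_H_dom"
  shows "inner (A_H u) (Sine k) = mu k * inner u (Sine k)"
proof -
  obtain w where w: "has_weak_deriv u w" using u by (auto simp: A_H_dom_def H2_def H1_def)
  then obtain z where z: "has_weak_deriv w z"
    using u by (auto simp: A_H_dom_def H2_def H1_def weak_deriv_eqI)
  have Az: "A_H u = - z" using w z by (simp add: A_H_def weak_deriv_eqI)
  obtain \<xi> where \<xi>: "\<And>j. test_function (\<xi> j)" "(\<lambda>j. abs_L2 (\<xi> j)) \<longlonglongrightarrow> Sine k"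
      "(\<lambda>j. abs_L2 (deriv (\<xi> j))) \<longlonglongrightarrow> freq k *\<^sub>R Cosine k"
    using H10_limit_sequence[OF H10_limit_Sine] by blast
  have "(\<lambda>j. inner w (abs_L2 (deriv (\<xi> j)))) = (\<lambda>j. - inner z (abs_L2 (\<xi> j)))"
    using z \<xi>(1) by (simp add: has_weak_deriv_def)
  moreover have "(\<lambda>j. - inner z (abs_L2 (\<xi> j))) \<longlonglongrightarrow> - inner z (Sine k)"
    by (intro tendsto_intros \<xi>)
  moreover have "(\<lambda>j. inner w (abs_L2 (deriv (\<xi> j)))) \<longlonglongrightarrow> inner w (freq k *\<^sub>R Cosine k)"
    by (intro tendsto_intros \<xi>)
  ultimately have "inner w (freq k *\<^sub>R Cosine k) = - inner z (Sine k)"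
    by (metis LIMSEQ_unique)
  then have a: "freq k * inner w (Cosine k) = - inner z (Sine k)" by simp
  obtain \<phi> where \<phi>: "\<And>j. test_function (\<phi> j)" "(\<lambda>j. abs_L2 (\<phi> j)) \<longlonglongrightarrow> u"
      "(\<lambda>j. abs_L2 (deriv (\<phi> j))) \<longlonglongrightarrow> w"
    using u w by (auto simp: A_H_dom_def H10_def weak_deriv_eqI)
  have "(\<lambda>j. inner (Cosine k) (abs_L2 (deriv (\<phi> j)))) = (\<lambda>j. freq k * inner (Sine k) (abs_L2 (\<phi> j)))"
    using has_weak_deriv_Cosine[of k] \<phi>(1) by (simp add: has_weak_deriv_def)
  moreover have "(\<lambda>j. freq k * inner (Sine k) (abs_L2 (\<phi> j))) \<longlonglongrightarrow> freq k * inner (Sine k) u"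
    by (intro tendsto_intros \<phi>)
  moreover have "(\<lambda>j. inner (Cosine k) (abs_L2 (deriv (\<phi> j)))) \<longlonglongrightarrow> inner (Cosine k) w"
    by (intro tendsto_intros \<phi>)
  ultimately have "inner (Cosine k) w = freq k * inner (Sine k) u"
    by (metis LIMSEQ_unique)
  then show ?thesis using a by (simp add: Az mu_def power2_eq_square inner_commute)
qed

lemma Sine_eigenvector: "Sine k \<in> A_H_dom" "A_H (Sine k) = mu k *\<^sub>R Sine k"
  using A_H_domI[of "mu k *\<^sub>R Sine k" "Sine k"]
  by (auto simp: A_H_dom_def A_H_def inner_Sine_Sine)

lemma is_A_H_pow_iff: "is_A_H_pow r u w \<longleftrightarrow> (\<forall>k. inner w (Sine k) = mu k powr r * inner u (Sine k))"
proof
  assume "is_A_H_pow r u w"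
  then show "\<forall>k. inner w (Sine k) = mu k powr r * inner u (Sine k)"
    using Sine_eigenvector unfolding is_A_H_pow_def by blast
next
  assume w: "\<forall>k. inner w (Sine k) = mu k powr r * inner u (Sine k)"
  show "is_A_H_pow r u w"
    unfolding is_A_H_pow_def
  proof (intro allI impI)
    fix m e assume e: "e \<in> A_H_dom \<and> A_H e = m *\<^sub>R e"
    then have "m * inner e (Sine k) = mu k * inner e (Sine k)" for k
      using A_H_coeff[of e k] by simp
    then have "inner w (Sine k) * inner e (Sine k) = m powr r * (inner u (Sine k) * inner e (Sine k))" for k
      using w by (cases "inner e (Sine k) = 0") auto
    moreover have "(\<lambda>k. m powr r * (inner u (Sine k) * inner e (Sine k))) sums (m powr r * inner u e)"
      by (intro sums_mult Sine.parseval)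
    ultimately have "(\<lambda>k. inner w (Sine k) * inner e (Sine k)) sums (m powr r * inner u e)" by (simp only:)
    then show "inner w e = m powr r * inner u e"
      using sums_unique2[OF Sine.parseval[of w e]] by blast
  qed
qed

lemma A_H_pow_eqI: "is_A_H_pow r u w \<Longrightarrow> A_H_pow r u = w"
  unfolding A_H_pow_def by (rule the_equality) (auto simp: is_A_H_pow_iff intro: Sine.eqI)

lemma V_H_iff: "u \<in> V_H s \<longleftrightarrow> summable (\<lambda>k. (mu k powr (s / 2) * inner u (Sine k))\<^sup>2)"
proof
  assume "u \<in> V_H s"
  then obtain w where "is_A_H_pow (s / 2) u w" by (auto simp: V_H_def A_H_pow_dom_def)
  then show "summable (\<lambda>k. (mu k powr (s / 2) * inner u (Sine k))\<^sup>2)"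
    using Sine.summable_coeff[of w] by (simp add: is_A_H_pow_iff)
next
  assume sm: "summable (\<lambda>k. (mu k powr (s / 2) * inner u (Sine k))\<^sup>2)"
  obtain w where "\<And>k. inner w (Sine k) = mu k powr (s / 2) * inner u (Sine k)"
    by (rule Sine.riesz_fischer[OF sm]) blast
  then show "u \<in> V_H s" by (auto simp: V_H_def A_H_pow_dom_def is_A_H_pow_iff)
qed

lemma V_H_norm_sums:
  assumes "u \<in> V_H s"
  shows "(\<lambda>k. (mu k powr (s / 2) * inner u (Sine k))\<^sup>2) sums (V_H_norm s u)\<^sup>2"
proof -
  obtain w where w: "is_A_H_pow (s / 2) u w" using assms by (auto simp: V_H_def A_H_pow_dom_def)
  then show ?thesis using Sine.parseval_norm[of w]
    by (simp add: V_H_norm_def A_H_pow_eqI is_A_H_pow_iff)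
qed

subsection \<open>Absolutely convergent sine series\<close>

definition synth :: "(nat \<Rightarrow> real) \<Rightarrow> real \<Rightarrow> real" where
  "synth c x = (\<Sum>k. c k * sine k x)"

definition sine_coeff :: "(real \<Rightarrow> real) \<Rightarrow> nat \<Rightarrow> real" where
  "sine_coeff f k = (LINT x|leb01. f x * sine k x)"

lemma sine_coeff_eq_inner: "square_integrable f \<Longrightarrow> sine_coeff f k = inner (abs_L2 f) (Sine k)"
  by (simp add: sine_coeff_def inner_abs_L2 square_integrable_sine)

lemma summable_norm_synth:
  assumes "summable (\<lambda>k. \<bar>c k\<bar>)" shows "summable (\<lambda>k. \<bar>c k * sine k x\<bar>)"
proof (rule summable_comparison_test')
  show "summable (\<lambda>k. \<bar>c k\<bar> * 2)" using assms by (rule summable_mult2)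
  show "norm \<bar>c k * sine k x\<bar> \<le> \<bar>c k\<bar> * 2" for k
    by (simp add: abs_mult) (intro mult_left_mono sine_bound abs_ge_zero)
qed

lemma synth_sums:
  assumes "summable (\<lambda>k. \<bar>c k\<bar>)" shows "(\<lambda>k. c k * sine k x) sums synth c x"
  unfolding synth_def using summable_rabs_cancel[OF summable_norm_synth[OF assms]] by (rule summable_sums)

lemma synth_add:
  assumes "summable (\<lambda>k. \<bar>c k\<bar>)" "summable (\<lambda>k. \<bar>d k\<bar>)"
  shows "synth (\<lambda>k. c k + d k) x = synth c x + synth d x"
  using sums_unique[OF sums_add[OF synth_sums[OF assms(1)] synth_sums[OF assms(2)]]]
  by (simp add: synth_def distrib_right)

lemma synth_diff:
  assumes "summable (\<lambda>k. \<bar>c k\<bar>)" "summable (\<lambda>k. \<bar>d k\<bar>)"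
  shows "synth (\<lambda>k. c k - d k) x = synth c x - synth d x"
  using sums_unique[OF sums_diff[OF synth_sums[OF assms(1)] synth_sums[OF assms(2)]]]
  by (simp add: synth_def left_diff_distrib)

lemma synth_uniform_limit:
  assumes "summable (\<lambda>k. \<bar>c k\<bar>)"
  shows "uniform_limit UNIV (\<lambda>n x. \<Sum>k<n. c k * sine k x) (synth c) sequentially"
  unfolding synth_def
proof (rule Weierstrass_m_test)
  show "summable (\<lambda>k. \<bar>c k\<bar> * 2)" using assms by (rule summable_mult2)
  show "norm (c k * sine k x) \<le> \<bar>c k\<bar> * 2" for k x
    by (simp add: abs_mult) (intro mult_left_mono sine_bound abs_ge_zero)
qed

lemma continuous_on_synth:
  assumes "summable (\<lambda>k. \<bar>c k\<bar>)" shows "continuous_on S (synth c)"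
proof -
  have "continuous_on UNIV (synth c)"
    by (rule uniform_limit_theorem[OF _ synth_uniform_limit[OF assms]])
      (auto intro!: always_eventually continuous_intros)
  then show ?thesis by (rule continuous_on_subset) simp
qed

lemma synth_bound:
  assumes "summable (\<lambda>k. \<bar>c k\<bar>)" shows "\<bar>synth c x\<bar> \<le> 2 * (\<Sum>k. \<bar>c k\<bar>)"
proof -
  have "\<bar>synth c x\<bar> \<le> (\<Sum>k. \<bar>c k * sine k x\<bar>)"
    unfolding synth_def by (rule summable_rabs[OF summable_norm_synth[OF assms]])
  also have "\<dots> \<le> (\<Sum>k. 2 * \<bar>c k\<bar>)"
  proof (intro suminf_le summable_norm_synth[OF assms] summable_mult assms)
    show "\<bar>c k * sine k x\<bar> \<le> 2 * \<bar>c k\<bar>" for k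
      using mult_left_mono[OF sine_bound, of "\<bar>c k\<bar>" k x] by (simp add: abs_mult)
  qed
  also have "\<dots> = 2 * (\<Sum>k. \<bar>c k\<bar>)" by (intro suminf_mult assms)
  finally show ?thesis .
qed

lemma square_integrable_synth:
  assumes "summable (\<lambda>k. \<bar>c k\<bar>)" shows "square_integrable (synth c)"
  by (intro square_integrable_continuous continuous_on_synth assms)

lemma abs_L2_synth_coeff:
  assumes c: "summable (\<lambda>k. \<bar>c k\<bar>)" shows "inner (abs_L2 (synth c)) (Sine j) = c j"
proof -
  have bd: "\<bar>\<Sum>k<n. c k * sine k x\<bar> \<le> 2 * (\<Sum>k. \<bar>c k\<bar>)" for n x
  proof -
    have "\<bar>\<Sum>k<n. c k * sine k x\<bar> \<le> (\<Sum>k<n. \<bar>c k\<bar> * 2)"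
    proof (rule order_trans[OF sum_abs sum_mono])
      show "\<bar>c k * sine k x\<bar> \<le> \<bar>c k\<bar> * 2" for k
        by (simp add: abs_mult) (intro mult_left_mono sine_bound abs_ge_zero)
    qed
    also have "\<dots> = 2 * (\<Sum>k<n. \<bar>c k\<bar>)" by (simp add: sum_distrib_left mult.commute)
    also have "\<dots> \<le> 2 * (\<Sum>k. \<bar>c k\<bar>)" using c by (intro mult_left_mono sum_le_suminf) auto
    finally show ?thesis .
  qed
  have "(\<lambda>n. abs_L2 (\<lambda>x. \<Sum>k<n. c k * sine k x)) \<longlonglongrightarrow> abs_L2 (synth c)"
  proof (rule abs_L2_tendsto(2)[OF _ bd])
    show "(\<lambda>x. \<Sum>k<n. c k * sine k x) \<in> borel_measurable leb01" for n
      by (intro continuous_on_measurable_leb01 continuous_intros)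
    show "synth c \<in> borel_measurable leb01"
      by (intro continuous_on_measurable_leb01 continuous_on_synth c)
    show "AE x in leb01. (\<lambda>n. \<Sum>k<n. c k * sine k x) \<longlonglongrightarrow> synth c x"
      using synth_sums[OF c] by (simp add: sums_def)
  qed
  moreover have "abs_L2 (\<lambda>x. \<Sum>k<n. c k * sine k x) = (\<Sum>k<n. c k *\<^sub>R Sine k)" for n
    by (subst abs_L2_sum[symmetric])
      (auto intro!: square_integrable_cmult square_integrable_sine simp: abs_L2_scaleR square_integrable_sine)
  ultimately have "(\<lambda>n. \<Sum>k<n. c k *\<^sub>R Sine k) \<longlonglongrightarrow> abs_L2 (synth c)" by simp
  then have "(\<lambda>n. inner (\<Sum>k<n. c k *\<^sub>R Sine k) (Sine j)) \<longlonglongrightarrow> inner (abs_L2 (synth c)) (Sine j)"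
    by (intro tendsto_inner tendsto_const)
  moreover have "(\<lambda>n. inner (\<Sum>k<n. c k *\<^sub>R Sine k) (Sine j)) \<longlonglongrightarrow> c j"
    by (rule tendsto_eventually, rule eventually_sequentiallyI[of "Suc j"]) (simp add: Sine.inner_sum_basis)
  ultimately show ?thesis by (rule LIMSEQ_unique)
qed

lemma sine_coeff_bound:
  assumes "f \<in> borel_measurable leb01" "\<And>x. x \<in> {0<..<1} \<Longrightarrow> \<bar>f x\<bar> \<le> C"
  shows "\<bar>sine_coeff f k\<bar> \<le> 2 * C"
proof -
  have C: "0 \<le> C" using assms(2)[of "1/2"] by simp
  have "\<bar>sine_coeff f k\<bar> \<le> (LINT x|leb01. \<bar>f x * sine k x\<bar>)"
    unfolding sine_coeff_def by (rule integral_abs_bound)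
  also have "\<dots> \<le> (LINT x|leb01. 2 * C)"
  proof (rule integral_mono)
    have "integrable leb01 (\<lambda>x. f x * sine k x)"
      using assms by (intro square_integrable_mult square_integrable_bounded[of _ C] square_integrable_sine)
    then show "integrable leb01 (\<lambda>x. \<bar>f x * sine k x\<bar>)" by simp
    show "integrable leb01 (\<lambda>x. 2 * C)" using C by (intro integrable_leb01_bounded[of _ "2 * C"]) auto
    fix x assume "x \<in> space leb01"
    then have "\<bar>f x\<bar> \<le> C" using assms(2) by simp
    then show "\<bar>f x * sine k x\<bar> \<le> 2 * C"
      using mult_mono[OF _ sine_bound, of "\<bar>f x\<bar>" C k x] C by (simp add: abs_mult mult.commute)
  qed
  also have "(LINT x|leb01. 2 * C) = 2 * C"
    using C by (intro LINT_leb01_eqI integrable_leb01_bounded[of _ "2 * C"])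
      (auto simp: has_integral_const_real[of _ 0 1, simplified])
  finally show ?thesis .
qed

lemma summable_mu_bounded:
  assumes "\<And>k. \<bar>c k\<bar> \<le> B / mu k" shows "summable (\<lambda>k. \<bar>c k\<bar>)"
proof (rule summable_comparison_test')
  show "summable (\<lambda>k. B * (1 / mu k))" by (intro summable_mult summable_inverse_mu)
  show "norm \<bar>c k\<bar> \<le> B * (1 / mu k)" for k using assms[of k] by simp
qed

subsection \<open>Positivity of the heat semigroup\<close>

lemma heat_sine_sum_nonneg:
  fixes b :: "nat \<Rightarrow> real"
  assumes pos: "\<And>x. x \<in> {0..1} \<Longrightarrow> 0 \<le> (\<Sum>k<N. b k * sine k x)" and T: "0 \<le> T" and x: "x \<in> {0..1}"
  shows "0 \<le> (\<Sum>k<N. b k * exp (- mu k * T) * sine k x)"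
proof (rule ccontr)
  define U where "U = (\<lambda>t x. \<Sum>k<N. b k * exp (- mu k * t) * sine k x)"
  assume "\<not> ?thesis"
  then have neg: "U T x < 0" by (simp add: U_def)
  then have T: "T > 0" using pos[OF x] T by (cases "T = 0") (auto simp: U_def)
  define \<eta> where "\<eta> = - U T x / (2 * T)"
  have \<eta>: "\<eta> > 0" using neg T by (simp add: \<eta>_def divide_neg_pos)
  define v where "v = (\<lambda>t x. U t x + \<eta> * t)"
  have vT: "v T x < 0" using neg T by (simp add: v_def \<eta>_def)
  have "continuous_on ({0..T} \<times> {0..1}) (\<lambda>(t, x). v t x)"
    unfolding v_def U_def sine_def case_prod_beta by (intro continuous_intros)
  then obtain z where z: "z \<in> {0..T} \<times> {0..1}"
    "\<And>w. w \<in> {0..T} \<times> {0..1} \<Longrightarrow> (\<lambda>(t, x). v t x) z \<le> (\<lambda>(t, x). v t x) w"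
    using continuous_attains_inf[of "{0..T} \<times> {0..1}" "\<lambda>(t, x). v t x"] T
    by (fastforce simp: compact_Times)
  obtain s y where sy: "z = (s, y)" by (cases z)
  have s: "s \<in> {0..T}" "y \<in> {0..1}" and min: "\<And>t x. t \<in> {0..T} \<Longrightarrow> x \<in> {0..1} \<Longrightarrow> v s y \<le> v t x"
    using z sy by auto
  have vneg: "v s y < 0" using min[of T x] vT x T by simp
  have s0: "0 < s" using s pos[of y] vneg by (cases "s = 0") (auto simp: v_def U_def)
  have "0 < \<eta> * s" using \<eta> s0 by simp
  then have y0: "y \<noteq> 0" and y1: "y \<noteq> 1" using vneg by (auto simp: v_def U_def)
  have y: "0 < y" "y < 1" using y0 y1 s by auto
  define D where "D = (\<Sum>k<N. b k * (- mu k * exp (- mu k * s)) * sine k y)"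
  have dt: "((\<lambda>t. v t y) has_real_derivative D + \<eta>) (at s)"
    unfolding v_def U_def D_def by (auto intro!: derivative_eq_intros sum.cong)
  have "D + \<eta> \<le> 0"
  proof (rule ccontr)
    assume "\<not> D + \<eta> \<le> 0"
    then obtain d where d: "d > 0" "\<And>h. h > 0 \<Longrightarrow> h < d \<Longrightarrow> v (s - h) y < v s y"
      using DERIV_pos_inc_left[OF dt] by auto
    define h where "h = min (d / 2) s"
    have "v (s - h) y < v s y" using d s0 by (auto simp: h_def)
    moreover have "v s y \<le> v (s - h) y" using s s0 d(1) by (intro min) (auto simp: h_def)
    ultimately show False by simp
  qed
  then have D: "D < 0" using \<eta> by simp
  define V' where "V' = (\<lambda>x. \<Sum>k<N. b k * exp (- mu k * s) * (freq k * cosine k x))"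
  have d1: "((\<lambda>x. v s x) has_real_derivative V' x) (at x)" for x
    unfolding v_def U_def V'_def by (auto intro!: derivative_eq_intros sine_deriv sum.cong)
  have d2: "(V' has_real_derivative D) (at y)"
    unfolding V'_def D_def
    by (auto intro!: derivative_eq_intros cosine_deriv sum.cong simp: mu_def power2_eq_square)
  have V'0: "V' y = 0"
  proof (rule DERIV_local_min[OF d1])
    show "0 < min y (1 - y)" using y by simp
    show "\<forall>z. \<bar>y - z\<bar> < min y (1 - y) \<longrightarrow> v s y \<le> v s z"
      using s(1) by (auto intro!: min)
  qed
  obtain d where d: "d > 0" "\<And>h. h > 0 \<Longrightarrow> h < d \<Longrightarrow> V' (y + h) < V' y"
    using DERIV_neg_dec_right[OF d2 D] by auto
  define h where "h = min (d / 2) ((1 - y) / 2)"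
  have h: "h > 0" "h < d" "y + h < 1" using d y by (auto simp: h_def min_def field_simps)
  obtain \<xi> where \<xi>: "\<xi> > y" "\<xi> < y + h" "v s (y + h) - v s y = (y + h - y) * V' \<xi>"
    using MVT2[of y "y + h" "v s" V'] d1 h by auto
  have "V' \<xi> < 0" using d(2)[of "\<xi> - y"] \<xi> h V'0 by simp
  then have "v s (y + h) < v s y" using \<xi>(3) h mult_pos_neg[of h "V' \<xi>"] by simp
  moreover have "v s y \<le> v s (y + h)" using s y h by (intro min) auto
  ultimately show False by simp
qed

lemma exp_minus_mu_bound:
  assumes "\<tau> > 0" shows "exp (- mu k * \<tau>) \<le> (1 / \<tau>) / mu k"
proof -
  have p: "0 < mu k * \<tau>" using assms by simp
  have "mu k * \<tau> \<le> exp (mu k * \<tau>)" using exp_ge_add_one_self[of "mu k * \<tau>"] by linarith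
  then show ?thesis using p by (simp add: exp_minus field_simps)
qed

definition heat_kernel :: "real \<Rightarrow> real \<Rightarrow> real \<Rightarrow> real" where
  "heat_kernel \<tau> x = synth (\<lambda>k. exp (- mu k * \<tau>) * sine k x)"

lemma heat_kernel_summable:
  assumes "\<tau> > 0" shows "summable (\<lambda>k. \<bar>exp (- mu k * \<tau>) * sine k x\<bar>)"
proof (rule summable_mu_bounded)
  fix k
  have "\<bar>exp (- mu k * \<tau>) * sine k x\<bar> \<le> ((1 / \<tau>) / mu k) * 2"
    unfolding abs_mult using assms exp_minus_mu_bound[OF assms, of k] sine_bound[of k x]
    by (intro mult_mono) (auto intro: less_imp_le)
  then show "\<bar>exp (- mu k * \<tau>) * sine k x\<bar> \<le> (2 / \<tau>) / mu k" by simp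
qed

lemma heat_kernel_nonneg:
  assumes \<tau>: "\<tau> > 0" and x: "x \<in> {0..1}"
  shows "AE y in leb01. 0 \<le> heat_kernel \<tau> x y"
proof -
  define K where "K = heat_kernel \<tau> x"
  note sm = heat_kernel_summable[OF \<tau>, of x]
  have cK: "continuous_on {0..1} K" unfolding K_def heat_kernel_def by (intro continuous_on_synth sm)
  have sK: "square_integrable K" by (intro square_integrable_continuous cK)
  have Kk: "(LINT y|leb01. K y * sine k y) = exp (- mu k * \<tau>) * sine k x" for k
    using abs_L2_synth_coeff[OF sm, of k] sK
    by (simp add: K_def heat_kernel_def inner_abs_L2 square_integrable_sine)
  have Ki: "integrable leb01 (\<lambda>y. K y * sine k y)" for k
    by (intro square_integrable_mult sK square_integrable_sine)
  have poly: "0 \<le> (LINT y|leb01. K y * p y)" "integrable leb01 (\<lambda>y. K y * p y)"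
    if p: "sine_poly p" "\<And>y. y \<in> {0..1} \<Longrightarrow> 0 \<le> p y" for p
  proof -
    obtain N b where b: "\<And>x. p x = (\<Sum>k<N. b k * sine k x)" using p(1) unfolding sine_poly_def by blast
    have eq: "K y * p y = (\<Sum>k<N. b k * (K y * sine k y))" for y
      unfolding b sum_distrib_left by (intro sum.cong) simp_all
    show "integrable leb01 (\<lambda>y. K y * p y)" unfolding eq using Ki by simp
    have "0 \<le> (\<Sum>k<N. b k * exp (- mu k * \<tau>) * sine k x)"
      using p(2) \<tau> x by (intro heat_sine_sum_nonneg) (auto simp: b)
    also have "\<dots> = (LINT y|leb01. K y * p y)"
      unfolding eq using Ki Kk by (simp add: mult.assoc)
    finally show "0 \<le> (LINT y|leb01. K y * p y)" .
  qed
  define L where "L = (LINT y|leb01. \<bar>K y\<bar>)"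
  have iK: "integrable leb01 K" using sK by (rule square_integrable_imp_integrable)
  have cont: "0 \<le> (LINT y|leb01. K y * (sin (pi * y) * q y))"
    if q: "continuous_on {0..1} q" "\<And>y. y \<in> {0..1} \<Longrightarrow> 0 \<le> q y" for q
  proof (rule field_le_epsilon)
    fix e :: real assume e: "e > 0"
    have L: "0 \<le> L" by (simp add: L_def)
    define \<epsilon> where "\<epsilon> = e / (2 * (L + 1))"
    have \<epsilon>: "\<epsilon> > 0" unfolding \<epsilon>_def using e L by (intro divide_pos_pos) auto
    have "continuous_on {0..1} (\<lambda>y. q y + \<epsilon>)" by (intro continuous_intros q)
    from sine_poly_approximation[OF this \<epsilon>] obtain p where p: "sine_poly p"
      "\<And>y. y \<in> {0..1} \<Longrightarrow> \<bar>p y - sin (pi * y) * (q y + \<epsilon>)\<bar> \<le> \<epsilon> * sin (pi * y)" by blast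
    have sin: "0 \<le> sin (pi * y)" if "y \<in> {0..1}" for y
      using that by (intro sin_ge_zero) (auto simp: mult_left_le)
    have ppos: "0 \<le> p y" if y: "y \<in> {0..1}" for y
    proof -
      have "sin (pi * y) * (q y + \<epsilon>) - \<epsilon> * sin (pi * y) \<le> p y" using p(2)[OF y] by linarith
      moreover have "0 \<le> sin (pi * y) * q y" using sin[OF y] q(2)[OF y] by simp
      ultimately show ?thesis by (simp add: algebra_simps)
    qed
    have i1: "integrable leb01 (\<lambda>y. K y * (sin (pi * y) * q y))"
      by (intro square_integrable_mult sK square_integrable_continuous continuous_intros q)
    have "0 \<le> (LINT y|leb01. K y * p y)" using poly(1)[OF p(1) ppos] .
    also have "\<dots> \<le> (LINT y|leb01. K y * (sin (pi * y) * q y) + 2 * \<epsilon> * \<bar>K y\<bar>)"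
    proof (rule integral_mono)
      show "integrable leb01 (\<lambda>y. K y * p y)" using poly(2)[OF p(1) ppos] .
      show "integrable leb01 (\<lambda>y. K y * (sin (pi * y) * q y) + 2 * \<epsilon> * \<bar>K y\<bar>)" using i1 iK by simp
      fix y assume "y \<in> space leb01"
      then have y: "y \<in> {0..1}" by simp
      have "\<epsilon> * sin (pi * y) \<le> \<epsilon>" using \<epsilon> by (intro mult_left_le) auto
      moreover have "p y - sin (pi * y) * q y = (p y - sin (pi * y) * (q y + \<epsilon>)) + \<epsilon> * sin (pi * y)"
        by (simp add: algebra_simps)
      moreover have "0 \<le> \<epsilon> * sin (pi * y)" using \<epsilon> sin[OF y] by simp
      ultimately have "\<bar>p y - sin (pi * y) * q y\<bar> \<le> 2 * \<epsilon>" using p(2)[OF y] by linarith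
      then have "\<bar>K y\<bar> * \<bar>p y - sin (pi * y) * q y\<bar> \<le> \<bar>K y\<bar> * (2 * \<epsilon>)" by (intro mult_left_mono) auto
      then have "\<bar>K y * p y - K y * (sin (pi * y) * q y)\<bar> \<le> 2 * \<epsilon> * \<bar>K y\<bar>"
        by (simp add: mult.commute right_diff_distrib flip: abs_mult)
      then show "K y * p y \<le> K y * (sin (pi * y) * q y) + 2 * \<epsilon> * \<bar>K y\<bar>" by linarith
    qed
    also have "\<dots> = (LINT y|leb01. K y * (sin (pi * y) * q y)) + 2 * \<epsilon> * L"
      using i1 iK by (simp add: L_def)
    also have "2 * \<epsilon> * L \<le> 2 * \<epsilon> * (L + 1)" using \<epsilon> by simp
    also have "2 * \<epsilon> * (L + 1) = e" using L by (simp add: \<epsilon>_def field_simps add_nonneg_eq_0_iff)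
    finally show "0 \<le> (LINT y|leb01. K y * (sin (pi * y) * q y)) + e" by simp
  qed
  define q where "q = (\<lambda>y. max 0 (- K y))"
  have cq: "continuous_on {0..1} q" unfolding q_def by (intro continuous_intros cK)
  have Kq: "K y * (sin (pi * y) * q y) = - (sin (pi * y) * (q y)\<^sup>2)" for y
    by (auto simp: q_def max_def power2_eq_square)
  have "0 \<le> (LINT y|leb01. K y * (sin (pi * y) * q y))"
    by (intro cont cq) (simp add: q_def)
  then have "(LINT y|leb01. sin (pi * y) * (q y)\<^sup>2) \<le> 0" unfolding Kq by simp
  moreover have nn: "AE y in leb01. 0 \<le> sin (pi * y) * (q y)\<^sup>2"
    by (intro AE_I2 mult_nonneg_nonneg sin_ge_zero) (auto simp: mult_left_le)
  ultimately have "(LINT y|leb01. sin (pi * y) * (q y)\<^sup>2) = 0"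
    using integral_nonneg_AE[OF nn] by linarith
  moreover have "integrable leb01 (\<lambda>y. sin (pi * y) * (q y)\<^sup>2)"
    by (intro square_integrable_imp_integrable square_integrable_continuous continuous_intros cq)
  ultimately have "AE y in leb01. sin (pi * y) * (q y)\<^sup>2 = 0"
    using integral_nonneg_eq_0_iff_AE[OF _ nn] by blast
  then have "AE y in leb01. 0 \<le> K y"
    using AE_space
  proof eventually_elim
    case (elim y)
    then have "0 < sin (pi * y)" by (intro sin_gt_zero) auto
    then have "q y = 0" using elim by simp
    then show ?case by (simp add: q_def max_def split: if_splits)
  qed
  then show ?thesis by (simp add: K_def)
qed

lemma heat_semigroup_nonneg:
  assumes \<tau>: "\<tau> > 0" and x: "x \<in> {0..1}" and f: "square_integrable f" "AE y in leb01. 0 \<le> f y"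
  shows "0 \<le> synth (\<lambda>k. exp (- mu k * \<tau>) * sine_coeff f k) x"
proof -
  note sm = heat_kernel_summable[OF \<tau>, of x]
  have sK: "square_integrable (heat_kernel \<tau> x)"
    unfolding heat_kernel_def by (intro square_integrable_synth sm)
  have "(\<lambda>k. (exp (- mu k * \<tau>) * sine k x) * sine_coeff f k) sums inner (abs_L2 (heat_kernel \<tau> x)) (abs_L2 f)"
    using Sine.parseval[of "abs_L2 (heat_kernel \<tau> x)" "abs_L2 f"] abs_L2_synth_coeff[OF sm]
    by (simp add: heat_kernel_def sine_coeff_eq_inner f)
  then have "synth (\<lambda>k. exp (- mu k * \<tau>) * sine_coeff f k) x = inner (abs_L2 (heat_kernel \<tau> x)) (abs_L2 f)"
    unfolding synth_def by (simp add: sums_iff mult_ac)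
  also have "\<dots> = (LINT y|leb01. heat_kernel \<tau> x y * f y)" by (intro inner_abs_L2 sK f)
  also have "\<dots> \<ge> 0"
    using heat_kernel_nonneg[OF \<tau> x] f(2) by (intro integral_nonneg_AE) (auto elim: eventually_elim2)
  finally show ?thesis .
qed

subsection \<open>Duhamel's formula for a single mode\<close>

lemma set_integrable_bounded:
  fixes f :: "real \<Rightarrow> real"
  assumes [measurable]: "f \<in> borel_measurable borel" and "\<And>s. s \<in> {a..b} \<Longrightarrow> \<bar>f s\<bar> \<le> B"
  shows "set_integrable lborel {a..b} f"
  unfolding set_integrable_def
proof (rule Bochner_Integration.integrable_bound)
  show "integrable lborel (\<lambda>s. \<bar>B\<bar> * indicator {a..b} s)"
    by (intro integrable_mult_right) (auto simp: integrable_indicator_iff emeasure_lborel_Icc_eq)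
  show "AE s in lborel. norm (indicator {a..b} s *\<^sub>R f s) \<le> norm (\<bar>B\<bar> * indicator {a..b} s)"
    using order_trans[OF assms(2) abs_ge_self] by (intro AE_I2) (auto simp: indicator_def)
qed simp

lemma set_integral_eq_integral:
  fixes f :: "real \<Rightarrow> real"
  assumes "set_integrable lborel {a..b} f"
  shows "(LBINT s:{a..b}. f s) = integral {a..b} f" "f integrable_on {a..b}"
  using set_borel_integral_eq_integral[OF assms] by auto

definition duhamel :: "real \<Rightarrow> (real \<Rightarrow> real) \<Rightarrow> real \<Rightarrow> real" where
  "duhamel m \<phi> t = (LBINT s:{0..t}. exp (- m * (t - s)) * \<phi> s)"

lemma borel_measurable_duhamel [measurable]:
  assumes [measurable]: "\<phi> \<in> borel_measurable borel"
  shows "duhamel m \<phi> \<in> borel_measurable borel"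
proof -
  have "(\<lambda>t. LINT s|lborel. (if 0 \<le> s \<and> s \<le> t then exp (- m * (t - s)) * \<phi> s else 0)) \<in> borel_measurable borel"
    by (rule lborel.borel_measurable_lebesgue_integral) measurable
  moreover have "duhamel m \<phi> t = (LINT s|lborel. (if 0 \<le> s \<and> s \<le> t then exp (- m * (t - s)) * \<phi> s else 0))" for t
    unfolding duhamel_def set_lebesgue_integral_def by (intro Bochner_Integration.integral_cong) (auto simp: indicator_def)
  ultimately show ?thesis by (simp cong: measurable_cong)
qed

lemma set_integral_indicator_right:
  "(LBINT s:A. f s) = (LBINT s. f s * indicator A s)" for f :: "real \<Rightarrow> real" and A :: "real set"
  unfolding set_lebesgue_integral_def by (intro Bochner_Integration.integral_cong) auto

lemma exp_kernel_integral:
  fixes m r t :: real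
  assumes "m > 0" "r \<le> t"
  shows "(LBINT s:{r..t}. exp (- m * (s - r))) = (1 - exp (- m * (t - r))) / m"
    "(LBINT s:{r..t}. exp (- m * (t - s))) = (1 - exp (- m * (t - r))) / m"
proof -
  have "(LBINT s. exp (- m * (s - r)) * indicator {r..t} s) = - exp (- m * (t - r)) / m - - exp (- m * (r - r)) / m"
    using assms by (intro integral_FTC_Icc_real) (auto intro!: derivative_eq_intros continuous_intros)
  then show "(LBINT s:{r..t}. exp (- m * (s - r))) = (1 - exp (- m * (t - r))) / m"
    by (simp add: set_integral_indicator_right diff_divide_distrib)
  have "(LBINT s. exp (- m * (t - s)) * indicator {r..t} s) = exp (- m * (t - t)) / m - exp (- m * (t - r)) / m"
    using assms by (intro integral_FTC_Icc_real) (auto intro!: derivative_eq_intros continuous_intros)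
  then show "(LBINT s:{r..t}. exp (- m * (t - s))) = (1 - exp (- m * (t - r))) / m"
    by (simp add: set_integral_indicator_right diff_divide_distrib)
qed

locale bounded_signal =
  fixes \<phi> :: "real \<Rightarrow> real" and B m :: real
  assumes meas [measurable]: "\<phi> \<in> borel_measurable borel"
    and bound: "\<And>s. \<bar>\<phi> s\<bar> \<le> B" and m: "m > 0"
begin

lemma B_nonneg: "0 \<le> B" using bound[of 0] by linarith

lemma exp_le_1: "s \<in> {0..t} \<Longrightarrow> exp (- m * (t - s)) \<le> 1"
  using m by simp

lemma kernel_integrable:
  "set_integrable lborel {0..t} (\<lambda>s. exp (- m * (t - s)) * \<phi> s)"
proof (rule set_integrable_bounded[of _ _ _ B])
  fix s assume s: "s \<in> {0..t}"
  have "\<bar>exp (- m * (t - s)) * \<phi> s\<bar> \<le> 1 * B"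
    unfolding abs_mult using exp_le_1[OF s] bound[of s] by (intro mult_mono) auto
  then show "\<bar>exp (- m * (t - s)) * \<phi> s\<bar> \<le> B" by simp
qed measurable

lemma exp_integrable: "set_integrable lborel {0..t} (\<lambda>s. exp (- m * (t - s)))"
  using exp_le_1 by (intro set_integrable_bounded[of _ _ _ 1]) auto

lemma exp_integral_le: "0 \<le> t \<Longrightarrow> (LBINT s:{0..t}. exp (- m * (t - s))) \<le> 1 / m"
  using m exp_kernel_integral(2)[OF m, of 0 t] by (simp add: divide_right_mono)

lemma abs_kernel_integral_le:
  assumes "0 \<le> t"
  shows "(LBINT s:{0..t}. \<bar>exp (- m * (t - s)) * \<phi> s\<bar>) \<le> B / m"
proof -
  have "(LBINT s:{0..t}. \<bar>exp (- m * (t - s)) * \<phi> s\<bar>) \<le> (LBINT s:{0..t}. B * exp (- m * (t - s)))"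
    using set_integrable_abs[OF kernel_integrable] exp_integrable bound
    by (intro set_integral_mono) (auto simp: abs_mult mult.commute intro!: mult_right_mono)
  also have "\<dots> = B * (LBINT s:{0..t}. exp (- m * (t - s)))" by simp
  also have "\<dots> \<le> B * (1 / m)" using exp_integral_le[OF assms] B_nonneg by (intro mult_left_mono)
  finally show ?thesis by simp
qed

lemma duhamel_bound:
  shows "\<bar>duhamel m \<phi> t\<bar> \<le> B / m"
proof (cases "0 \<le> t")
  case True
  have "\<bar>duhamel m \<phi> t\<bar> \<le> (LBINT s:{0..t}. \<bar>exp (- m * (t - s)) * \<phi> s\<bar>)"
    unfolding duhamel_def using set_integral_norm_bound[OF kernel_integrable] by simp
  then show ?thesis using abs_kernel_integral_le[OF True] by linarith
next
  case False
  then show ?thesis using m B_nonneg by (simp add: duhamel_def set_lebesgue_integral_def)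
qed

lemma signal_integrable: "set_integrable lborel {a..b} \<phi>"
  using bound by (intro set_integrable_bounded) auto

lemma duhamel_integrable: "set_integrable lborel {a..b} (duhamel m \<phi>)"
  using duhamel_bound by (intro set_integrable_bounded) auto

lemma duhamel_ode:
  assumes t: "0 \<le> t"
  shows "duhamel m \<phi> t = (LBINT s:{0..t}. \<phi> s - m * duhamel m \<phi> s)"
proof -
  define H where "H = (\<lambda>(s, r). if 0 \<le> r \<and> r \<le> s \<and> s \<le> t then m * exp (- m * (s - r)) * \<phi> r else 0)"
  have [measurable]: "H \<in> borel_measurable (lborel \<Otimes>\<^sub>M lborel)"
    unfolding H_def case_prod_beta by measurable
  have Hint: "integrable (lborel \<Otimes>\<^sub>M lborel) H"
  proof (rule Bochner_Integration.integrable_bound)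
    show "integrable (lborel \<Otimes>\<^sub>M lborel) (\<lambda>x. m * B * indicator ({0..t} \<times> {0..t}) x)"
      by (intro integrable_mult_right)
        (auto simp: integrable_indicator_iff lborel.emeasure_pair_measure_Times emeasure_lborel_Icc_eq
          simp flip: ennreal_mult')
    have "\<bar>H x\<bar> \<le> m * B * indicator ({0..t} \<times> {0..t}) x" for x
    proof (cases x)
      case (Pair s r)
      have "\<bar>m * exp (- m * (s - r)) * \<phi> r\<bar> \<le> m * 1 * B" if "r \<le> s"
        unfolding abs_mult using m bound[of r] that by (intro mult_mono) auto
      then show ?thesis using Pair m B_nonneg by (auto simp: H_def indicator_def)
    qed
    then show "AE x in lborel \<Otimes>\<^sub>M lborel. norm (H x) \<le> norm (m * B * indicator ({0..t} \<times> {0..t}) x)"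
      unfolding real_norm_def by (intro AE_I2 order_trans[OF _ abs_ge_self])
  qed measurable
  have inner_s: "(LINT r|lborel. H (s, r)) = indicator {0..t} s * (m * duhamel m \<phi> s)" for s
  proof -
    have "(LINT r|lborel. H (s, r)) = (LINT r|lborel. (indicator {0..t} s * m) * (indicator {0..s} r *\<^sub>R (exp (- m * (s - r)) * \<phi> r)))"
      by (intro Bochner_Integration.integral_cong) (auto simp: H_def indicator_def)
    then show ?thesis by (simp add: duhamel_def set_lebesgue_integral_def)
  qed
  have inner_r: "(LINT s|lborel. H (s, r)) = indicator {0..t} r * ((1 - exp (- m * (t - r))) * \<phi> r)" for r
  proof (cases "r \<in> {0..t}")
    case True
    have "(LINT s|lborel. H (s, r)) = (LINT s|lborel. (m * \<phi> r) * (indicator {r..t} s *\<^sub>R exp (- m * (s - r))))"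
      using True by (intro Bochner_Integration.integral_cong) (auto simp: H_def indicator_def)
    also have "\<dots> = (m * \<phi> r) * ((1 - exp (- m * (t - r))) / m)"
      using exp_kernel_integral(1)[OF m, of r t] True by (simp add: set_lebesgue_integral_def)
    finally show ?thesis using True m by simp
  next
    case False
    then have "H (s, r) = 0" for s by (auto simp: H_def)
    then show ?thesis using False by simp
  qed
  have "m * (LBINT s:{0..t}. duhamel m \<phi> s) = (LINT s|lborel. LINT r|lborel. H (s, r))"
    unfolding inner_s set_lebesgue_integral_def
    by (simp add: mult.left_commute)
  also have "\<dots> = (LINT r|lborel. LINT s|lborel. H (s, r))"
    using lborel_pair.Fubini_integral[of "\<lambda>s r. H (s, r)"] Hint by simp
  also have "\<dots> = (LBINT r:{0..t}. \<phi> r - exp (- m * (t - r)) * \<phi> r)"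
    unfolding inner_r set_lebesgue_integral_def by (simp add: left_diff_distrib)
  also have "\<dots> = (LBINT r:{0..t}. \<phi> r) - duhamel m \<phi> t"
    unfolding duhamel_def by (intro set_integral_diff signal_integrable kernel_integrable)
  finally have "duhamel m \<phi> t = (LBINT r:{0..t}. \<phi> r) - (LBINT s:{0..t}. m * duhamel m \<phi> s)" by simp
  also have "\<dots> = (LBINT s:{0..t}. \<phi> s - m * duhamel m \<phi> s)"
    using duhamel_integrable signal_integrable by (intro set_integral_diff(2)[symmetric]) auto
  finally show ?thesis .
qed

lemma square_signal: "bounded_signal (\<lambda>s. (\<phi> s)\<^sup>2) (B\<^sup>2) m"
proof
  show "\<bar>(\<phi> s)\<^sup>2\<bar> \<le> B\<^sup>2" for s
    using bound[of s] by (metis abs_ge_zero abs_power2 power2_abs power_mono)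
qed (use m in auto)

lemma duhamel_square_le:
  assumes t: "0 \<le> t"
  shows "m * (duhamel m \<phi> t)\<^sup>2 \<le> duhamel m (\<lambda>s. (\<phi> s)\<^sup>2) t"
proof -
  interpret sq: bounded_signal "\<lambda>s. (\<phi> s)\<^sup>2" "B\<^sup>2" m by (rule square_signal)
  define c where "c = m * duhamel m \<phi> t"
  let ?E = "\<lambda>s. exp (- m * (t - s))"
  have "0 \<le> (LBINT s:{0..t}. ?E s * (\<phi> s - c)\<^sup>2)"
    unfolding set_lebesgue_integral_def by (intro integral_nonneg_AE AE_I2) auto
  also have "\<dots> = (LBINT s:{0..t}. ?E s * (\<phi> s)\<^sup>2 - 2 * c * (?E s * \<phi> s) + c\<^sup>2 * ?E s)"
    by (simp add: power2_diff algebra_simps)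
  also have "\<dots> = duhamel m (\<lambda>s. (\<phi> s)\<^sup>2) t - 2 * c * duhamel m \<phi> t + c\<^sup>2 * (LBINT s:{0..t}. ?E s)"
    unfolding duhamel_def using sq.kernel_integrable kernel_integrable exp_integrable
    by (subst set_integral_add set_integral_diff | intro set_integral_add set_integral_diff set_integrable_mult_right | simp)+
  also have "\<dots> \<le> duhamel m (\<lambda>s. (\<phi> s)\<^sup>2) t - 2 * c * duhamel m \<phi> t + c\<^sup>2 * (1 / m)"
    using exp_integral_le[OF t] by (intro add_left_mono mult_left_mono) auto
  also have "\<dots> = duhamel m (\<lambda>s. (\<phi> s)\<^sup>2) t - m * (duhamel m \<phi> t)\<^sup>2"
    using m by (simp add: c_def power2_eq_square)
  finally show ?thesis by simp
qed

lemma maximal_regularity: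
  assumes T: "0 \<le> T"
  shows "integral {0..T} (\<lambda>s. (m * duhamel m \<phi> s)\<^sup>2) \<le> integral {0..T} (\<lambda>s. (\<phi> s)\<^sup>2)"
proof -
  interpret sq: bounded_signal "\<lambda>s. (\<phi> s)\<^sup>2" "B\<^sup>2" m by (rule square_signal)
  let ?y = "duhamel m (\<lambda>s. (\<phi> s)\<^sup>2)"
  have i1: "(\<lambda>s. (m * duhamel m \<phi> s)\<^sup>2) integrable_on {0..T}"
  proof (rule set_integral_eq_integral(2), rule set_integrable_bounded)
    show "\<bar>(m * duhamel m \<phi> s)\<^sup>2\<bar> \<le> B\<^sup>2" for s
      using duhamel_bound[of s] m
      by (metis abs_ge_zero abs_mult abs_of_pos abs_power2 mult.commute pos_le_divide_eq power2_abs power_mono)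
  qed measurable
  have iy: "?y integrable_on {0..T}" and iphi: "(\<lambda>s. (\<phi> s)\<^sup>2) integrable_on {0..T}"
    by (intro set_integral_eq_integral(2) sq.duhamel_integrable sq.signal_integrable)+
  have "integral {0..T} (\<lambda>s. (m * duhamel m \<phi> s)\<^sup>2) \<le> integral {0..T} (\<lambda>s. m * ?y s)"
  proof (rule integral_le[OF i1])
    show "(\<lambda>s. m * ?y s) integrable_on {0..T}" using integrable_on_cmult_left[OF iy, of m] by simp
    fix s assume "s \<in> {0..T}"
    then have "m * (m * (duhamel m \<phi> s)\<^sup>2) \<le> m * ?y s"
      using duhamel_square_le[of s] m by (intro mult_left_mono) auto
    then show "(m * duhamel m \<phi> s)\<^sup>2 \<le> m * ?y s" by (simp add: power2_eq_square mult_ac)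
  qed
  also have "\<dots> = integral {0..T} (\<lambda>s. (\<phi> s)\<^sup>2) - ?y T"
  proof -
    have "set_integrable lborel {0..T} (\<lambda>s. (\<phi> s)\<^sup>2 - m * ?y s)"
      using sq.signal_integrable sq.duhamel_integrable by (intro set_integral_diff) auto
    then have "?y T = integral {0..T} (\<lambda>s. (\<phi> s)\<^sup>2 - m * ?y s)"
      using sq.duhamel_ode[OF T] set_integral_eq_integral(1) by simp
    also have "\<dots> = integral {0..T} (\<lambda>s. (\<phi> s)\<^sup>2) - integral {0..T} (\<lambda>s. m * ?y s)"
      using integrable_on_cmult_left[OF iy, of m] by (intro integral_diff iphi) simp
    finally show ?thesis by simp
  qed
  also have "\<dots> \<le> integral {0..T} (\<lambda>s. (\<phi> s)\<^sup>2)"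
  proof -
    have "0 \<le> ?y T" unfolding duhamel_def set_lebesgue_integral_def by (intro integral_nonneg_AE AE_I2) auto
    then show ?thesis by simp
  qed
  finally show ?thesis .
qed

end

subsection \<open>Solutions of the inhomogeneous heat equation\<close>

locale heat_source =
  fixes h :: "real \<Rightarrow> real \<Rightarrow> real" and C :: real
  assumes source_measurable [measurable]: "(\<lambda>(s, x). h s x) \<in> borel_measurable borel"
    and source_bound: "\<And>s x. \<bar>h s x\<bar> \<le> C"
begin

definition hk :: "nat \<Rightarrow> real \<Rightarrow> real" where "hk k s = sine_coeff (h s) k"

definition Yk :: "nat \<Rightarrow> real \<Rightarrow> real" where "Yk k = duhamel (mu k) (hk k)"

lemma section_measurable [measurable]: "h s \<in> borel_measurable borel"
  using measurable_compose[OF measurable_Pair1'[of s borel borel] source_measurable[folded borel_prod]]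
  by simp

lemma section_square_integrable: "square_integrable (h s)"
  using source_bound by (intro square_integrable_bounded borel_measurable_leb01) auto

lemma hk_measurable [measurable]: "hk k \<in> borel_measurable borel"
proof -
  have [measurable]: "(\<lambda>(s, x). h s x) \<in> borel_measurable (borel \<Otimes>\<^sub>M borel)"
    using source_measurable by (simp add: borel_prod)
  have "(\<lambda>s. LINT x|lborel. (if 0 < x \<and> x < 1 then h s x * sine k x else 0)) \<in> borel_measurable borel"
    by (rule lborel.borel_measurable_lebesgue_integral) measurable
  moreover have "hk k s = (LINT x|lborel. (if 0 < x \<and> x < 1 then h s x * sine k x else 0))" for s
  proof -
    have "hk k s = (LINT x|lebesgue. indicator {0<..<1} x *\<^sub>R (h s x * sine k x))"
      unfolding hk_def sine_coeff_def by (subst integral_restrict_space) auto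
    also have "\<dots> = (LINT x|lborel. indicator {0<..<1} x *\<^sub>R (h s x * sine k x))"
      by (intro integral_completion) measurable
    also have "\<dots> = (LINT x|lborel. (if 0 < x \<and> x < 1 then h s x * sine k x else 0))"
      by (intro Bochner_Integration.integral_cong) (auto simp: indicator_def)
    finally show ?thesis .
  qed
  ultimately show ?thesis by (simp cong: measurable_cong)
qed

lemma hk_bound: "\<bar>hk k s\<bar> \<le> 2 * C"
  unfolding hk_def using source_bound by (intro sine_coeff_bound borel_measurable_leb01) auto

lemma C_nonneg: "0 \<le> C" using source_bound[of 0 0] by linarith

sublocale mode: bounded_signal "hk k" "2 * C" "mu k" for k
  by unfold_locales (auto intro: hk_bound)

lemma Yk_measurable [measurable]: "Yk k \<in> borel_measurable borel"
  unfolding Yk_def by measurable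

lemma Yk_bound: "\<bar>Yk k t\<bar> \<le> 2 * C / mu k"
  unfolding Yk_def by (rule mode.duhamel_bound)

lemma Yk_summable: "summable (\<lambda>k. \<bar>Yk k t\<bar>)"
  by (rule summable_mu_bounded[of _ "2 * C"]) (rule Yk_bound)

lemma Yk_0: "Yk k 0 = 0"
proof -
  have "AE s in lborel. s \<noteq> (0::real)" by (rule AE_lborel_singleton)
  have "(LINT s|lborel. indicator {0..0::real} s *\<^sub>R (exp (- mu k * (0 - s)) * hk k s)) = (LINT s|(lborel::real measure). 0)"
  proof (rule integral_cong_AE)
    show "AE s in lborel. indicator {0..0::real} s *\<^sub>R (exp (- mu k * (0 - s)) * hk k s) = 0"
      using \<open>AE s in lborel. s \<noteq> 0\<close> by eventually_elim (simp add: indicator_def)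
  qed measurable
  then show ?thesis by (simp add: Yk_def duhamel_def set_lebesgue_integral_def)
qed

definition Y :: "real \<Rightarrow> real \<Rightarrow> real" where "Y t = synth (\<lambda>k. Yk k t)"

lemma Y_measurable [measurable]: "(\<lambda>(t, x). Y t x) \<in> borel_measurable borel"
proof -
  have "(\<lambda>z. \<Sum>k. Yk k (fst z) * sine k (snd z)) \<in> borel_measurable (borel \<Otimes>\<^sub>M borel)"
    by measurable
  then show ?thesis by (simp add: Y_def synth_def case_prod_beta borel_prod)
qed

text \<open>Exchanging the sine series with the time integral exhibits \<open>Y\<close> as a superposition of
  values of the heat semigroup.\<close>

lemma Y_nonneg:
  assumes h: "\<And>s. 0 \<le> s \<Longrightarrow> AE x in leb01. 0 \<le> h s x" and t: "0 \<le> t" and x: "x \<in> {0..1}"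
  shows "0 \<le> Y t x"
proof -
  define f where "f = (\<lambda>k s. indicator {0..t} s *\<^sub>R (exp (- mu k * (t - s)) * hk k s) * sine k x)"
  have int_eq: "(LINT s|lborel. f k s) = Yk k t * sine k x" for k
    by (simp add: f_def Yk_def duhamel_def set_lebesgue_integral_def)
  have int: "integrable lborel (f k)" for k
    using mode.kernel_integrable[of t k] by (simp add: f_def set_integrable_def)
  have "(LINT s|lborel. norm (f k s)) \<le> 4 * C / mu k" for k
  proof -
    have "(LINT s|lborel. norm (f k s)) = (LBINT s:{0..t}. \<bar>exp (- mu k * (t - s)) * hk k s\<bar>) * \<bar>sine k x\<bar>"
      by (simp add: f_def set_lebesgue_integral_def abs_mult)
    also have "\<dots> \<le> (2 * C / mu k) * 2"
      using mode.abs_kernel_integral_le[OF t, of k] sine_bound[of k x] C_nonneg mu_pos[of k]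
      by (intro mult_mono) (auto intro!: divide_nonneg_pos)
    finally show ?thesis by simp
  qed
  then have sm_int: "summable (\<lambda>k. LINT s|lborel. norm (f k s))"
    using summable_mu_bounded[of "\<lambda>k. LINT s|lborel. norm (f k s)" "4 * C"] by simp
  have pw: "summable (\<lambda>k. norm (f k s))" "0 \<le> (\<Sum>k. f k s)" if "s \<noteq> t" for s
  proof -
    show "summable (\<lambda>k. norm (f k s))"
    proof (cases "s \<in> {0..t}")
      case True
      then have "t - s > 0" using that by simp
      then have "summable (\<lambda>k. \<bar>exp (- mu k * (t - s)) * sine k x\<bar> * (2 * C))"
        by (intro summable_mult2 heat_kernel_summable)
      then show ?thesis
      proof (rule summable_comparison_test'[where N=0])
        fix k
        show "norm (norm (f k s)) \<le> \<bar>exp (- mu k * (t - s)) * sine k x\<bar> * (2 * C)"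
          using mult_left_mono[OF hk_bound, of "\<bar>exp (- mu k * (t - s)) * sine k x\<bar>" k s] True
          by (simp add: f_def abs_mult mult_ac)
      qed
    qed (simp add: f_def)
    show "0 \<le> (\<Sum>k. f k s)"
    proof (cases "s \<in> {0..t}")
      case True
      then have "0 \<le> synth (\<lambda>k. exp (- mu k * (t - s)) * sine_coeff (h s) k) x"
        using that h[of s] by (intro heat_semigroup_nonneg x section_square_integrable) auto
      then show ?thesis using True by (simp add: synth_def f_def hk_def)
    qed (simp add: f_def)
  qed
  have ne: "AE s in lborel. s \<noteq> t" by (rule AE_lborel_singleton)
  have "Y t x = (LINT s|lborel. (\<Sum>k. f k s))"
    unfolding Y_def synth_def int_eq[symmetric]
    by (rule integral_suminf[symmetric, OF int _ sm_int]) (use ne pw in \<open>auto elim!: eventually_mono\<close>)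
  also have "\<dots> \<ge> 0"
    by (rule integral_nonneg_AE) (use ne pw in \<open>auto elim!: eventually_mono\<close>)
  finally show ?thesis .
qed

end

context orthonormal_basis begin

lemma tendsto_of_weak:
  assumes weak: "\<And>k. ((\<lambda>s. inner (D s) (e k)) \<longlongrightarrow> inner z (e k)) F"
    and bound: "eventually (\<lambda>s. (norm (D s))\<^sup>2 \<le> q s) F" and q: "(q \<longlongrightarrow> (norm z)\<^sup>2) F"
  shows "(D \<longlongrightarrow> z) F"
proof -
  define B where "B = sqrt ((norm z)\<^sup>2 + 1)"
  have B: "B > 0" by (simp add: B_def add_nonneg_pos)
  have "eventually (\<lambda>s. q s < (norm z)\<^sup>2 + 1) F"
    by (rule order_tendstoD(2)[OF q]) simp
  with bound have DB: "eventually (\<lambda>s. norm (D s) \<le> B) F"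
    by eventually_elim (auto simp: B_def intro!: real_le_rsqrt)
  define zN where "zN = (\<lambda>N. \<Sum>k<N. inner z (e k) *\<^sub>R e k)"
  have zN: "zN \<longlonglongrightarrow> z" using expansion[of z] by (simp add: sums_def zN_def)
  have "((\<lambda>s. inner (D s) z) \<longlongrightarrow> inner z z) F"
  proof (rule tendstoI)
    fix \<epsilon> :: real assume \<epsilon>: "\<epsilon> > 0"
    define W where "W = B + norm z + 1"
    have pos: "W > 0" using B by (simp add: W_def add_pos_nonneg)
    define \<delta> where "\<delta> = \<epsilon> / (2 * W)"
    have \<delta>: "\<delta> > 0" unfolding \<delta>_def using \<epsilon> pos by simp
    obtain N where N: "norm (zN N - z) < \<delta>"
      using LIMSEQ_D[OF zN \<delta>] by blast
    have "((\<lambda>s. inner (D s) (zN N)) \<longlongrightarrow> inner z (zN N)) F"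
      unfolding zN_def inner_sum_right inner_scaleR_right by (intro tendsto_intros weak)
    then have "eventually (\<lambda>s. dist (inner (D s) (zN N)) (inner z (zN N)) < \<epsilon> / 2) F"
      using \<epsilon> by (intro tendstoD) auto
    with DB show "eventually (\<lambda>s. dist (inner (D s) z) (inner z z) < \<epsilon>) F"
    proof eventually_elim
      case (elim s)
      have "inner (D s) z - inner z z = (inner (D s) (zN N) - inner z (zN N)) - inner (D s - z) (zN N - z)"
        by (simp add: inner_diff_left inner_diff_right)
      moreover have "\<bar>inner (D s - z) (zN N - z)\<bar> \<le> W * \<delta>"
      proof (rule order_trans[OF Cauchy_Schwarz_ineq2])
        have "norm (D s - z) \<le> W" using norm_triangle_ineq4[of "D s" z] elim by (simp add: W_def)
        then show "norm (D s - z) * norm (zN N - z) \<le> W * \<delta>"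
          using N pos by (intro mult_mono) auto
      qed
      moreover have "W * \<delta> = \<epsilon> / 2" using pos by (simp add: \<delta>_def)
      ultimately show ?case using elim unfolding dist_real_def by linarith
    qed
  qed
  then have "((\<lambda>s. q s - 2 * inner (D s) z + (norm z)\<^sup>2) \<longlongrightarrow> (norm z)\<^sup>2 - 2 * inner z z + (norm z)\<^sup>2) F"
    by (intro tendsto_add tendsto_diff tendsto_mult tendsto_const q)
  moreover have "(norm z)\<^sup>2 - 2 * inner z z + (norm z)\<^sup>2 = 0"
    unfolding power2_norm_eq_inner by simp
  ultimately have lim: "((\<lambda>s. q s - 2 * inner (D s) z + (norm z)\<^sup>2) \<longlongrightarrow> 0) F" by (simp only:)
  have "((\<lambda>s. (norm (D s - z))\<^sup>2) \<longlongrightarrow> 0) F"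
  proof (rule Lim_null_comparison[OF _ lim])
    show "eventually (\<lambda>s. norm ((norm (D s - z))\<^sup>2) \<le> q s - 2 * inner (D s) z + (norm z)\<^sup>2) F"
      using bound
    proof eventually_elim
      case (elim s)
      have "(norm (D s - z))\<^sup>2 = (norm (D s))\<^sup>2 - 2 * inner (D s) z + (norm z)\<^sup>2"
        unfolding power2_norm_eq_inner by (simp add: inner_diff_left inner_diff_right inner_commute)
      moreover have "norm ((norm (D s - z))\<^sup>2) = (norm (D s - z))\<^sup>2" by simp
      ultimately show ?case using elim by linarith
    qed
  qed
  then have "((\<lambda>s. norm (D s - z)) \<longlongrightarrow> 0) F"
    using tendsto_real_sqrt[of "\<lambda>s. (norm (D s - z))\<^sup>2" 0 F] by simp
  then have "((\<lambda>s. D s - z) \<longlongrightarrow> 0) F" by (simp only: tendsto_norm_zero_iff)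
  then show ?thesis by (rule LIM_zero_cancel)
qed

end

lemma integral_square_le:
  fixes f :: "real \<Rightarrow> real"
  assumes [measurable]: "f \<in> borel_measurable borel" and b: "\<And>s. \<bar>f s\<bar> \<le> B" and st: "s \<le> t"
  shows "(integral {s..t} f)\<^sup>2 \<le> (t - s) * integral {s..t} (\<lambda>x. (f x)\<^sup>2)"
proof (cases "s = t")
  case False
  then have ts: "t - s > 0" using st by simp
  let ?I = "integral {s..t} f"
  define c where "c = ?I / (t - s)"
  have i1: "f integrable_on {s..t}"
    using b by (intro set_integral_eq_integral(2) set_integrable_bounded) auto
  have "\<bar>(f s)\<^sup>2\<bar> \<le> B\<^sup>2" for s
    using b[of s] by (metis abs_ge_zero abs_power2 power2_abs power_mono)
  then have i2: "(\<lambda>x. (f x)\<^sup>2) integrable_on {s..t}"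
    by (intro set_integral_eq_integral(2) set_integrable_bounded[of _ _ _ "B\<^sup>2"]) auto
  have eq: "(\<lambda>x. (f x - c)\<^sup>2) = (\<lambda>x. ((f x)\<^sup>2 - (2 * c) * f x) + c\<^sup>2)"
    by (simp add: power2_diff algebra_simps)
  have h: "((\<lambda>x. ((f x)\<^sup>2 - (2 * c) * f x) + c\<^sup>2) has_integral
      ((integral {s..t} (\<lambda>x. (f x)\<^sup>2) - (2 * c) * ?I) + (t - s) * c\<^sup>2)) {s..t}"
    using has_integral_const_real[of "c\<^sup>2" s t] st
    by (intro has_integral_add has_integral_diff has_integral_mult_right integrable_integral i1 i2) auto
  have "0 \<le> (integral {s..t} (\<lambda>x. (f x)\<^sup>2) - (2 * c) * ?I) + (t - s) * c\<^sup>2"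
    by (rule has_integral_nonneg[OF h[folded eq]]) simp
  also have "\<dots> = integral {s..t} (\<lambda>x. (f x)\<^sup>2) - ?I\<^sup>2 / (t - s)"
    using ts by (simp add: c_def power2_eq_square)
  finally show ?thesis using ts by (simp add: field_simps)
qed simp

context heat_source begin

definition Fk :: "nat \<Rightarrow> real \<Rightarrow> real" where "Fk k t = hk k t - mu k * Yk k t"

definition R :: "real \<Rightarrow> real" where "R t = (\<Sum>k. (Fk k t)\<^sup>2)"

definition Q :: "real \<Rightarrow> real" where "Q t = integral {0..t} R"

lemma Fk_measurable [measurable]: "Fk k \<in> borel_measurable borel"
  unfolding Fk_def by measurable

lemma R_measurable [measurable]: "R \<in> borel_measurable borel"
  unfolding R_def by measurable

lemma Fk_bound: "\<bar>Fk k t\<bar> \<le> 4 * C"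
proof -
  have "\<bar>mu k * Yk k t\<bar> \<le> mu k * (2 * C / mu k)"
    unfolding abs_mult using Yk_bound[of k t] mu_pos[of k] by (intro mult_mono) (auto intro: less_imp_le)
  then show ?thesis using hk_bound[of k t] by (simp add: Fk_def)
qed

lemma Fk_integrable: "Fk k integrable_on {a..b}"
  using Fk_bound by (intro set_integral_eq_integral(2) set_integrable_bounded) auto

lemma Yk_eq_integral: "0 \<le> t \<Longrightarrow> Yk k t = integral {0..t} (Fk k)"
proof -
  assume "0 \<le> t"
  then have "Yk k t = (LBINT s:{0..t}. Fk k s)"
    using mode.duhamel_ode[of t k] by (simp add: Yk_def Fk_def)
  also have "\<dots> = integral {0..t} (Fk k)"
    by (intro set_integral_eq_integral(1) set_integrable_bounded[of _ _ _ "4 * C"] Fk_bound Fk_measurable)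
  finally show ?thesis .
qed

lemma Yk_increment:
  assumes "0 \<le> s" "s \<le> t" shows "Yk k t - Yk k s = integral {s..t} (Fk k)"
  using assms Henstock_Kurzweil_Integration.integral_combine[of 0 s t "Fk k"] Fk_integrable
  by (simp add: Yk_eq_integral)

lemma sum_hk_square_le: "(\<Sum>k<N. (hk k s)\<^sup>2) \<le> C\<^sup>2"
proof -
  have "(\<Sum>k<N. (hk k s)\<^sup>2) \<le> (norm (abs_L2 (h s)))\<^sup>2"
    using Sine.bessel[where u="abs_L2 (h s)" and n=N]
    by (simp add: hk_def sine_coeff_eq_inner section_square_integrable)
  also have "\<dots> = (LINT x|leb01. (h s x)\<^sup>2)" by (intro norm_abs_L2 section_square_integrable)
  also have "\<dots> \<le> (LINT x|leb01. C\<^sup>2)"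
  proof (rule integral_mono)
    show "integrable leb01 (\<lambda>x. (h s x)\<^sup>2)" using section_square_integrable[of s] by (simp add: square_integrable_def)
    show "integrable leb01 (\<lambda>x. C\<^sup>2)" by (rule integrable_leb01_bounded[of _ "C\<^sup>2"]) auto
    show "(h s x)\<^sup>2 \<le> C\<^sup>2" for x
      using source_bound[of s x] by (metis abs_ge_zero power2_abs power_mono)
  qed
  also have "(LINT x|leb01. C\<^sup>2) = C\<^sup>2"
    by (intro LINT_leb01_eqI integrable_leb01_bounded[of _ "C\<^sup>2"])
      (auto simp: has_integral_const_real[of _ 0 1, simplified])
  finally show ?thesis .
qed

lemma Fk_square_integrable: "(\<lambda>s. (Fk k s)\<^sup>2) integrable_on {a..b}" "set_integrable lborel {a..b} (\<lambda>s. (Fk k s)\<^sup>2)"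
proof -
  have "\<bar>(Fk k s)\<^sup>2\<bar> \<le> (4 * C)\<^sup>2" for s
    using Fk_bound[of k s] by (metis abs_ge_zero abs_power2 power2_abs power_mono)
  then show "set_integrable lborel {a..b} (\<lambda>s. (Fk k s)\<^sup>2)"
    by (intro set_integrable_bounded) auto
  then show "(\<lambda>s. (Fk k s)\<^sup>2) integrable_on {a..b}" by (rule set_integral_eq_integral(2))
qed

lemma sum_integral_Fk_le:
  assumes T: "0 \<le> T" shows "(\<Sum>k<N. integral {0..T} (\<lambda>s. (Fk k s)\<^sup>2)) \<le> 4 * T * C\<^sup>2"
proof -
  have i: "(\<lambda>s. (hk k s)\<^sup>2) integrable_on {0..T}" for k
  proof -
    interpret sq: bounded_signal "\<lambda>s. (hk k s)\<^sup>2" "(2 * C)\<^sup>2" "mu k" by (rule mode.square_signal)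
    show ?thesis by (intro set_integral_eq_integral(2) sq.signal_integrable)
  qed
  have j: "(\<lambda>s. (mu k * Yk k s)\<^sup>2) integrable_on {0..T}" for k
  proof (rule set_integral_eq_integral(2), rule set_integrable_bounded)
    show "\<bar>(mu k * Yk k s)\<^sup>2\<bar> \<le> (2 * C)\<^sup>2" for s
    proof -
      have "\<bar>mu k * Yk k s\<bar> \<le> mu k * (2 * C / mu k)"
        unfolding abs_mult using Yk_bound[of k s] mu_pos[of k] by (intro mult_mono) (auto intro: less_imp_le)
      then have "\<bar>mu k * Yk k s\<bar> \<le> 2 * C" by simp
      then show ?thesis by (metis abs_ge_zero abs_power2 power2_abs power_mono)
    qed
  qed measurable
  have "integral {0..T} (\<lambda>s. (Fk k s)\<^sup>2) \<le> 4 * integral {0..T} (\<lambda>s. (hk k s)\<^sup>2)" for k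
  proof -
    have "integral {0..T} (\<lambda>s. (Fk k s)\<^sup>2) \<le> integral {0..T} (\<lambda>s. 2 * (hk k s)\<^sup>2 + 2 * (mu k * Yk k s)\<^sup>2)"
    proof (rule integral_le[OF Fk_square_integrable(1)])
      show "(\<lambda>s. 2 * (hk k s)\<^sup>2 + 2 * (mu k * Yk k s)\<^sup>2) integrable_on {0..T}"
        using i j by (intro integrable_add) (auto intro: integrable_on_cmult_left)
      show "(Fk k s)\<^sup>2 \<le> 2 * (hk k s)\<^sup>2 + 2 * (mu k * Yk k s)\<^sup>2" for s
        using zero_le_power2[of "hk k s + mu k * Yk k s"] by (simp add: Fk_def power2_sum power2_diff)
    qed
    also have "\<dots> = 2 * integral {0..T} (\<lambda>s. (hk k s)\<^sup>2) + 2 * integral {0..T} (\<lambda>s. (mu k * Yk k s)\<^sup>2)"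
      using i[of k] j[of k] by (subst Henstock_Kurzweil_Integration.integral_add) (auto intro: integrable_on_cmult_left)
    also have "\<dots> \<le> 4 * integral {0..T} (\<lambda>s. (hk k s)\<^sup>2)"
      using mode.maximal_regularity[OF T, of k] by (simp add: Yk_def)
    finally show ?thesis .
  qed
  then have "(\<Sum>k<N. integral {0..T} (\<lambda>s. (Fk k s)\<^sup>2)) \<le> (\<Sum>k<N. 4 * integral {0..T} (\<lambda>s. (hk k s)\<^sup>2))"
    by (intro sum_mono)
  also have "\<dots> = 4 * integral {0..T} (\<lambda>s. \<Sum>k<N. (hk k s)\<^sup>2)"
    by (subst integral_sum) (auto simp: sum_distrib_left intro: i)
  also have "\<dots> \<le> 4 * integral {0..T} (\<lambda>s. C\<^sup>2)"
    using i by (intro mult_left_mono integral_le integrable_sum sum_hk_square_le) auto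
  also have "integral {0..T} (\<lambda>s. C\<^sup>2) = T * C\<^sup>2" using T by simp
  finally show ?thesis by simp
qed

lemma R_summable_integrable:
  assumes T: "0 \<le> T"
  shows "AE t in lborel. t \<in> {0..T} \<longrightarrow> summable (\<lambda>k. (Fk k t)\<^sup>2)" "set_integrable lborel {0..T} R"
proof -
  define S where "S = (\<lambda>t. \<Sum>k. ennreal (indicator {0..T} t * (Fk k t)\<^sup>2))"
  have "(\<integral>\<^sup>+t. S t \<partial>lborel) = (\<Sum>k. \<integral>\<^sup>+t. ennreal (indicator {0..T} t * (Fk k t)\<^sup>2) \<partial>lborel)"
    unfolding S_def by (rule nn_integral_suminf) measurable
  also have "\<dots> = (\<Sum>k. ennreal (integral {0..T} (\<lambda>s. (Fk k s)\<^sup>2)))"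
  proof (intro suminf_cong)
    fix k
    have "(\<integral>\<^sup>+t. ennreal (indicator {0..T} t * (Fk k t)\<^sup>2) \<partial>lborel) = ennreal (LINT t|lborel. indicator {0..T} t * (Fk k t)\<^sup>2)"
      using Fk_square_integrable(2)[of 0 T k] by (intro nn_integral_eq_integral) (auto simp: set_integrable_def)
    also have "(LINT t|lborel. indicator {0..T} t * (Fk k t)\<^sup>2) = integral {0..T} (\<lambda>s. (Fk k s)\<^sup>2)"
      using set_integral_eq_integral(1)[OF Fk_square_integrable(2)[of 0 T k]] by (simp add: set_lebesgue_integral_def)
    finally show "(\<integral>\<^sup>+t. ennreal (indicator {0..T} t * (Fk k t)\<^sup>2) \<partial>lborel) = ennreal (integral {0..T} (\<lambda>s. (Fk k s)\<^sup>2))" .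
  qed
  also have "\<dots> \<le> ennreal (4 * T * C\<^sup>2)"
  proof (intro suminf_le_const allI)
    show "(\<Sum>k<N. ennreal (integral {0..T} (\<lambda>s. (Fk k s)\<^sup>2))) \<le> ennreal (4 * T * C\<^sup>2)" for N
      using sum_integral_Fk_le[OF T, of N]
      by (subst sum_ennreal) (auto intro!: ennreal_leI Henstock_Kurzweil_Integration.integral_nonneg Fk_square_integrable)
  qed simp
  finally have S: "(\<integral>\<^sup>+t. S t \<partial>lborel) < \<infinity>" by (auto simp: le_less_trans)
  have [measurable]: "S \<in> borel_measurable lborel" unfolding S_def by measurable
  have fin: "AE t in lborel. S t \<noteq> \<infinity>"
    using S by (intro nn_integral_PInf_AE) auto
  have sm: "summable (\<lambda>k. indicator {0..T} t * (Fk k t)\<^sup>2)" if "S t \<noteq> \<infinity>" for t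
    using that unfolding S_def by (intro summable_suminf_not_top) auto
  show "AE t in lborel. t \<in> {0..T} \<longrightarrow> summable (\<lambda>k. (Fk k t)\<^sup>2)"
    using fin
  proof eventually_elim
    case (elim t)
    then show ?case using sm[OF elim] by (auto simp: indicator_def)
  qed
  show "set_integrable lborel {0..T} R"
    unfolding set_integrable_def
  proof (rule integrableI_bounded)
    have "AE t in lborel. ennreal (norm (indicator {0..T} t *\<^sub>R R t)) \<le> S t"
      using fin
    proof eventually_elim
      case (elim t)
      have "S t = ennreal (\<Sum>k. indicator {0..T} t * (Fk k t)\<^sup>2)"
        unfolding S_def by (intro suminf_ennreal2 sm elim) auto
      moreover have "norm (indicator {0..T} t *\<^sub>R R t) = (\<Sum>k. indicator {0..T} t * (Fk k t)\<^sup>2)"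
        using sm[OF elim] by (auto simp: indicator_def R_def intro!: abs_of_nonneg suminf_nonneg)
      ultimately show ?case by simp
    qed
    then have "(\<integral>\<^sup>+t. ennreal (norm (indicator {0..T} t *\<^sub>R R t)) \<partial>lborel) \<le> (\<integral>\<^sup>+t. S t \<partial>lborel)"
      by (rule nn_integral_mono_AE)
    then show "(\<integral>\<^sup>+t. ennreal (norm (indicator {0..T} t *\<^sub>R R t)) \<partial>lborel) < \<infinity>"
      using S by (rule le_less_trans)
  qed measurable
qed

lemma R_integrable: "0 \<le> s \<Longrightarrow> R integrable_on {s..t}" "0 \<le> s \<Longrightarrow> set_integrable lborel {s..t} R"
proof -
  assume s: "0 \<le> s"
  show "set_integrable lborel {s..t} R"
    by (rule set_integrable_subset[OF R_summable_integrable(2)[of "max 0 t"]]) (use s in auto)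
  then show "R integrable_on {s..t}" by (rule set_integral_eq_integral(2))
qed

lemma Q_increment: "0 \<le> s \<Longrightarrow> s \<le> t \<Longrightarrow> Q t - Q s = integral {s..t} R"
  using Henstock_Kurzweil_Integration.integral_combine[of 0 s t R] R_integrable(1)[of 0 t] by (simp add: Q_def)

lemma sum_Yk_increment_le:
  assumes st: "0 \<le> s" "s \<le> t"
  shows "(\<Sum>k<N. (Yk k t - Yk k s)\<^sup>2) \<le> (t - s) * (Q t - Q s)"
proof -
  have "(\<Sum>k<N. (Yk k t - Yk k s)\<^sup>2) \<le> (\<Sum>k<N. (t - s) * integral {s..t} (\<lambda>x. (Fk k x)\<^sup>2))"
    using st by (intro sum_mono) (simp add: Yk_increment integral_square_le[OF Fk_measurable Fk_bound])
  also have "\<dots> = (t - s) * integral {s..t} (\<lambda>x. \<Sum>k<N. (Fk k x)\<^sup>2)"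
    by (subst integral_sum) (auto simp: sum_distrib_left intro: Fk_square_integrable)
  also have "\<dots> \<le> (t - s) * integral {s..t} R"
  proof (intro mult_left_mono)
    have si: "set_integrable lborel {s..t} (\<lambda>x. \<Sum>k<N. (Fk k x)\<^sup>2)"
      using Fk_square_integrable(2)[of s t] unfolding set_integrable_def scaleR_sum_right
      by (intro Bochner_Integration.integrable_sum)
    have "(LBINT x:{s..t}. \<Sum>k<N. (Fk k x)\<^sup>2) \<le> (LBINT x:{s..t}. R x)"
      unfolding set_lebesgue_integral_def
    proof (rule integral_mono_AE)
      have "0 \<le> t" using st by simp
      show "AE x in lborel. indicator {s..t} x *\<^sub>R (\<Sum>k<N. (Fk k x)\<^sup>2) \<le> indicator {s..t} x *\<^sub>R R x"
        using R_summable_integrable(1)[OF \<open>0 \<le> t\<close>]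
      proof eventually_elim
        case (elim x)
        then show ?case using st by (auto simp: indicator_def R_def intro!: sum_le_suminf)
      qed
    qed (use si R_integrable(2)[OF st(1), of t] in \<open>auto simp: set_integrable_def\<close>)
    then show "integral {s..t} (\<lambda>x. \<Sum>k<N. (Fk k x)\<^sup>2) \<le> integral {s..t} R"
      using si R_integrable(2)[OF st(1), of t] by (simp add: set_integral_eq_integral(1))
  qed (use st in simp)
  finally show ?thesis using st by (simp add: Q_increment)
qed

lemma Q_mono: assumes "0 \<le> s" "s \<le> t" shows "Q s \<le> Q t"
proof (cases "s = t")
  case False
  then have "0 < t - s" using assms by simp
  moreover have "0 \<le> (t - s) * (Q t - Q s)" using sum_Yk_increment_le[OF assms, of 0] by simp
  ultimately show ?thesis by (simp add: zero_le_mult_iff)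
qed simp

end

lemma AE_lebesgue_on_pos_iff: "(AE t in lebesgue_on {0<..}. P t) \<longleftrightarrow> (AE t in lebesgue. 0 < t \<longrightarrow> P t)" for P :: "real \<Rightarrow> bool"
  by (subst AE_restrict_space_iff) simp_all

context heat_source begin

lemma AE_differentiable:
  "AE t in lebesgue_on {0<..}. (Q has_real_derivative R t) (at t) \<and>
     (\<forall>k. (Yk k has_real_derivative Fk k t) (at t)) \<and> summable (\<lambda>k. (Fk k t)\<^sup>2)"
proof -
  have "\<exists>N. negligible N \<and> (\<forall>t\<in>{0<..<real T} - N. (Q has_real_derivative R t) (at t))" for T
    using indefinite_integral_has_derivative_AE[OF R_integrable(1)[of 0 "real T"]] by (simp add: Q_def[abs_def])
  then obtain N1 where N1: "\<And>T. negligible (N1 T)"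
      "\<And>T t. t \<in> {0<..<real T} - N1 T \<Longrightarrow> (Q has_real_derivative R t) (at t)" by metis
  have "\<exists>N. negligible N \<and> (\<forall>t\<in>{0<..<real T} - N. ((\<lambda>t. integral {0..t} (Fk k)) has_real_derivative Fk k t) (at t))" for T k
    using indefinite_integral_has_derivative_AE[OF Fk_integrable[of k 0 "real T"]] .
  then obtain N2 where N2: "\<And>T k. negligible (N2 T k)"
      "\<And>T k t. t \<in> {0<..<real T} - N2 T k \<Longrightarrow> ((\<lambda>t. integral {0..t} (Fk k)) has_real_derivative Fk k t) (at t)"
    by metis
  have notin: "AE t in lebesgue. t \<notin> N" if "negligible N" for N :: "real set"
    using that by (intro AE_not_in) (simp add: negligible_iff_null_sets)
  have "AE t in lebesgue. \<forall>T. t \<notin> N1 T"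
    unfolding AE_all_countable by (intro allI notin N1(1))
  moreover have "AE t in lebesgue. \<forall>T k. t \<notin> N2 T k"
    unfolding AE_all_countable by (intro allI notin N2(1))
  moreover have "AE t in lebesgue. \<forall>T::nat. t \<in> {0..real T} \<longrightarrow> summable (\<lambda>k. (Fk k t)\<^sup>2)"
    unfolding AE_all_countable by (intro allI AE_completion R_summable_integrable(1)) simp
  ultimately have "AE t in lebesgue. 0 < t \<longrightarrow> (Q has_real_derivative R t) (at t) \<and>
     (\<forall>k. (Yk k has_real_derivative Fk k t) (at t)) \<and> summable (\<lambda>k. (Fk k t)\<^sup>2)"
  proof eventually_elim
    case (elim t)
    show ?case
    proof (intro impI conjI allI)
      assume t: "0 < t"
      obtain T :: nat where T: "t < real T" using reals_Archimedean2 by blast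
      then show "(Q has_real_derivative R t) (at t)" using N1(2)[of t T] elim t by auto
      show "summable (\<lambda>k. (Fk k t)\<^sup>2)" using elim(3)[rule_format, of T] T t by auto
      fix k
      have "((\<lambda>t. integral {0..t} (Fk k)) has_real_derivative Fk k t) (at t)"
        using N2(2)[of t T k] elim T t by auto
      then show "(Yk k has_real_derivative Fk k t) (at t)"
        by (rule has_field_derivative_transform_within_open[of _ _ _ "{0<..}"])
          (use t in \<open>auto simp: Yk_eq_integral\<close>)
    qed
  qed
  then show ?thesis unfolding AE_lebesgue_on_pos_iff .
qed

lemma sum_Q_le:
  fixes m :: nat and s t :: "nat \<Rightarrow> real"
  assumes "\<And>i. i < m \<Longrightarrow> 0 \<le> s i \<and> s i \<le> t i \<and> t i \<le> T"
    and disj: "disjoint_family_on (\<lambda>i. {s i<..<t i}) {..<m}" and T: "0 \<le> T"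
  shows "(\<Sum>i<m. Q (t i) - Q (s i)) \<le> Q T"
proof -
  have si: "set_integrable lborel {s i<..<t i} R" if "i < m" for i
    by (rule set_integrable_subset[OF R_integrable(2)[of "s i" "t i"]]) (use assms(1)[OF that] in auto)
  have "(\<Sum>i<m. Q (t i) - Q (s i)) = (\<Sum>i<m. LINT x|lborel. indicator {s i<..<t i} x * R x)"
  proof (rule sum.cong)
    fix i assume "i \<in> {..<m}"
    then have i: "i < m" by simp
    have "Q (t i) - Q (s i) = integral {s i<..<t i} R"
      using Q_increment[of "s i" "t i"] assms(1)[OF i] integral_open_interval[of "s i" "t i" R] by simp
    also have "\<dots> = (LBINT x:{s i<..<t i}. R x)"
      using set_borel_integral_eq_integral(2)[OF si[OF i]] by simp
    finally show "Q (t i) - Q (s i) = (LINT x|lborel. indicator {s i<..<t i} x * R x)"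
      by (simp add: set_lebesgue_integral_def)
  qed simp
  also have "\<dots> = (LINT x|lborel. (\<Sum>i<m. indicator {s i<..<t i} x * R x))"
    using si by (intro Bochner_Integration.integral_sum[symmetric]) (auto simp: set_integrable_def)
  also have "\<dots> \<le> (LINT x|lborel. indicator {0..T} x * R x)"
  proof (rule integral_mono_AE)
    show "integrable lborel (\<lambda>x. \<Sum>i<m. indicator {s i<..<t i} x * R x)"
      using si by (intro Bochner_Integration.integrable_sum) (auto simp: set_integrable_def)
    show "integrable lborel (\<lambda>x. indicator {0..T} x * R x)"
      using R_integrable(2)[of 0 T] by (simp add: set_integrable_def)
    show "AE x in lborel. (\<Sum>i<m. indicator {s i<..<t i} x * R x) \<le> indicator {0..T} x * R x"
      using R_summable_integrable(1)[OF T]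
    proof eventually_elim
      case (elim x)
      have ind: "(\<Sum>i<m. indicator {s i<..<t i} x) = (indicator (\<Union>i<m. {s i<..<t i}) x :: real)"
        by (rule indicator_UN_disjoint[symmetric]) (use disj in auto)
      have sub: "(\<Union>i<m. {s i<..<t i}) \<subseteq> {0..T}" using assms(1) by fastforce
      show ?case
      proof (cases "x \<in> {0..T}")
        case True
        then have "0 \<le> R x" using elim by (auto simp: R_def intro!: suminf_nonneg)
        moreover have "(indicator (\<Union>i<m. {s i<..<t i}) x :: real) \<le> indicator {0..T} x"
          using True by (simp add: indicator_def)
        ultimately show ?thesis unfolding sum_distrib_right[symmetric] ind by (rule mult_right_mono[rotated])
      next
        case False
        then have "x \<notin> (\<Union>i<m. {s i<..<t i})" using sub by blast
        then have "indicator (\<Union>i<m. {s i<..<t i}) x = (0::real)" by (rule indicator_simps(2))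
        then show ?thesis unfolding sum_distrib_right[symmetric] ind using False by simp
      qed
    qed
  qed
  also have "\<dots> = Q T"
    using set_integral_eq_integral(1)[OF R_integrable(2)[of 0 T]] by (simp add: Q_def set_lebesgue_integral_def)
  finally show ?thesis .
qed

end

subsection \<open>From mild to strong solutions\<close>

locale mild_solution =
  fixes f0 :: "real \<Rightarrow> real" and g :: "real \<Rightarrow> real \<Rightarrow> real" and C0 :: real
  assumes f0_measurable [measurable]: "f0 \<in> borel_measurable borel" and f0_bound: "\<And>x. \<bar>f0 x\<bar> \<le> C0"
    and g_measurable [measurable]: "(\<lambda>(t, x). g t x) \<in> borel_measurable borel" and g_bound: "\<And>t x. \<bar>g t x\<bar> \<le> 1"
begin

sublocale heat_source "\<lambda>t x. g t x - f0 x" "1 + C0"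
proof
  have "(\<lambda>(t, x). g t x) \<in> borel_measurable (borel \<Otimes>\<^sub>M borel)"
    using g_measurable by (simp add: borel_prod)
  then have "(\<lambda>z. g (fst z) (snd z) - f0 (snd z)) \<in> borel_measurable (borel \<Otimes>\<^sub>M borel)"
    by (intro borel_measurable_diff) (simp_all add: case_prod_beta)
  then show "(\<lambda>(t, x). g t x - f0 x) \<in> borel_measurable borel"
    by (simp add: case_prod_beta borel_prod)
  show "\<bar>g t x - f0 x\<bar> \<le> 1 + C0" for t x
    using f0_bound[of x] g_bound[of t x] by linarith
qed

definition uk :: "nat \<Rightarrow> real \<Rightarrow> real" where "uk k t = sine_coeff f0 k / mu k + Yk k t"

definition U :: "real \<Rightarrow> real \<Rightarrow> real" where "U t = synth (\<lambda>k. uk k t)"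

definition u :: "real \<Rightarrow> L2" where "u t = abs_L2 (U t)"

lemma f0_square_integrable: "square_integrable f0"
  using f0_bound by (intro square_integrable_bounded borel_measurable_leb01) auto

lemma g_section_measurable [measurable]: "g t \<in> borel_measurable borel"
  using measurable_compose[OF measurable_Pair1'[of t borel borel] g_measurable[folded borel_prod]]
  by simp

lemma g_square_integrable: "square_integrable (g t)"
  using g_bound by (intro square_integrable_bounded borel_measurable_leb01) auto

lemma f0_coeff_bound: "\<bar>sine_coeff f0 k / mu k\<bar> \<le> 2 * C0 / mu k"
proof -
  have "\<bar>sine_coeff f0 k\<bar> \<le> 2 * C0"
    using f0_bound by (intro sine_coeff_bound borel_measurable_leb01) auto
  then show ?thesis using mu_pos[of k] by (simp add: abs_divide abs_of_pos divide_right_mono less_imp_le)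
qed

lemma uk_bound: "\<bar>uk k t\<bar> \<le> (2 + 4 * C0) / mu k"
proof -
  have "(2 + 4 * C0) / mu k = 2 * (1 + C0) / mu k + 2 * C0 / mu k"
    by (simp add: add_divide_distrib[symmetric])
  then show ?thesis
    using Yk_bound[of k t] f0_coeff_bound[of k] unfolding uk_def by linarith
qed

lemma uk_summable: "summable (\<lambda>k. \<bar>uk k t\<bar>)"
  by (rule summable_mu_bounded[of _ "2 + 4 * C0"]) (rule uk_bound)

lemma f0_summable: "summable (\<lambda>k. \<bar>sine_coeff f0 k / mu k\<bar>)"
  by (rule summable_mu_bounded[of _ "2 * C0"]) (rule f0_coeff_bound)

lemma U_eq: "U t x = synth (\<lambda>k. sine_coeff f0 k / mu k) x + Y t x"
  using synth_add[OF f0_summable Yk_summable] by (simp add: U_def uk_def Y_def)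

lemma u_coeff: "inner (u t) (Sine k) = uk k t"
  by (simp add: u_def U_def abs_L2_synth_coeff uk_summable)

lemma norm_u_increment_le:
  assumes "0 \<le> s" "s \<le> t" shows "(norm (u t - u s))\<^sup>2 \<le> (t - s) * (Q t - Q s)"
proof -
  have "(\<lambda>k. (Yk k t - Yk k s)\<^sup>2) sums (norm (u t - u s))\<^sup>2"
    using Sine.parseval_norm[of "u t - u s"] by (simp add: inner_diff_left u_coeff uk_def)
  then show ?thesis
    using sum_Yk_increment_le[OF assms] by (auto simp: sums_def intro: LIMSEQ_le_const2)
qed

lemma u_continuous: "continuous_on {0..} u"
proof -
  have lip: "(dist (u t) (u s))\<^sup>2 \<le> \<bar>t - s\<bar> * Q T" if "s \<in> {0..T}" "t \<in> {0..T}" for s t T :: real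
  proof -
    have *: "(dist (u t) (u s))\<^sup>2 \<le> (t - s) * Q T" if "0 \<le> s" "s \<le> t" "t \<le> T" for s t :: real
    proof -
      have "(dist (u t) (u s))\<^sup>2 \<le> (t - s) * (Q t - Q s)"
        unfolding dist_norm by (rule norm_u_increment_le) (use that in auto)
      also have "\<dots> \<le> (t - s) * Q T"
        using Q_mono[of 0 s] Q_mono[of t T] that by (intro mult_left_mono) (auto simp: Q_def)
      finally show ?thesis .
    qed
    show ?thesis
      using *[of s t] *[of t s] that by (cases "s \<le> t") (auto simp: dist_commute)
  qed
  show ?thesis
    unfolding continuous_on_iff
  proof (intro ballI allI impI)
    fix s \<epsilon> :: real assume s: "s \<in> {0..}" and e: "\<epsilon> > 0"
    define K where "K = Q (s + 1) + 1"
    have K: "K > 0" using Q_mono[of 0 "s + 1"] s by (simp add: K_def Q_def)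
    show "\<exists>d>0. \<forall>t\<in>{0..}. dist t s < d \<longrightarrow> dist (u t) (u s) < \<epsilon>"
    proof (intro exI[of _ "min 1 (\<epsilon>\<^sup>2 / K)"] conjI ballI impI)
      fix t assume t: "t \<in> {0..}" "dist t s < min 1 (\<epsilon>\<^sup>2 / K)"
      have ts: "\<bar>t - s\<bar> < 1" "\<bar>t - s\<bar> < \<epsilon>\<^sup>2 / K" using t(2) by (auto simp: dist_real_def)
      have "(dist (u t) (u s))\<^sup>2 \<le> \<bar>t - s\<bar> * Q (s + 1)"
        by (rule lip) (use s t ts in auto)
      also have "\<dots> \<le> \<bar>t - s\<bar> * K" by (intro mult_left_mono) (auto simp: K_def)
      also have "\<dots> < \<epsilon>\<^sup>2" using ts K by (simp add: pos_less_divide_eq)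
      finally show "dist (u t) (u s) < \<epsilon>" using e by (simp add: power_less_imp_less_base)
    qed (use e K in auto)
  qed
qed

lemma u_absolutely_continuous:
  assumes T: "0 < T1" "T1 \<le> T2" shows "absolutely_continuous_on T1 T2 u"
  unfolding absolutely_continuous_on_def
proof (intro allI impI)
  fix \<epsilon> :: real assume e: "\<epsilon> > 0"
  have QT: "0 \<le> Q T2" using Q_mono[of 0 T2] T by (simp add: Q_def)
  define \<kappa> where "\<kappa> = \<epsilon> / (Q T2 + 1)"
  have \<kappa>: "\<kappa> > 0" using e QT by (simp add: \<kappa>_def)
  have \<kappa>Q: "\<kappa> * Q T2 \<le> \<epsilon>" using e QT by (simp add: \<kappa>_def field_simps)
  show "\<exists>\<delta>>0. \<forall>(m::nat) (s :: nat \<Rightarrow> real) (t :: nat \<Rightarrow> real). (\<forall>i<m. T1 \<le> s i \<and> s i \<le> t i \<and> t i \<le> T2) \<and>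
        disjoint_family_on (\<lambda>i. {s i<..<t i}) {..<m} \<and> (\<Sum>i<m. t i - s i) < \<delta>
        \<longrightarrow> (\<Sum>i<m. dist (u (s i)) (u (t i))) < \<epsilon>"
  proof (intro exI[of _ "\<kappa> * \<epsilon>"] conjI allI impI)
    fix m :: nat and s t :: "nat \<Rightarrow> real"
    assume A: "(\<forall>i<m. T1 \<le> s i \<and> s i \<le> t i \<and> t i \<le> T2) \<and>
        disjoint_family_on (\<lambda>i. {s i<..<t i}) {..<m} \<and> (\<Sum>i<m. t i - s i) < \<kappa> * \<epsilon>"
    have amgm: "x * y \<le> ((x + y) / 2)\<^sup>2" for x y :: real
      using zero_le_power2[of "x - y"] by (simp add: power2_eq_square field_simps)
    have one: "dist (u (s i)) (u (t i)) \<le> ((t i - s i) / \<kappa> + \<kappa> * (Q (t i) - Q (s i))) / 2" if "i < m" for i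
    proof -
      have st: "0 \<le> s i" "s i \<le> t i" using A that T by (auto intro: order_trans)
      let ?a = "t i - s i" and ?b = "Q (t i) - Q (s i)"
      have ab: "0 \<le> ?a" "0 \<le> ?b" using st Q_mono[OF st] by auto
      have "(dist (u (s i)) (u (t i)))\<^sup>2 \<le> ?a * ?b"
        using norm_u_increment_le[OF st] by (simp add: dist_norm norm_minus_commute)
      also have "\<dots> = (?a / \<kappa>) * (\<kappa> * ?b)" using \<kappa> by simp
      also have "\<dots> \<le> ((?a / \<kappa> + \<kappa> * ?b) / 2)\<^sup>2"
        by (rule amgm)
      finally show ?thesis
        by (rule power2_le_imp_le) (use ab \<kappa> in auto)
    qed
    have "(\<Sum>i<m. dist (u (s i)) (u (t i))) \<le> (\<Sum>i<m. ((t i - s i) / \<kappa> + \<kappa> * (Q (t i) - Q (s i))) / 2)"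
      by (rule sum_mono) (use one in auto)
    also have "\<dots> = ((\<Sum>i<m. t i - s i) / \<kappa> + \<kappa> * (\<Sum>i<m. Q (t i) - Q (s i))) / 2"
      by (simp add: sum.distrib sum_distrib_left flip: sum_divide_distrib)
    also have "\<dots> < (\<epsilon> + \<epsilon>) / 2"
    proof -
      have "(\<Sum>i<m. t i - s i) / \<kappa> < \<epsilon>" using A \<kappa> by (simp add: pos_divide_less_eq mult.commute)
      moreover have "\<kappa> * (\<Sum>i<m. Q (t i) - Q (s i)) \<le> \<kappa> * Q T2"
        using A T \<kappa> by (intro mult_left_mono sum_Q_le) (auto intro: order_trans)
      ultimately show ?thesis using \<kappa>Q by simp
    qed
    finally show "(\<Sum>i<m. dist (u (s i)) (u (t i))) < \<epsilon>" by simp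
  qed (use \<kappa> e in auto)
qed

lemma g_coeff: "inner (abs_L2 (g t)) (Sine k) = hk k t + sine_coeff f0 k"
proof -
  have "hk k t = inner (abs_L2 (g t) - abs_L2 f0) (Sine k)"
    by (simp add: hk_def sine_coeff_eq_inner section_square_integrable abs_L2_diff g_square_integrable f0_square_integrable)
  then show ?thesis by (simp add: inner_diff_left sine_coeff_eq_inner f0_square_integrable)
qed

lemma g_L2_measurable: "(\<lambda>t. abs_L2 (g t)) \<in> borel_measurable borel"
proof (rule borel_measurable_LIMSEQ_metric)
  fix N
  have "(\<lambda>t k. inner (abs_L2 (g t)) (Sine k)) \<in> borel_measurable borel"
    unfolding g_coeff by (intro measurable_coordinatewise_then_product) measurable
  moreover have "(\<lambda>c. \<Sum>k<N. c k *\<^sub>R Sine k) \<in> borel_measurable (borel :: (nat \<Rightarrow> real) measure)"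
    by (intro borel_measurable_continuous_onI continuous_intros continuous_on_product_coordinates)
  ultimately show "(\<lambda>t. \<Sum>k<N. inner (abs_L2 (g t)) (Sine k) *\<^sub>R Sine k) \<in> borel_measurable borel"
    by (rule measurable_compose)
next
  show "(\<lambda>N. \<Sum>k<N. inner (abs_L2 (g t)) (Sine k) *\<^sub>R Sine k) \<longlonglongrightarrow> abs_L2 (g t)" for t
    using Sine.expansion[of "abs_L2 (g t)"] by (simp add: sums_def)
qed

lemma norm_g_le: "norm (abs_L2 (g t)) \<le> 1"
proof -
  have "(norm (abs_L2 (g t)))\<^sup>2 = (LINT x|leb01. (g t x)\<^sup>2)" by (intro norm_abs_L2 g_square_integrable)
  also have "\<dots> \<le> (LINT x|leb01. 1)"
  proof (rule integral_mono)
    show "integrable leb01 (\<lambda>x. (g t x)\<^sup>2)" using g_square_integrable[of t] by (simp add: square_integrable_def)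
    show "integrable leb01 (\<lambda>x. 1::real)" by (rule integrable_leb01_bounded[of _ 1]) auto
    show "(g t x)\<^sup>2 \<le> 1" for x using g_bound[of t x] by (simp add: abs_square_le_1)
  qed
  also have "(LINT x|leb01. 1) = (1::real)"
    by (intro LINT_leb01_eqI integrable_leb01_bounded[of _ 1]) (auto simp: has_integral_const_real[of _ 0 1, simplified])
  finally show ?thesis by (simp add: abs_square_le_1)
qed

lemma regular_time:
  assumes Q: "(Q has_real_derivative R t) (at t)" and Yk: "\<And>k. (Yk k has_real_derivative Fk k t) (at t)"
    and sm: "summable (\<lambda>k. (Fk k t)\<^sup>2)" and t: "t > 0"
  shows "u t \<in> H2 \<inter> H10" "\<exists>u'. (u has_vector_derivative u') (at t) \<and> u' - weak_deriv (weak_deriv (u t)) = abs_L2 (g t)"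
proof -
  obtain z where z: "\<And>k. inner z (Sine k) = Fk k t" by (rule Sine.riesz_fischer[OF sm]) blast
  define f where "f = abs_L2 (g t) - z"
  have f: "inner f (Sine k) = mu k * inner (u t) (Sine k)" for k
    by (simp add: f_def inner_diff_left g_coeff z u_coeff uk_def Fk_def distrib_left)
  show "u t \<in> H2 \<inter> H10" using A_H_domI(1,2)[OF f] by simp
  define D where "D = (\<lambda>s. (1 / (s - t)) *\<^sub>R (u s - u t))"
  have "(D \<longlongrightarrow> z) (at t)"
  proof (rule Sine.tendsto_of_weak)
    show "((\<lambda>s. inner (D s) (Sine k)) \<longlongrightarrow> inner z (Sine k)) (at t)" for k
      using Yk[of k] by (simp add: has_field_derivative_iff z D_def inner_diff_left u_coeff uk_def)
    have "(norm z)\<^sup>2 = R t" using Sine.parseval_norm[of z] by (simp add: z R_def sums_iff)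
    then show "((\<lambda>s. (Q s - Q t) / (s - t)) \<longlongrightarrow> (norm z)\<^sup>2) (at t)"
      using Q by (simp add: has_field_derivative_iff)
    have "eventually (\<lambda>s. s \<in> {0<..}) (at t)"
      using t by (intro eventually_at_in_open') auto
    then show "eventually (\<lambda>s. (norm (D s))\<^sup>2 \<le> (Q s - Q t) / (s - t)) (at t)"
    proof eventually_elim
      case (elim s)
      have nD: "(norm (D s))\<^sup>2 = (norm (u s - u t))\<^sup>2 / (s - t)\<^sup>2"
        by (simp add: D_def power_divide)
      have "(norm (u s - u t))\<^sup>2 \<le> (s - t) * (Q s - Q t)"
      proof (cases "t \<le> s")
        case True
        then show ?thesis using norm_u_increment_le[of t s] t by simp
      next
        case False
        then have "(norm (u t - u s))\<^sup>2 \<le> (t - s) * (Q t - Q s)"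
          using elim by (intro norm_u_increment_le) auto
        then show ?thesis by (simp add: norm_minus_commute algebra_simps)
      qed
      then have "(norm (D s))\<^sup>2 \<le> ((s - t) * (Q s - Q t)) / (s - t)\<^sup>2"
        unfolding nD by (intro divide_right_mono) auto
      also have "\<dots> = (Q s - Q t) / (s - t)" by (simp add: power2_eq_square)
      finally show ?case .
    qed
  qed
  then have lim: "((\<lambda>s. norm (D s - z)) \<longlongrightarrow> 0) (at t)"
    by (simp only: tendsto_norm_zero_iff LIM_zero_iff)
  have "(u has_vector_derivative z) (at t)"
    unfolding has_vector_derivative_def has_derivative_iff_norm
  proof
    show "bounded_linear (\<lambda>x. x *\<^sub>R z)" by (rule bounded_linear_scaleR_left)
    have "norm (D s - z) = norm (u s - u t - (s - t) *\<^sub>R z) / norm (s - t)" if "s \<noteq> t" for s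
    proof -
      have "D s - z = (1 / (s - t)) *\<^sub>R (u s - u t - (s - t) *\<^sub>R z)"
        using that by (simp add: D_def scaleR_diff_right)
      then show ?thesis by simp
    qed
    then show "((\<lambda>s. norm (u s - u t - (s - t) *\<^sub>R z) / norm (s - t)) \<longlongrightarrow> 0) (at t)"
      by (intro Lim_transform_eventually[OF lim]) (auto simp: eventually_at_filter)
  qed
  moreover have "z - weak_deriv (weak_deriv (u t)) = abs_L2 (g t)"
    unfolding A_H_domI(3)[OF f] by (simp add: f_def)
  ultimately show "\<exists>u'. (u has_vector_derivative u') (at t) \<and> u' - weak_deriv (weak_deriv (u t)) = abs_L2 (g t)"
    by blast
qed

theorem strong_solution:
  assumes incl: "\<And>t. 0 < t \<Longrightarrow> AE x in leb01. g t x \<in> H0 (U t x)"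
  shows "strong_solution (u 0) u"
  unfolding strong_solution_def
proof (intro conjI allI impI exI[of _ "\<lambda>t. abs_L2 (g t)"])
  show "continuous_on {0..} u" by (rule u_continuous)
  show "absolutely_continuous_on T1 T2 u" if "0 < T1 \<and> T1 \<le> T2" for T1 T2
    using that by (intro u_absolutely_continuous) auto
  have AE_pos: "AE t in lebesgue_on {0<..}. 0 < (t::real)"
    by (rule iffD2[OF AE_lebesgue_on_pos_iff]) simp
  show "AE t in lebesgue_on {0<..}. u t \<in> H2 \<inter> H10"
    using AE_differentiable AE_pos by eventually_elim (use regular_time(1) in blast)
  show "AE t in lebesgue_on {0<..}. \<exists>u'. (u has_vector_derivative u') (at t) \<and>
      u' - weak_deriv (weak_deriv (u t)) = abs_L2 (g t)"
    using AE_differentiable AE_pos by eventually_elim (use regular_time(2) in blast)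
  show gm: "(\<lambda>t. abs_L2 (g t)) \<in> borel_measurable (lebesgue_on {0<..<T})" for T
    using g_L2_measurable by (simp add: measurable_completion measurable_restrict_space1)
  show "integrable (lebesgue_on {0<..<T}) (\<lambda>t. (norm (abs_L2 (g t)))\<^sup>2)" if "0 < T" for T
  proof (rule finite_measure.integrable_const_bound[where B=1])
    show "finite_measure (lebesgue_on {0<..<T})" by (rule finite_measure_lebesgue_on) auto
    show "AE t in lebesgue_on {0<..<T}. norm ((norm (abs_L2 (g t)))\<^sup>2) \<le> 1"
      using norm_g_le by (auto simp: abs_square_le_1)
    have "(\<lambda>v. (norm v)\<^sup>2) \<in> borel_measurable (borel :: L2 measure)"
      by (intro borel_measurable_continuous_onI continuous_intros)
    then show "(\<lambda>t. (norm (abs_L2 (g t)))\<^sup>2) \<in> borel_measurable (lebesgue_on {0<..<T})"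
      by (rule measurable_compose[OF gm])
  qed
  have "AE x in leb01. rep_L2 (abs_L2 (g t)) x \<in> H0 (rep_L2 (u t) x)" if t: "0 < t" for t
    using incl[OF t] L2_rel_rep_abs[OF g_square_integrable, of t] L2_rel_rep_abs[OF square_integrable_synth[OF uk_summable], of t]
    by eventually_elim (simp add: u_def U_def)
  then show "AE t in lebesgue_on {0<..}. AE x in leb01. rep_L2 (abs_L2 (g t)) x \<in> H0 (rep_L2 (u t) x)"
    using AE_pos by (auto elim!: eventually_mono)
qed simp

end

subsection \<open>Existence by monotone iteration\<close>

lemma Y_mono:
  assumes "heat_source h1 C1" "heat_source h2 C2"
    and le: "\<And>s. 0 \<le> s \<Longrightarrow> AE x in leb01. h1 s x \<le> h2 s x" and t: "0 \<le> t" and x: "x \<in> {0..1}"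
  shows "heat_source.Y h1 t x \<le> heat_source.Y h2 t x"
proof -
  interpret h1: heat_source h1 C1 by fact
  interpret h2: heat_source h2 C2 by fact
  interpret d: heat_source "\<lambda>s x. h2 s x - h1 s x" "C2 + C1"
  proof
    have "(\<lambda>z. (case z of (s, x) \<Rightarrow> h2 s x) - (case z of (s, x) \<Rightarrow> h1 s x)) \<in> borel_measurable borel"
      by (intro borel_measurable_diff h1.source_measurable h2.source_measurable)
    then show "(\<lambda>(s, x). h2 s x - h1 s x) \<in> borel_measurable borel" by (simp add: case_prod_beta)
    show "\<bar>h2 s x - h1 s x\<bar> \<le> C2 + C1" for s x
      using h1.source_bound[of s x] h2.source_bound[of s x] by linarith
  qed
  have hk: "d.hk k s = h2.hk k s - h1.hk k s" for k s
  proof -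
    have "d.hk k s = inner (abs_L2 (h2 s) - abs_L2 (h1 s)) (Sine k)"
      by (simp add: d.hk_def sine_coeff_eq_inner d.section_square_integrable abs_L2_diff
          h1.section_square_integrable h2.section_square_integrable)
    then show ?thesis
      by (simp add: inner_diff_left h1.hk_def h2.hk_def sine_coeff_eq_inner
          h1.section_square_integrable h2.section_square_integrable)
  qed
  have "d.Yk k t = h2.Yk k t - h1.Yk k t" for k
  proof -
    have "d.Yk k t = (LBINT s:{0..t}. exp (- mu k * (t - s)) * h2.hk k s - exp (- mu k * (t - s)) * h1.hk k s)"
      by (simp add: d.Yk_def duhamel_def hk right_diff_distrib)
    also have "\<dots> = h2.Yk k t - h1.Yk k t"
      unfolding h2.Yk_def h1.Yk_def duhamel_def
      by (intro set_integral_diff(2) h1.mode.kernel_integrable h2.mode.kernel_integrable)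
    finally show ?thesis .
  qed
  then have "d.Y t x = h2.Y t x - h1.Y t x"
    using synth_diff[OF h2.Yk_summable h1.Yk_summable] by (simp add: d.Y_def h1.Y_def h2.Y_def)
  moreover have "0 \<le> d.Y t x"
    using le by (intro d.Y_nonneg t x) simp
  ultimately show ?thesis by simp
qed

text \<open>The selection of \<open>H0\<close> with value \<open>-1\<close> at \<open>0\<close> is lower semicontinuous, so it commutes with
  increasing limits.\<close>

definition sg :: "real \<Rightarrow> real" where "sg y = (if 0 < y then 1 else - 1)"

lemma sg_mono: "y \<le> z \<Longrightarrow> sg y \<le> sg z" by (auto simp: sg_def)

lemma sg_in_H0: "sg y \<in> H0 y" by (auto simp: sg_def H0_def)

lemma abs_sg [simp]: "\<bar>sg y\<bar> = 1" by (simp add: sg_def)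

lemma sg_measurable [measurable]: "sg \<in> borel_measurable borel"
  unfolding sg_def[abs_def] by measurable

lemma sg_tendsto:
  assumes "(\<lambda>j. y j) \<longlonglongrightarrow> z" "\<And>j. y j \<le> z"
  shows "(\<lambda>j. sg (y j)) \<longlonglongrightarrow> sg z"
proof (cases "0 < z")
  case True
  then have "eventually (\<lambda>j. 0 < y j) sequentially" using order_tendstoD(1)[OF assms(1)] by blast
  then show ?thesis using True by (intro tendsto_eventually) (auto simp: sg_def elim: eventually_mono)
next
  case False
  then have "\<not> 0 < y j" for j using assms(2)[of j] by simp
  then show ?thesis using False by (simp add: sg_def)
qed

lemma sine_coeff_tendsto:
  assumes [measurable]: "\<And>j. f j \<in> borel_measurable borel" "g \<in> borel_measurable borel"
    and b: "\<And>j x. \<bar>f j x\<bar> \<le> C"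
    and lim: "\<And>x. x \<in> {0<..<1} \<Longrightarrow> (\<lambda>j. f j x) \<longlonglongrightarrow> g x"
  shows "(\<lambda>j. sine_coeff (f j) k) \<longlonglongrightarrow> sine_coeff g k"
  unfolding sine_coeff_def
proof (rule integral_dominated_convergence[where w="\<lambda>x. C * 2"])
  show "(\<lambda>x. g x * sine k x) \<in> borel_measurable leb01" "(\<lambda>x. f j x * sine k x) \<in> borel_measurable leb01" for j
    by (intro borel_measurable_leb01, measurable)+
  have C: "0 \<le> C" using b[of 0 0] by linarith
  then show "integrable leb01 (\<lambda>x. C * 2)" by (intro integrable_leb01_bounded[of _ "C * 2"]) auto
  show "AE x in leb01. (\<lambda>j. f j x * sine k x) \<longlonglongrightarrow> g x * sine k x"
    using lim by (intro AE_I2 tendsto_mult tendsto_const) simp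
  show "AE x in leb01. norm (f j x * sine k x) \<le> C * 2" for j
    unfolding real_norm_def abs_mult using b sine_bound C by (intro AE_I2 mult_mono) auto
qed

lemma duhamel_tendsto:
  assumes [measurable]: "\<And>j. f j \<in> borel_measurable borel" "g \<in> borel_measurable borel"
    and b: "\<And>j s. \<bar>f j s\<bar> \<le> C" and m: "m > 0"
    and lim: "\<And>s. 0 \<le> s \<Longrightarrow> (\<lambda>j. f j s) \<longlonglongrightarrow> g s"
  shows "(\<lambda>j. duhamel m (f j) t) \<longlonglongrightarrow> duhamel m g t"
  unfolding duhamel_def set_lebesgue_integral_def
proof (rule integral_dominated_convergence[where w="\<lambda>s. indicator {0..t} s *\<^sub>R C"])
  have C: "0 \<le> C" using b[of 0 0] by linarith
  show "integrable lborel (\<lambda>s. indicator {0..t} s *\<^sub>R C)"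
    using set_integrable_bounded[of "\<lambda>s. C" 0 t C] C by (simp add: set_integrable_def)
  show "AE s in lborel. (\<lambda>j. indicator {0..t} s *\<^sub>R (exp (- m * (t - s)) * f j s)) \<longlonglongrightarrow>
      indicator {0..t} s *\<^sub>R (exp (- m * (t - s)) * g s)"
  proof (intro AE_I2)
    fix s
    show "(\<lambda>j. indicator {0..t} s *\<^sub>R (exp (- m * (t - s)) * f j s)) \<longlonglongrightarrow>
        indicator {0..t} s *\<^sub>R (exp (- m * (t - s)) * g s)"
      by (cases "s \<in> {0..t}") (auto intro!: tendsto_intros lim)
  qed
  show "AE s in lborel. norm (indicator {0..t} s *\<^sub>R (exp (- m * (t - s)) * f j s)) \<le> indicator {0..t} s *\<^sub>R C" for j
  proof (intro AE_I2)
    fix s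
    show "norm (indicator {0..t} s *\<^sub>R (exp (- m * (t - s)) * f j s)) \<le> indicator {0..t} s *\<^sub>R C"
    proof (cases "s \<in> {0..t}")
      case True
      have "\<bar>exp (- m * (t - s)) * f j s\<bar> \<le> 1 * C"
        unfolding abs_mult using True m b[of j s] by (intro mult_mono) auto
      then show ?thesis using True by simp
    qed simp
  qed
qed measurable

lemma suminf_tendsto_dominated:
  fixes f :: "nat \<Rightarrow> nat \<Rightarrow> real"
  assumes lim: "\<And>k. (\<lambda>j. f j k) \<longlonglongrightarrow> g k" and b: "\<And>j k. \<bar>f j k\<bar> \<le> B k" and B: "summable B"
  shows "(\<lambda>j. \<Sum>k. f j k) \<longlonglongrightarrow> (\<Sum>k. g k)"
proof -
  have Bn: "0 \<le> B k" for k using b[of 0 k] by linarith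
  have iB: "integrable (count_space UNIV) B"
    using B Bn by (simp add: integrable_count_space_nat_iff)
  have gB: "\<bar>g k\<bar> \<le> B k" for k
    using LIMSEQ_le_const2[OF tendsto_rabs[OF lim[of k]]] b by blast
  have int: "integrable (count_space UNIV) (f j)" "integrable (count_space UNIV) g" for j
    by (rule Bochner_Integration.integrable_bound[OF iB]; use b gB Bn in \<open>simp add: abs_of_nonneg\<close>)+
  have "(\<lambda>j. integral\<^sup>L (count_space UNIV) (f j)) \<longlonglongrightarrow> integral\<^sup>L (count_space UNIV) g"
    by (rule integral_dominated_convergence[where w=B]) (use iB lim b in auto)
  then show ?thesis using int by (simp add: integral_count_space_nat)
qed

locale subsolution =
  fixes f0 :: "real \<Rightarrow> real" and C0 :: real
  assumes f0_measurable [measurable]: "f0 \<in> borel_measurable borel" and f0_bound: "\<And>x. \<bar>f0 x\<bar> \<le> C0"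
    and sub: "AE x in leb01. f0 x \<le> sg (synth (\<lambda>k. sine_coeff f0 k / mu k) x)"
begin

definition u0 :: "real \<Rightarrow> real" where "u0 = synth (\<lambda>k. sine_coeff f0 k / mu k)"

primrec iter :: "nat \<Rightarrow> real \<Rightarrow> real \<Rightarrow> real" where
  "iter 0 = (\<lambda>t. u0)"
| "iter (Suc j) = (\<lambda>t x. u0 x + heat_source.Y (\<lambda>t x. sg (iter j t x) - f0 x) t x)"

lemma mild_solution_sg:
  assumes "(\<lambda>(t, x). w t x) \<in> borel_measurable borel"
  shows "mild_solution f0 (\<lambda>t x. sg (w t x)) C0"
proof
  have "(\<lambda>z. sg ((\<lambda>(t, x). w t x) z)) \<in> borel_measurable borel"
    by (rule measurable_compose[OF assms sg_measurable])
  then show "(\<lambda>(t, x). sg (w t x)) \<in> borel_measurable borel" by (simp add: case_prod_beta)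
qed (use f0_bound in auto)

lemma u0_measurable: "u0 \<in> borel_measurable borel"
  unfolding u0_def synth_def by measurable

lemma iter_measurable: "(\<lambda>(t, x). iter j t x) \<in> borel_measurable borel"
proof (induction j)
  case 0
  have "(\<lambda>z::real \<times> real. u0 (snd z)) \<in> borel_measurable (borel \<Otimes>\<^sub>M borel)"
    using u0_measurable by measurable
  then show ?case by (simp add: case_prod_unfold borel_prod)
next
  case (Suc j)
  interpret m: mild_solution f0 "\<lambda>t x. sg (iter j t x)" C0 by (rule mild_solution_sg[OF Suc])
  have "(\<lambda>z::real \<times> real. u0 (snd z)) \<in> borel_measurable (borel \<Otimes>\<^sub>M borel)"
    using u0_measurable by measurable
  moreover have "(\<lambda>z. m.Y (fst z) (snd z)) \<in> borel_measurable (borel \<Otimes>\<^sub>M borel)"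
    using m.Y_measurable by (simp add: case_prod_unfold borel_prod)
  ultimately have "(\<lambda>z. u0 (snd z) + m.Y (fst z) (snd z)) \<in> borel_measurable (borel \<Otimes>\<^sub>M borel)"
    by (rule borel_measurable_add)
  then show ?case by (simp add: case_prod_unfold borel_prod)
qed

lemma iter_mild: "mild_solution f0 (\<lambda>t x. sg (iter j t x)) C0"
  by (rule mild_solution_sg[OF iter_measurable])

lemma iter_Suc_eq: "iter (Suc j) t x = mild_solution.U f0 (\<lambda>t x. sg (iter j t x)) t x"
  using mild_solution.U_eq[OF iter_mild, of j t x] by (simp add: u0_def)

lemma iter_heat_source: "heat_source (\<lambda>t x. sg (iter j t x) - f0 x) (1 + C0)"
proof -
  interpret m: mild_solution f0 "\<lambda>t x. sg (iter j t x)" C0 by (rule iter_mild)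
  show ?thesis by (rule m.heat_source_axioms)
qed

lemma iter_mono: "0 \<le> t \<Longrightarrow> x \<in> {0..1} \<Longrightarrow> iter j t x \<le> iter (Suc j) t x"
proof (induction j arbitrary: t x)
  case 0
  have "0 \<le> heat_source.Y (\<lambda>t x. sg (u0 x) - f0 x) t x"
    using sub iter_heat_source[of 0] 0 by (intro heat_source.Y_nonneg[where C="1 + C0"]) (simp_all add: u0_def)
  then show ?case by simp
next
  case (Suc j)
  have "heat_source.Y (\<lambda>t x. sg (iter j t x) - f0 x) t x \<le> heat_source.Y (\<lambda>t x. sg (iter (Suc j) t x) - f0 x) t x"
  proof (rule Y_mono[OF iter_heat_source iter_heat_source _ Suc.prems])
    show "AE x in leb01. sg (iter j s x) - f0 x \<le> sg (iter (Suc j) s x) - f0 x" if "0 \<le> s" for s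
      using Suc.IH[OF that] by (intro AE_I2 diff_right_mono sg_mono) auto
  qed
  then show ?case by simp
qed

lemma iter_bounded: "\<exists>B. \<forall>j t x. \<bar>iter j t x\<bar> \<le> B"
proof -
  have C0: "0 \<le> C0" using f0_bound[of 0] by linarith
  define A where "A = (2 + 4 * C0) * (\<Sum>k. 1 / mu k)"
  have A: "\<bar>synth c x\<bar> \<le> 2 * A" if "\<And>k. \<bar>c k\<bar> \<le> (2 + 4 * C0) / mu k" for c x
  proof -
    have s: "summable (\<lambda>k. \<bar>c k\<bar>)" by (rule summable_mu_bounded[OF that])
    have "(\<Sum>k. \<bar>c k\<bar>) \<le> (\<Sum>k. (2 + 4 * C0) * (1 / mu k))"
      using that by (intro suminf_le s summable_mult summable_inverse_mu) simp
    also have "\<dots> = A" unfolding A_def by (rule suminf_mult[OF summable_inverse_mu])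
    finally show ?thesis using synth_bound[OF s, of x] by simp
  qed
  have "\<bar>iter j t x\<bar> \<le> 2 * A" for j t x
  proof (cases j)
    case 0
    interpret m: mild_solution f0 "\<lambda>t x. sg (iter 0 t x)" C0 by (rule iter_mild)
    have "\<bar>sine_coeff f0 k / mu k\<bar> \<le> (2 + 4 * C0) / mu k" for k
      using m.f0_coeff_bound[of k] C0 mu_pos[of k] by (elim order_trans) (intro divide_right_mono, auto intro: less_imp_le)
    then show ?thesis using 0 A by (simp add: u0_def)
  next
    case (Suc i)
    interpret m: mild_solution f0 "\<lambda>t x. sg (iter i t x)" C0 by (rule iter_mild)
    show ?thesis unfolding Suc iter_Suc_eq m.U_def by (intro A m.uk_bound)
  qed
  then show ?thesis by blast
qed

definition limit :: "real \<Rightarrow> real \<Rightarrow> real" where "limit t x = lim (\<lambda>j. iter j t x)"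

lemma limit_measurable: "(\<lambda>(t, x). limit t x) \<in> borel_measurable borel"
proof -
  have "(\<lambda>z. lim (\<lambda>j. (\<lambda>(t, x). iter j t x) z)) \<in> borel_measurable borel"
    using iter_measurable by measurable
  then show ?thesis by (simp add: limit_def case_prod_beta)
qed

lemma iter_tendsto:
  assumes "0 \<le> t" "x \<in> {0..1}"
  shows "(\<lambda>j. iter j t x) \<longlonglongrightarrow> limit t x" "iter j t x \<le> limit t x"
proof -
  have inc: "incseq (\<lambda>j. iter j t x)" using iter_mono[OF assms] by (rule incseq_SucI)
  obtain B where "\<forall>j t x. \<bar>iter j t x\<bar> \<le> B" using iter_bounded by blast
  then have "\<forall>j. iter j t x \<le> B" by (meson abs_le_D1)
  with inc obtain L where L: "(\<lambda>j. iter j t x) \<longlonglongrightarrow> L" "\<forall>j. iter j t x \<le> L"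
    using incseq_convergent by blast
  then have "limit t x = L" by (simp add: limit_def limI)
  then show "(\<lambda>j. iter j t x) \<longlonglongrightarrow> limit t x" "iter j t x \<le> limit t x" using L by auto
qed

lemma limit_mild: "mild_solution f0 (\<lambda>t x. sg (limit t x)) C0"
  by (rule mild_solution_sg[OF limit_measurable])

lemma limit_eq:
  assumes t: "0 \<le> t" and x: "x \<in> {0..1}"
  shows "mild_solution.U f0 (\<lambda>t x. sg (limit t x)) t x = limit t x"
proof -
  interpret m: mild_solution f0 "\<lambda>t x. sg (limit t x)" C0 by (rule limit_mild)
  let ?hs = "\<lambda>j t x. sg (iter j t x) - f0 x"
  have hk: "(\<lambda>j. heat_source.hk (?hs j) k s) \<longlonglongrightarrow> m.hk k s" if s: "0 \<le> s" for k s
    unfolding heat_source.hk_def[OF iter_heat_source] m.hk_def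
  proof (rule sine_coeff_tendsto)
    show "(\<lambda>x. sg (iter j s x) - f0 x) \<in> borel_measurable borel" for j
      by (rule heat_source.section_measurable[OF iter_heat_source])
    show "(\<lambda>x. sg (limit s x) - f0 x) \<in> borel_measurable borel" by (rule m.section_measurable)
    show "\<bar>sg (iter j s x) - f0 x\<bar> \<le> 1 + C0" for j x
      by (rule heat_source.source_bound[OF iter_heat_source])
    show "(\<lambda>j. sg (iter j s x) - f0 x) \<longlonglongrightarrow> sg (limit s x) - f0 x" if "x \<in> {0<..<1}" for x
      using iter_tendsto[of s x] s that by (intro tendsto_diff sg_tendsto tendsto_const) auto
  qed
  have Yk: "(\<lambda>j. heat_source.Yk (?hs j) k t) \<longlonglongrightarrow> m.Yk k t" for k
    unfolding heat_source.Yk_def[OF iter_heat_source] m.Yk_def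
  proof (rule duhamel_tendsto[OF _ _ _ _ hk])
    show "heat_source.hk (?hs j) k \<in> borel_measurable borel" for j
      by (rule heat_source.hk_measurable[OF iter_heat_source])
    show "\<bar>heat_source.hk (?hs j) k s\<bar> \<le> 2 * (1 + C0)" for j s
      by (rule heat_source.hk_bound[OF iter_heat_source])
  qed simp_all
  have "(\<lambda>j. heat_source.Y (?hs j) t x) \<longlonglongrightarrow> m.Y t x"
    unfolding heat_source.Y_def[OF iter_heat_source] m.Y_def synth_def
  proof (rule suminf_tendsto_dominated)
    show "(\<lambda>j. heat_source.Yk (?hs j) k t * sine k x) \<longlonglongrightarrow> m.Yk k t * sine k x" for k
      by (intro tendsto_mult Yk tendsto_const)
    show "\<bar>heat_source.Yk (?hs j) k t * sine k x\<bar> \<le> 2 * (1 + C0) * 2 * (1 / mu k)" for j k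
    proof -
      have "\<bar>heat_source.Yk (?hs j) k t\<bar> \<le> 2 * (1 + C0) / mu k"
        by (rule heat_source.Yk_bound[OF iter_heat_source])
      moreover from this have "0 \<le> 2 * (1 + C0) / mu k" by linarith
      ultimately have "\<bar>heat_source.Yk (?hs j) k t * sine k x\<bar> \<le> (2 * (1 + C0) / mu k) * 2"
        unfolding abs_mult using sine_bound[of k x] by (intro mult_mono) auto
      then show ?thesis by simp
    qed
    show "summable (\<lambda>k. 2 * (1 + C0) * 2 * (1 / mu k))" by (intro summable_mult summable_inverse_mu)
  qed
  then have "(\<lambda>j. iter (Suc j) t x) \<longlonglongrightarrow> u0 x + m.Y t x"
    by (simp only: iter.simps) (intro tendsto_add tendsto_const)
  moreover have "(\<lambda>j. iter (Suc j) t x) \<longlonglongrightarrow> limit t x"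
    using iter_tendsto(1)[OF t x] by (rule LIMSEQ_Suc)
  ultimately have "u0 x + m.Y t x = limit t x" by (rule LIMSEQ_unique)
  then show ?thesis by (simp add: m.U_eq u0_def)
qed

theorem existence:
  "\<exists>g. mild_solution f0 g C0 \<and>
     (\<forall>t x. 0 \<le> t \<longrightarrow> x \<in> {0..1} \<longrightarrow>
        g t x = sg (mild_solution.U f0 g t x) \<and> u0 x \<le> mild_solution.U f0 g t x)"
proof (intro exI[of _ "\<lambda>t x. sg (limit t x)"] conjI allI impI)
  show "u0 x \<le> mild_solution.U f0 (\<lambda>t x. sg (limit t x)) t x" if "0 \<le> t" "x \<in> {0..1}" for t x
    using iter_tendsto(2)[OF that, of 0] by (simp add: limit_eq[OF that])
qed (simp_all add: limit_mild limit_eq)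

end

subsection \<open>The Green function\<close>

definition green :: "real \<Rightarrow> real \<Rightarrow> real" where
  "green y x = (if x \<le> y then x * (1 - y) else y * (1 - x))"

lemma green_bounds: "y \<in> {0..1} \<Longrightarrow> x \<in> {0..1} \<Longrightarrow> 0 \<le> green y x \<and> green y x \<le> 1"
  by (auto simp: green_def intro!: mult_le_one)

lemma green_lower:
  assumes "0 \<le> a" "b \<le> 1" "x \<in> {a..b}" "y \<in> {a..b}" shows "a * (1 - b) \<le> green y x"
  using assms by (auto simp: green_def intro!: mult_mono)

lemma green_square_integrable: "y \<in> {0..1} \<Longrightarrow> square_integrable (green y)"
proof (rule square_integrable_bounded[of _ 1])
  show "green y \<in> borel_measurable leb01"
    unfolding green_def[abs_def] by (intro borel_measurable_leb01) measurable
qed (use green_bounds in fastforce)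

lemma green_coeff:
  assumes y: "y \<in> {0..1}" shows "sine_coeff (green y) k = sine k y / mu k"
proof -
  define A B where "A = (\<lambda>x. (1 - y) * (sine k x / mu k - x * cosine k x / freq k))"
    and "B = (\<lambda>x. - y * (sine k x / mu k + (1 - x) * cosine k x / freq k))"
  have dA: "(A has_real_derivative (1 - y) * (x * sine k x)) (at x)" for x
    unfolding A_def
    by (auto intro!: derivative_eq_intros sine_deriv cosine_deriv simp: mu_def power2_eq_square field_simps)
  have dB: "(B has_real_derivative y * ((1 - x) * sine k x)) (at x)" for x
    unfolding B_def
    by (auto intro!: derivative_eq_intros sine_deriv cosine_deriv simp: mu_def power2_eq_square field_simps)
  have "((\<lambda>x. (1 - y) * (x * sine k x)) has_integral A y - A 0) {0..y}"
    using y dA by (intro fundamental_theorem_of_calculus)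
      (auto simp flip: has_real_derivative_iff_has_vector_derivative intro: DERIV_subset)
  then have 1: "((\<lambda>x. green y x * sine k x) has_integral A y - A 0) {0..y}"
    by (rule has_integral_eq[rotated]) (auto simp: green_def)
  have "((\<lambda>x. y * ((1 - x) * sine k x)) has_integral B 1 - B y) {y..1}"
    using y dB by (intro fundamental_theorem_of_calculus)
      (auto simp flip: has_real_derivative_iff_has_vector_derivative intro: DERIV_subset)
  then have 2: "((\<lambda>x. green y x * sine k x) has_integral B 1 - B y) {y..1}"
    by (rule has_integral_eq[rotated]) (auto simp: green_def)
  have "((\<lambda>x. green y x * sine k x) has_integral (A y - A 0) + (B 1 - B y)) {0..1}"
    using y by (intro has_integral_combine[OF _ _ 1 2]) auto
  moreover have "(A y - A 0) + (B 1 - B y) = sine k y / mu k"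
  proof -
    define S D where "S = sine k y / mu k" and "D = cosine k y / freq k"
    have "A y = (1 - y) * (S - y * D)" "B y = - y * (S + (1 - y) * D)" "A 0 = 0" "B 1 = 0"
      by (simp_all add: A_def B_def S_def D_def)
    then show ?thesis by (simp add: S_def[symmetric] algebra_simps)
  qed
  ultimately show ?thesis
    unfolding sine_coeff_def
    by (intro LINT_leb01_eqI square_integrable_mult green_square_integrable square_integrable_sine y) simp
qed

lemma green_synth:
  assumes f: "square_integrable f" and y: "y \<in> {0..1}"
  shows "synth (\<lambda>k. sine_coeff f k / mu k) y = (LINT x|leb01. green y x * f x)"
proof -
  have "inner (abs_L2 (green y)) (Sine k) = sine k y / mu k" for k
    using sine_coeff_eq_inner[OF green_square_integrable[OF y]] green_coeff[OF y] by simp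
  then have "(\<lambda>k. sine k y / mu k * sine_coeff f k) sums inner (abs_L2 (green y)) (abs_L2 f)"
    using Sine.parseval[of "abs_L2 (green y)" "abs_L2 f"]
    by (simp add: sine_coeff_eq_inner[symmetric] f)
  then have "synth (\<lambda>k. sine_coeff f k / mu k) y = inner (abs_L2 (green y)) (abs_L2 f)"
    by (simp add: synth_def sums_iff mult.commute)
  also have "\<dots> = (LINT x|leb01. green y x * f x)"
    by (intro inner_abs_L2 f green_square_integrable y)
  finally show ?thesis .
qed

lemma indicator_square_integrable: "square_integrable (indicat_real {a<..<b})"
  by (rule square_integrable_bounded[of _ 1]) (auto intro!: borel_measurable_leb01 simp: indicator_def)

lemma LINT_indicator:
  assumes "0 \<le> a" "a \<le> b" "b \<le> 1"
  shows "(LINT x|leb01. indicat_real {a<..<b} x) = b - a"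
proof -
  have "((\<lambda>x. 1::real) has_integral (b - a)) {a..b}"
    using has_integral_const_real[of "1::real" a b] assms by simp
  then have "((\<lambda>x. 1::real) has_integral (b - a)) {a<..<b}"
    by (simp add: has_integral_Icc_iff_Ioo)
  then have "((\<lambda>x. if x \<in> {a<..<b} then 1 else 0 :: real) has_integral (b - a)) {0..1}"
    using assms by (subst has_integral_restrict) auto
  moreover have "indicat_real {a<..<b} = (\<lambda>x. if x \<in> {a<..<b} then 1 else 0)"
    by (auto simp: indicator_def)
  ultimately show ?thesis
    by (intro LINT_leb01_eqI square_integrable_imp_integrable indicator_square_integrable) simp
qed

lemma green_integral_interval:
  assumes "0 \<le> a" "a \<le> b" "b \<le> 1" "y \<in> {a..b}"
  shows "(b - a) * (a * (1 - b)) \<le> (LINT x|leb01. green y x * indicator {a<..<b} x)"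
proof -
  have y: "y \<in> {0..1}" using assms by auto
  have i: "integrable leb01 (indicat_real {a<..<b})"
    by (rule square_integrable_imp_integrable[OF indicator_square_integrable])
  have "(b - a) * (a * (1 - b)) = (LINT x|leb01. a * (1 - b) * indicator {a<..<b} x)"
    using LINT_indicator[of a b] assms by simp
  also have "\<dots> \<le> (LINT x|leb01. green y x * indicator {a<..<b} x)"
  proof (rule integral_mono)
    show "integrable leb01 (\<lambda>x. a * (1 - b) * indicator {a<..<b} x)" using i by simp
    show "integrable leb01 (\<lambda>x. green y x * indicator {a<..<b} x)"
      by (intro square_integrable_mult green_square_integrable y indicator_square_integrable)
    show "a * (1 - b) * indicator {a<..<b} x \<le> green y x * indicator {a<..<b} x" for x
      using green_lower[of a b x y] assms by (auto simp: indicator_def)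
  qed
  finally show ?thesis .
qed

subsection \<open>The fixed points\<close>

lemma v_fun_measurable [measurable]: "v_fun n \<in> borel_measurable borel"
proof -
  have "(\<lambda>x. (\<lambda>k::nat. (-1) ^ k :: real) (nat \<lfloor>real n * x\<rfloor>)) \<in> borel_measurable borel"
    "(\<lambda>x. (\<lambda>k::nat. real k) (nat \<lfloor>real n * x\<rfloor>)) \<in> borel_measurable borel"
    by (rule measurable_compose[of _ _ "count_space UNIV"], measurable)+
  then show ?thesis unfolding v_fun_def[abs_def] Let_def by measurable
qed

lemma v_fun_piece:
  assumes "k < n" "x \<in> {real k / real n .. real (k + 1) / real n}"
  shows "v_fun n x = (-1) ^ k * ((x - real k / real n) * (1 / real n - (x - real k / real n)) / 2)"
proof -
  have "- y\<^sup>2 / 2 + y / (2 * real n) = y * (1 / real n - y) / 2" for y :: real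
    by (simp add: power2_eq_square right_diff_distrib diff_divide_distrib)
  then show ?thesis using v_fun_eq[OF assms] by (simp only:)
qed

lemma unit_interval_piece:
  assumes "n > 0" "x \<in> {0..<1}"
  obtains k where "k < n" "x \<in> {real k / real n ..< real (k + 1) / real n}"
proof
  let ?k = "nat \<lfloor>real n * x\<rfloor>"
  have nx: "0 \<le> real n * x" "real n * x < real n" using assms by auto
  have k: "real ?k = of_int \<lfloor>real n * x\<rfloor>" using nx by simp
  have "real ?k < real n" unfolding k using nx by linarith
  then show "?k < n" by simp
  have "real ?k \<le> real n * x" "real n * x < real ?k + 1" unfolding k by linarith+
  then show "x \<in> {real ?k / real n ..< real (?k + 1) / real n}"
    using assms by (auto simp: field_simps)
qed

lemma v_fun_bound: "n > 0 \<Longrightarrow> x \<in> {0<..<1} \<Longrightarrow> \<bar>v_fun n x\<bar> \<le> 1"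
proof -
  assume n: "n > 0" and x: "x \<in> {0<..<1}"
  obtain k where k: "k < n" "x \<in> {real k / real n ..< real (k + 1) / real n}"
    using unit_interval_piece[of n x] n x by auto
  define y where "y = x - real k / real n"
  have n1: "1 / real n \<le> 1" using n by simp
  have y: "0 \<le> y" "y \<le> 1 / real n" using k by (auto simp: y_def add_divide_distrib)
  have "\<bar>v_fun n x\<bar> = y * (1 / real n - y) / 2"
  proof -
    have "v_fun n x = (-1) ^ k * (y * (1 / real n - y) / 2)"
      using v_fun_piece[of k n x] k by (simp add: y_def)
    moreover have "0 \<le> y * (1 / real n - y) / 2" using y by simp
    ultimately show ?thesis by (simp only: abs_mult power_abs abs_minus_cancel abs_one power_one mult_1 abs_of_nonneg)
  qed
  also have "\<dots> \<le> 1 * 1" using y n1 mult_mono[of y 1 "1 / real n - y" 1] by simp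
  finally show ?thesis by simp
qed

lemma v_fun_square_integrable: "n > 0 \<Longrightarrow> square_integrable (v_fun n)"
  by (rule square_integrable_bounded[of _ 1]) (auto intro!: borel_measurable_leb01 v_fun_bound)

definition v_sign :: "nat \<Rightarrow> real \<Rightarrow> real" where "v_sign n x = sg (v_fun n x)"

lemma v_sign_measurable [measurable]: "v_sign n \<in> borel_measurable borel"
  unfolding v_sign_def[abs_def] by measurable

lemma v_sign_square_integrable: "square_integrable (v_sign n)"
  by (rule square_integrable_bounded[of _ 1]) (auto intro!: borel_measurable_leb01 simp: v_sign_def)

text \<open>On each piece, \<open>v e' - v' e\<close> with \<open>e = sine k\<close> is an antiderivative; the boundary terms telescope
  because \<open>v\<close> vanishes and \<open>v'\<close> is continuous at the nodes.\<close>

lemma v_sign_coeff: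
  assumes n: "n > 0"
  shows "sine_coeff (v_sign n) k = mu k * sine_coeff (v_fun n) k"
proof -
  let ?f = "\<lambda>x. (v_sign n x - mu k * v_fun n x) * sine k x"
  define \<Phi> where "\<Phi> = (\<lambda>m. - ((-1) ^ m) * sine k (real m / real n) / (2 * real n))"
  have "m \<le> n \<Longrightarrow> (?f has_integral \<Phi> m) {0..real m / real n}" for m
  proof (induction m)
    case 0
    then show ?case using has_integral_refl[of ?f 0] by (simp add: \<Phi>_def)
  next
    case (Suc m)
    define a b where "a = real m / real n" and "b = real (Suc m) / real n"
    have ab: "0 \<le> a" "a < b" "b - a = 1 / real n"
      using n by (auto simp: a_def b_def field_simps)
    define F where "F = (\<lambda>x. (-1) ^ m * (((x - a) * (1 / real n - (x - a)) / 2) * (freq k * cosine k x)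
        - (1 / (2 * real n) - (x - a)) * sine k x))"
    have "(?f has_integral F b - F a) {a..b}"
    proof (rule fundamental_theorem_of_calculus_interior)
      show "a \<le> b" using ab by simp
      show "continuous_on {a..b} F" unfolding F_def by (intro continuous_intros) auto
      fix x assume x: "x \<in> {a<..<b}"
      have v: "v_fun n x = (-1) ^ m * ((x - a) * (1 / real n - (x - a)) / 2)"
        using v_fun_piece[of m n x] Suc.prems x by (simp add: a_def b_def)
      have pos: "0 < (x - a) * (1 / real n - (x - a)) / 2"
        using x ab by (intro divide_pos_pos mult_pos_pos) auto
      have s: "v_sign n x = (-1) ^ m"
        using pos by (cases "even m") (auto simp: v_sign_def v sg_def)
      have "(F has_real_derivative ?f x) (at x)"
        unfolding F_def s v using n
        by (auto intro!: derivative_eq_intros sine_deriv cosine_deriv simp: mu_def power2_eq_square field_simps)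
      then show "(F has_vector_derivative ?f x) (at x)"
        by (simp add: has_real_derivative_iff_has_vector_derivative)
    qed
    moreover have "F a = \<Phi> m" by (simp add: F_def \<Phi>_def a_def)
    moreover have "F b = \<Phi> (Suc m)"
    proof -
      have "1 / real n - (b - a) = 0" "1 / (2 * real n) - (b - a) = - 1 / (2 * real n)"
        unfolding ab(3) using n by (simp_all add: field_simps)
      note eqs = this
      show ?thesis unfolding F_def eqs \<Phi>_def by (simp add: b_def)
    qed
    ultimately have 2: "(?f has_integral \<Phi> (Suc m) - \<Phi> m) {a..b}" by simp
    have 1: "(?f has_integral \<Phi> m) {0..a}" using Suc by (simp add: a_def)
    have "(?f has_integral \<Phi> m + (\<Phi> (Suc m) - \<Phi> m)) {0..b}"
      using ab by (intro has_integral_combine[OF _ _ 1 2]) auto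
    then show ?case by (simp add: b_def)
  qed
  from this[of n] have "(?f has_integral 0) {0..1}" using n by (simp add: \<Phi>_def)
  moreover have "integrable leb01 ?f"
    using n by (intro square_integrable_mult square_integrable_diff square_integrable_cmult
        v_sign_square_integrable v_fun_square_integrable square_integrable_sine)
  ultimately have "(LINT x|leb01. ?f x) = 0" by (intro LINT_leb01_eqI)
  moreover have "(LINT x|leb01. ?f x) = sine_coeff (v_sign n) k - mu k * sine_coeff (v_fun n) k"
  proof -
    have i: "integrable leb01 (\<lambda>x. v_sign n x * sine k x)" "integrable leb01 (\<lambda>x. v_fun n x * sine k x)"
      using n by (auto intro!: square_integrable_mult v_sign_square_integrable v_fun_square_integrable square_integrable_sine)
    have "(LINT x|leb01. ?f x) = (LINT x|leb01. v_sign n x * sine k x - mu k * (v_fun n x * sine k x))"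
      by (simp add: left_diff_distrib mult.assoc)
    also have "\<dots> = sine_coeff (v_sign n) k - mu k * sine_coeff (v_fun n) k"
      unfolding sine_coeff_def using i by simp
    finally show ?thesis .
  qed
  ultimately show ?thesis by simp
qed

subsection \<open>Scaling by signs\<close>

text \<open>The problem is invariant under \<open>u \<mapsto> - u\<close>; the factor \<open>c \<in> {1, - 1}\<close> treats
  \<open>v_plus\<close> and \<open>v_minus\<close> together.\<close>

lemma (in mild_solution) strong_solution_scaled:
  assumes c: "c = 1 \<or> c = - 1" and incl: "\<And>t. 0 < t \<Longrightarrow> AE x in leb01. g t x \<in> H0 (U t x)"
  shows "strong_solution (c *\<^sub>R u 0) (\<lambda>t. c *\<^sub>R u t)"
proof (cases "c = 1")
  case True
  then show ?thesis using strong_solution[OF incl] by simp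
next
  case False
  then have c: "c = - 1" using c by simp
  interpret m: mild_solution "\<lambda>x. - f0 x" "\<lambda>t x. - g t x" C0
  proof
    show "(\<lambda>x. - f0 x) \<in> borel_measurable borel" by measurable
    have "(\<lambda>z. - (\<lambda>(t, x). g t x) z) \<in> borel_measurable borel"
      by (rule borel_measurable_uminus[OF g_measurable])
    then show "(\<lambda>(t, x). - g t x) \<in> borel_measurable borel" by (simp add: case_prod_unfold)
  qed (use f0_bound g_bound in auto)
  have sc: "sine_coeff (\<lambda>x. - f x) k = - sine_coeff f k" for f k
    by (simp add: sine_coeff_def)
  have hk: "m.hk k s = - hk k s" for k s
    unfolding m.hk_def hk_def using sc[of "\<lambda>x. g s x - f0 x" k] by simp
  have Yk: "m.Yk k t = - Yk k t" for k t
    unfolding m.Yk_def Yk_def duhamel_def hk by (simp add: set_lebesgue_integral_def)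
  have uk: "m.uk k t = - uk k t" for k t
    unfolding m.uk_def uk_def Yk sc by simp
  have U: "m.U t x = - U t x" for t x
    using sums_unique[OF sums_minus[OF synth_sums[OF uk_summable, of t x]]]
    unfolding m.U_def U_def uk synth_def by simp
  have u: "m.u t = - u t" for t
    unfolding m.u_def u_def U[abs_def]
    by (intro abs_L2_uminus[symmetric]) (simp add: U_def square_integrable_synth uk_summable)
  have "strong_solution (m.u 0) m.u"
  proof (rule m.strong_solution)
    show "AE x in leb01. - g t x \<in> H0 (m.U t x)" if "0 < t" for t
      using incl[OF that] by eventually_elim (auto simp: H0_def U split: if_splits)
  qed
  then show ?thesis by (simp add: c u[abs_def])
qed

lemma sine_coeff_add:
  assumes "square_integrable f" "square_integrable g"
  shows "sine_coeff (\<lambda>x. f x + g x) k = sine_coeff f k + sine_coeff g k"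
  using assms
  by (simp add: sine_coeff_eq_inner square_integrable_add abs_L2_add[symmetric] inner_add_left)

lemma sine_coeff_cmult: "sine_coeff (\<lambda>x. c * f x) k = c * sine_coeff f k"
  by (simp add: sine_coeff_def mult.assoc)

lemma v_sign_summable: "summable (\<lambda>k. \<bar>sine_coeff (v_sign n) k / mu k\<bar>)"
proof (rule summable_mu_bounded[of _ 2])
  fix k
  have "\<bar>sine_coeff (v_sign n) k\<bar> \<le> 2 * 1"
    by (intro sine_coeff_bound borel_measurable_leb01) (auto simp: v_sign_def)
  then show "\<bar>sine_coeff (v_sign n) k / mu k\<bar> \<le> 2 / mu k"
    using mu_pos[of k] by (simp add: abs_divide abs_of_pos divide_right_mono less_imp_le)
qed

lemma v_plus_coeff: "n > 0 \<Longrightarrow> inner (v_plus n) (Sine k) = sine_coeff (v_sign n) k / mu k"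
  using sine_coeff_eq_inner[OF v_fun_square_integrable, of n k] v_sign_coeff[of n k] by (simp add: v_plus_def)

lemma v_fun_AE_synth:
  assumes n: "n > 0"
  shows "AE x in leb01. synth (\<lambda>k. sine_coeff (v_sign n) k / mu k) x = v_fun n x"
proof (rule abs_L2_eqD)
  show "abs_L2 (synth (\<lambda>k. sine_coeff (v_sign n) k / mu k)) = abs_L2 (v_fun n)"
    using abs_L2_synth_coeff[OF v_sign_summable[of n]] v_plus_coeff[OF n]
    by (intro Sine.eqI) (simp add: v_plus_def)
qed (use n in \<open>auto intro!: square_integrable_synth v_sign_summable v_fun_square_integrable\<close>)

lemma fixed_point_v:
  assumes n: "n > 0" and c: "c = 1 \<or> c = - 1"
  shows "fixed_point (c *\<^sub>R v_plus n)"
proof -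
  interpret m: mild_solution "v_sign n" "\<lambda>t. v_sign n" 1
  proof
    have "(\<lambda>z::real \<times> real. v_sign n (snd z)) \<in> borel_measurable (borel \<Otimes>\<^sub>M borel)" by measurable
    then show "(\<lambda>(t::real, x). v_sign n x) \<in> borel_measurable borel" by (simp add: case_prod_unfold borel_prod)
  qed (auto simp: v_sign_def)
  have hk: "m.hk k s = 0" for k s unfolding m.hk_def sine_coeff_def by simp
  have Yk: "m.Yk k t = 0" for k t unfolding m.Yk_def duhamel_def hk by (simp add: set_lebesgue_integral_def)
  have U: "m.U t = synth (\<lambda>k. sine_coeff (v_sign n) k / mu k)" for t
    unfolding m.U_def m.uk_def Yk by simp
  have u: "m.u t = v_plus n" for t
    by (rule Sine.eqI) (simp only: m.u_coeff m.uk_def Yk v_plus_coeff[OF n] add_0_right)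
  have "AE x in leb01. v_sign n x \<in> H0 (m.U t x)" for t
    using v_fun_AE_synth[OF n] unfolding U by eventually_elim (simp add: v_sign_def sg_in_H0)
  then have "strong_solution (c *\<^sub>R m.u 0) (\<lambda>t. c *\<^sub>R m.u t)"
    by (intro m.strong_solution_scaled c)
  then show ?thesis by (simp add: fixed_point_def u)
qed

subsection \<open>Estimates in the fractional power spaces\<close>

lemma V_H_I:
  assumes f: "square_integrable f" and u: "\<And>k. inner u (Sine k) = sine_coeff f k / mu k" and r: "r \<le> 1"
  shows "u \<in> V_H (2 * r)" "(V_H_norm (2 * r) u)\<^sup>2 \<le> (LINT x|leb01. (f x)\<^sup>2)"
proof -
  have le: "(mu k powr (2 * r / 2) * inner u (Sine k))\<^sup>2 \<le> (inner (abs_L2 f) (Sine k))\<^sup>2" for k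
  proof -
    have "mu k powr r \<le> mu k powr 1" using mu_ge_1[of k] r by (intro powr_mono) auto
    then have "mu k powr r / mu k \<le> 1" using mu_pos[of k] by (simp add: less_imp_le)
    then have "(mu k powr r / mu k) * \<bar>sine_coeff f k\<bar> \<le> 1 * \<bar>sine_coeff f k\<bar>" by (intro mult_right_mono) auto
    moreover have "\<bar>mu k powr r * inner u (Sine k)\<bar> = (mu k powr r / mu k) * \<bar>sine_coeff f k\<bar>"
      using mu_pos[of k] by (simp add: u abs_mult abs_divide abs_of_pos)
    ultimately have "\<bar>mu k powr r * inner u (Sine k)\<bar> \<le> \<bar>inner (abs_L2 f) (Sine k)\<bar>"
      by (simp add: sine_coeff_eq_inner f)
    then show ?thesis by (simp add: abs_le_square_iff)
  qed
  show V: "u \<in> V_H (2 * r)"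
    unfolding V_H_iff
  proof (rule summable_comparison_test'[OF Sine.summable_coeff[of "abs_L2 f"]])
    show "norm ((mu k powr (2 * r / 2) * inner u (Sine k))\<^sup>2) \<le> (inner (abs_L2 f) (Sine k))\<^sup>2" for k
      using le[of k] by simp
  qed
  have "(V_H_norm (2 * r) u)\<^sup>2 \<le> (norm (abs_L2 f))\<^sup>2"
    by (rule sums_le[OF le V_H_norm_sums[OF V] Sine.parseval_norm])
  then show "(V_H_norm (2 * r) u)\<^sup>2 \<le> (LINT x|leb01. (f x)\<^sup>2)" by (simp add: norm_abs_L2 f)
qed

lemma V_H_diff:
  assumes "u \<in> V_H s" "v \<in> V_H s" shows "u - v \<in> V_H s"
proof -
  obtain w z where "is_A_H_pow (s / 2) u w" "is_A_H_pow (s / 2) v z"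
    using assms by (auto simp: V_H_def A_H_pow_dom_def)
  then have "is_A_H_pow (s / 2) (u - v) (w - z)"
    by (simp add: is_A_H_pow_iff inner_diff_left right_diff_distrib)
  then show ?thesis by (auto simp: V_H_def A_H_pow_dom_def)
qed

text \<open>The Sobolev embedding into \<open>C\<^sup>1\<close>: the series of \<open>\<mu>\<^sub>k powr (1 - 2 * r)\<close> converges since
  \<open>4 * r - 2 > 1\<close>.\<close>

lemma V_H_Lipschitz:
  assumes r: "3 / 4 < r"
  shows "\<exists>S>0. \<forall>u c \<epsilon> x y. 0 < \<epsilon> \<longrightarrow> u \<in> V_H (2 * r) \<longrightarrow> V_H_norm (2 * r) u \<le> \<epsilon> \<longrightarrow>
    (\<forall>k. \<bar>c k\<bar> = \<bar>inner u (Sine k)\<bar>) \<longrightarrow> summable (\<lambda>k. \<bar>c k\<bar>) \<longrightarrow>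
    \<bar>synth c x - synth c y\<bar> \<le> \<epsilon> * S * \<bar>x - y\<bar>"
proof -
  define b where "b k = mu k powr (1 - 2 * r)" for k
  have sb: "summable b"
  proof (rule summable_comparison_test')
    have "summable (\<lambda>k. real k powr (2 - 4 * r))" using r by (simp add: summable_real_powr_iff)
    then show "summable (\<lambda>k. real (Suc k) powr (2 - 4 * r))" by (subst summable_Suc_iff)
    fix k
    have "b k = freq k powr (2 - 4 * r)"
    proof -
      have "mu k = freq k powr 2" by (simp add: mu_def)
      then show ?thesis unfolding b_def by (simp only: powr_powr) (simp add: algebra_simps)
    qed
    also have "\<dots> \<le> real (Suc k) powr (2 - 4 * r)"
      using freq_ge[of k] r by (intro powr_mono2') auto
    finally show "norm (b k) \<le> real (Suc k) powr (2 - 4 * r)" by (simp add: b_def)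
  qed
  define S where "S = 1 + suminf b"
  have b0: "0 \<le> b k" for k by (simp add: b_def)
  have S: "S > 0" using suminf_nonneg[OF sb b0] by (simp add: S_def)
  show ?thesis
  proof (intro exI[of _ S] conjI allI impI S)
    fix u :: L2 and c :: "nat \<Rightarrow> real" and \<epsilon> x y :: real
    assume \<epsilon>: "0 < \<epsilon>" and u: "u \<in> V_H (2 * r)" "V_H_norm (2 * r) u \<le> \<epsilon>"
      and c': "\<forall>k. \<bar>c k\<bar> = \<bar>inner u (Sine k)\<bar>" and sc: "summable (\<lambda>k. \<bar>c k\<bar>)"
    note c = c'[rule_format]
    define a where "a k = (mu k powr r * inner u (Sine k))\<^sup>2" for k
    have a: "a sums (V_H_norm (2 * r) u)\<^sup>2" using V_H_norm_sums[OF u(1)] by (simp add: a_def[abs_def])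
    have N: "(V_H_norm (2 * r) u)\<^sup>2 \<le> \<epsilon>\<^sup>2" using u(2) by (intro power_mono) (auto simp: V_H_norm_def)
    have cf: "\<bar>c k\<bar> * freq k \<le> (a k / \<epsilon> + \<epsilon> * b k) / 2" for k
    proof -
      define \<alpha> \<beta> where "\<alpha> = mu k powr r * \<bar>c k\<bar>" and "\<beta> = freq k * mu k powr (- r)"
      have "\<alpha>\<^sup>2 = a k" by (simp add: \<alpha>_def a_def power_mult_distrib c)
      moreover have "\<beta>\<^sup>2 = b k"
      proof -
        have "\<beta>\<^sup>2 = mu k powr 1 * (mu k powr (- r) * mu k powr (- r))"
          by (simp add: \<beta>_def power_mult_distrib mu_def power2_eq_square)
        also have "\<dots> = b k" unfolding b_def powr_add[symmetric] by simp
        finally show ?thesis .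
      qed
      moreover have "\<bar>c k\<bar> * freq k = \<alpha> * \<beta>"
      proof -
        have "mu k powr r * mu k powr (- r) = 1" by (simp add: powr_minus)
        then show ?thesis by (simp add: \<alpha>_def \<beta>_def)
      qed
      moreover have "\<alpha> * \<beta> \<le> (\<alpha>\<^sup>2 / \<epsilon> + \<epsilon> * \<beta>\<^sup>2) / 2"
      proof -
        have "0 \<le> (\<alpha> - \<epsilon> * \<beta>)\<^sup>2 / \<epsilon>" using \<epsilon> by simp
        also have "\<dots> = \<alpha>\<^sup>2 / \<epsilon> + \<epsilon> * \<beta>\<^sup>2 - 2 * (\<alpha> * \<beta>)"
          using \<epsilon> by (simp add: power2_eq_square field_simps)
        finally show ?thesis by simp
      qed
      ultimately show ?thesis by simp
    qed
    have "(\<lambda>k. (a k / \<epsilon> + \<epsilon> * b k) / 2) sums (((V_H_norm (2 * r) u)\<^sup>2 / \<epsilon> + \<epsilon> * suminf b) / 2)"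
      by (intro sums_divide sums_add sums_mult a summable_sums sb)
    moreover have "((V_H_norm (2 * r) u)\<^sup>2 / \<epsilon> + \<epsilon> * suminf b) / 2 \<le> (\<epsilon> * S) / 2"
    proof -
      have "(V_H_norm (2 * r) u)\<^sup>2 / \<epsilon> \<le> \<epsilon>" using N \<epsilon> by (simp add: pos_divide_le_eq power2_eq_square)
      then have "(V_H_norm (2 * r) u)\<^sup>2 / \<epsilon> + \<epsilon> * suminf b \<le> \<epsilon> + \<epsilon> * suminf b"
        by (rule add_right_mono)
      also have "\<dots> = \<epsilon> * S" by (simp add: S_def distrib_left)
      finally show ?thesis by (rule divide_right_mono) simp
    qed
    ultimately obtain M where M: "(\<lambda>k. (a k / \<epsilon> + \<epsilon> * b k) / 2) sums M" "M \<le> (\<epsilon> * S) / 2" by blast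
    have sd: "\<bar>sine k x - sine k y\<bar> \<le> 2 * freq k * \<bar>x - y\<bar>" for k
    proof -
      have "\<bar>sin (freq k * x) - sin (freq k * y)\<bar> \<le> \<bar>freq k * x - freq k * y\<bar>"
      proof -
        have "sin (freq k * x) - sin (freq k * y) = 2 * sin ((freq k * x - freq k * y) / 2) * cos ((freq k * x + freq k * y) / 2)"
          by (rule sin_diff_sin)
        also have "\<bar>\<dots>\<bar> \<le> 2 * \<bar>(freq k * x - freq k * y) / 2\<bar> * 1"
          unfolding abs_mult by (intro mult_mono abs_sin_x_le_abs_x) auto
        finally show ?thesis by simp
      qed
      then have "sqrt 2 * \<bar>sin (freq k * x) - sin (freq k * y)\<bar> \<le> 2 * \<bar>freq k * x - freq k * y\<bar>"
        by (intro mult_mono real_le_lsqrt) auto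
      then show ?thesis
        by (simp add: sine_def abs_mult flip: right_diff_distrib)
    qed
    have bd: "\<bar>c k * sine k x - c k * sine k y\<bar> \<le> 2 * \<bar>x - y\<bar> * ((a k / \<epsilon> + \<epsilon> * b k) / 2)" for k
    proof -
      have "\<bar>c k * sine k x - c k * sine k y\<bar> = \<bar>c k\<bar> * \<bar>sine k x - sine k y\<bar>"
        by (simp add: abs_mult flip: right_diff_distrib)
      also have "\<dots> \<le> \<bar>c k\<bar> * (2 * freq k * \<bar>x - y\<bar>)" using sd by (intro mult_left_mono) auto
      also have "\<dots> = 2 * \<bar>x - y\<bar> * (\<bar>c k\<bar> * freq k)" by simp
      also have "\<dots> \<le> 2 * \<bar>x - y\<bar> * ((a k / \<epsilon> + \<epsilon> * b k) / 2)" using cf by (intro mult_left_mono) auto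
      finally show ?thesis .
    qed
    have sm: "(\<lambda>k. c k * sine k x - c k * sine k y) sums (synth c x - synth c y)"
      by (intro sums_diff synth_sums sc)
    have bs: "(\<lambda>k. 2 * \<bar>x - y\<bar> * ((a k / \<epsilon> + \<epsilon> * b k) / 2)) sums (2 * \<bar>x - y\<bar> * M)"
      by (intro sums_mult M)
    have "\<bar>synth c x - synth c y\<bar> \<le> 2 * \<bar>x - y\<bar> * M"
      unfolding abs_le_iff
      using sums_le[OF _ sm bs] sums_le[OF _ sums_minus[OF sm] bs] bd by (auto simp: abs_le_iff)
    also have "\<dots> \<le> 2 * \<bar>x - y\<bar> * ((\<epsilon> * S) / 2)" using M(2) by (intro mult_left_mono) auto
    finally show "\<bar>synth c x - synth c y\<bar> \<le> \<epsilon> * S * \<bar>x - y\<bar>" by (simp add: mult_ac)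
  qed
qed

subsection \<open>Growth of the weighted deviation\<close>

context heat_source begin

text \<open>The left-hand side is the pairing of \<open>Y t\<close> with \<open>green p\<close>, whose second derivative is a Dirac
  mass at \<open>p\<close>; hence the term \<open>- Y s p\<close> in its rate of change.\<close>

lemma green_pairing_growth:
  assumes p: "p \<in> {0..1}" and t: "0 \<le> t"
    and rate: "\<And>s. 0 \<le> s \<Longrightarrow> \<delta> \<le> (LINT x|leb01. green p x * h s x) - Y s p"
  shows "t * \<delta> \<le> (\<Sum>k. Yk k t * (sine k p / mu k))"
proof -
  define f where "f = (\<lambda>k s. indicator {0..t} s *\<^sub>R (Fk k s * (sine k p / mu k)))"
  have si: "set_integrable lborel {0..t} (Fk k)" for k
    by (intro set_integrable_bounded[of _ _ _ "4 * C"] Fk_bound Fk_measurable)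
  have int: "integrable lborel (f k)" for k
    using si[of k] by (simp add: f_def set_integrable_def flip: mult.assoc)
  have int_eq: "(LINT s|lborel. f k s) = Yk k t * (sine k p / mu k)" for k
  proof -
    have "(LINT s|lborel. f k s) = (LBINT s:{0..t}. Fk k s) * (sine k p / mu k)"
      by (simp add: f_def set_lebesgue_integral_def flip: mult.assoc)
    then show ?thesis using set_integral_eq_integral(1)[OF si[of k]] Yk_eq_integral[OF t, of k] by simp
  qed
  have fb: "norm (f k s) \<le> indicator {0..t} s * (8 * C * (1 / mu k))" for k s
  proof -
    have "\<bar>Fk k s * (sine k p / mu k)\<bar> \<le> 4 * C * (2 / mu k)"
      unfolding abs_mult abs_divide using Fk_bound[of k s] sine_bound[of k p] mu_pos[of k] C_nonneg
      by (intro mult_mono) (auto simp: abs_of_pos divide_right_mono less_imp_le)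
    then show ?thesis by (auto simp: f_def indicator_def)
  qed
  have sm: "summable (\<lambda>k. norm (f k s))" for s
  proof (rule summable_comparison_test')
    show "summable (\<lambda>k. indicator {0..t} s * (8 * C * (1 / mu k)))"
      by (intro summable_mult summable_inverse_mu)
    show "norm (norm (f k s)) \<le> indicator {0..t} s * (8 * C * (1 / mu k))" for k
      using fb[of k s] by (simp only: real_norm_def abs_abs)
  qed
  have smi: "summable (\<lambda>k. LINT s|lborel. norm (f k s))"
  proof (rule summable_comparison_test')
    show "summable (\<lambda>k. t * (8 * C * (1 / mu k)))" by (intro summable_mult summable_inverse_mu)
    fix k
    have "(LINT s|lborel. norm (f k s)) \<le> (LINT s|lborel. indicator {0..t} s * (8 * C * (1 / mu k)))"
      using int fb by (intro integral_mono integrable_norm integrable_mult_left)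
        (auto simp: integrable_indicator_iff emeasure_lborel_Icc_eq)
    also have "\<dots> = t * (8 * C * (1 / mu k))" using t by simp
    finally show "norm (LINT s|lborel. norm (f k s)) \<le> t * (8 * C * (1 / mu k))" by simp
  qed
  have sum_eq: "(\<Sum>k. f k s) = indicator {0..t} s * ((LINT x|leb01. green p x * h s x) - Y s p)" for s
  proof -
    have sh: "summable (\<lambda>k. \<bar>sine_coeff (h s) k / mu k\<bar>)"
    proof (rule summable_mu_bounded[of _ "2 * C"])
      show "\<bar>sine_coeff (h s) k / mu k\<bar> \<le> 2 * C / mu k" for k
        using hk_bound[of k s] mu_pos[of k] by (simp add: hk_def abs_divide abs_of_pos divide_right_mono less_imp_le)
    qed
    have "(\<lambda>k. sine_coeff (h s) k / mu k * sine k p - Yk k s * sine k p) sums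
        (synth (\<lambda>k. sine_coeff (h s) k / mu k) p - Y s p)"
      unfolding Y_def by (intro sums_diff synth_sums sh Yk_summable)
    then have "(\<lambda>k. Fk k s * (sine k p / mu k)) sums ((LINT x|leb01. green p x * h s x) - Y s p)"
      unfolding green_synth[OF section_square_integrable p] by (simp add: Fk_def hk_def field_simps)
    then have "(\<lambda>k. f k s) sums (indicator {0..t} s * ((LINT x|leb01. green p x * h s x) - Y s p))"
      unfolding f_def real_scaleR_def by (rule sums_mult)
    then show ?thesis by (simp add: sums_iff)
  qed
  have "t * \<delta> = (LINT s|lborel. indicator {0..t} s * \<delta>)" using t by simp
  also have "\<dots> \<le> (LINT s|lborel. (\<Sum>k. f k s))"
  proof (rule integral_mono)
    show "integrable lborel (\<lambda>s. indicator {0..t} s * \<delta>)"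
      by (intro integrable_mult_left) (auto simp: integrable_indicator_iff emeasure_lborel_Icc_eq)
    show "integrable lborel (\<lambda>s. \<Sum>k. f k s)"
      by (rule integrable_suminf[OF int _ smi]) (use sm in auto)
    show "indicator {0..t} s * \<delta> \<le> (\<Sum>k. f k s)" for s
      unfolding sum_eq using rate[of s] by (auto simp: indicator_def)
  qed
  also have "\<dots> = (\<Sum>k. LINT s|lborel. f k s)"
    by (rule integral_suminf[OF int _ smi]) (use sm in auto)
  finally show ?thesis by (simp add: int_eq)
qed

lemma green_pairing_bound: "(\<Sum>k. Yk k t * (sine k p / mu k)) \<le> (\<Sum>k. 4 * C * (1 / mu k))"
proof -
  have b: "\<bar>Yk k t * (sine k p / mu k)\<bar> \<le> 4 * C * (1 / mu k)" for k
  proof -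
    have "\<bar>Yk k t\<bar> \<le> 2 * C"
      using Yk_bound[of k t] mu_ge_1[of k] C_nonneg divide_left_mono[of 1 "mu k" "2 * C"] by simp
    then have "\<bar>Yk k t * (sine k p / mu k)\<bar> \<le> (2 * C) * (2 / mu k)"
      unfolding abs_mult abs_divide using sine_bound[of k p] mu_pos[of k] C_nonneg
      by (intro mult_mono) (auto simp: abs_of_pos divide_right_mono less_imp_le)
    then show ?thesis by simp
  qed
  have s: "summable (\<lambda>k. 4 * C * (1 / mu k))" by (intro summable_mult summable_inverse_mu)
  have sY: "summable (\<lambda>k. Yk k t * (sine k p / mu k))"
    by (rule summable_comparison_test'[OF s]) (use b in auto)
  show ?thesis by (rule suminf_le[OF _ sY s]) (rule order_trans[OF abs_ge_self b])
qed

end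

lemma instability:
  fixes n :: nat and r c :: real
  assumes n: "n \<ge> 2" and r: "3 / 4 < r" "r < 1" and c: "c = 1 \<or> c = - 1"
  shows "\<not> stable_in_V_H (2 * r) (c *\<^sub>R v_plus n)"
proof
  assume stable: "stable_in_V_H (2 * r) (c *\<^sub>R v_plus n)"
  have n0: "n > 0" using n by simp
  define p where "p = 1 / real n"
  have p: "0 < p" "p \<le> 1 / 2" using n by (auto simp: p_def field_simps)
  have p01: "p \<in> {0..1}" using p by auto
  define \<eta> where "\<eta> = p / 32"
  have \<eta>: "\<eta> > 0" using p by (simp add: \<eta>_def)
  obtain S where S: "S > 0"
    and lip: "\<forall>u c \<epsilon> x y. 0 < \<epsilon> \<longrightarrow> u \<in> V_H (2 * r) \<longrightarrow> V_H_norm (2 * r) u \<le> \<epsilon> \<longrightarrow>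
    (\<forall>k. \<bar>c k\<bar> = \<bar>inner u (Sine k)\<bar>) \<longrightarrow> summable (\<lambda>k. \<bar>c k\<bar>) \<longrightarrow>
    \<bar>synth c x - synth c y\<bar> \<le> \<epsilon> * S * \<bar>x - y\<bar>"
    using V_H_Lipschitz[OF r(1)] by (elim exE conjE)
  define \<epsilon> where "\<epsilon> = \<eta> / S"
  have \<epsilon>: "\<epsilon> > 0" "\<epsilon> * S = \<eta>" using \<eta> S by (auto simp: \<epsilon>_def)
  have "\<exists>\<gamma>>0. \<forall>u. strong_solution (u 0) u \<and> u 0 \<in> V_H (2 * r) \<and>
      V_H_norm (2 * r) (u 0 - c *\<^sub>R v_plus n) \<le> \<gamma> \<longrightarrow>
      (\<forall>t\<ge>0. u t \<in> V_H (2 * r) \<and> V_H_norm (2 * r) (u t - c *\<^sub>R v_plus n) \<le> \<epsilon>)"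
    by (rule mp[OF spec[OF stable[unfolded stable_in_V_H_def, THEN conjunct2]] \<epsilon>(1)])
  then obtain \<gamma> where \<gamma>: "\<gamma> > 0" and stab: "\<forall>u. strong_solution (u 0) u \<and> u 0 \<in> V_H (2 * r) \<and>
      V_H_norm (2 * r) (u 0 - c *\<^sub>R v_plus n) \<le> \<gamma> \<longrightarrow>
      (\<forall>t\<ge>0. u t \<in> V_H (2 * r) \<and> V_H_norm (2 * r) (u t - c *\<^sub>R v_plus n) \<le> \<epsilon>)"
    by (elim exE conjE)
  define l where "l = min (p / 8) (\<gamma>\<^sup>2 / 4)"
  have l: "0 < l" "l \<le> p / 8" "4 * l \<le> \<gamma>\<^sup>2" using p \<gamma> by (auto simp: l_def)
  define J where "J = {p<..<p + l}"
  define j where "j = (\<lambda>x. 2 * indicat_real J x)"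
  define f0 where "f0 = (\<lambda>x. v_sign n x + j x)"
  have sj: "square_integrable j" unfolding j_def J_def by (intro square_integrable_cmult indicator_square_integrable)
  have sf0: "square_integrable f0" unfolding f0_def by (intro square_integrable_add v_sign_square_integrable sj)
  have jm [measurable]: "j \<in> borel_measurable borel" unfolding j_def J_def by measurable
  have f0m: "f0 \<in> borel_measurable borel" unfolding f0_def by measurable
  have f0b: "\<bar>f0 x\<bar> \<le> 3" for x by (auto simp: f0_def v_sign_def sg_def j_def indicator_def)
  have cf0: "sine_coeff f0 k = sine_coeff (v_sign n) k + sine_coeff j k" for k
    unfolding f0_def by (intro sine_coeff_add v_sign_square_integrable sj)
  define V where "V = synth (\<lambda>k. sine_coeff (v_sign n) k / mu k)"
  define w0 where "w0 = synth (\<lambda>k. sine_coeff j k / mu k)"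
  define u0 where "u0 = synth (\<lambda>k. sine_coeff f0 k / mu k)"
  have jk: "summable (\<lambda>k. \<bar>sine_coeff j k / mu k\<bar>)"
  proof (rule summable_mu_bounded[of _ 4])
    fix k
    have "\<bar>sine_coeff j k\<bar> \<le> 2 * 2"
      by (intro sine_coeff_bound borel_measurable_leb01 jm) (auto simp: j_def indicator_def)
    then show "\<bar>sine_coeff j k / mu k\<bar> \<le> 4 / mu k"
      using mu_pos[of k] by (simp add: abs_divide abs_of_pos divide_right_mono less_imp_le)
  qed
  have u0: "u0 x = V x + w0 x" for x
    unfolding u0_def V_def w0_def cf0 add_divide_distrib by (intro synth_add v_sign_summable jk)
  have w0_eq: "w0 y = 2 * (LINT x|leb01. green y x * indicat_real J x)" if "y \<in> {0..1}" for y
  proof -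
    have "w0 y = (LINT x|leb01. green y x * j x)" unfolding w0_def by (rule green_synth[OF sj that])
    then show ?thesis by (simp add: j_def mult.left_commute)
  qed
  have w0_nonneg: "0 \<le> w0 y" if "y \<in> {0..1}" for y
  proof -
    have "0 \<le> (LINT x|leb01. green y x * indicat_real J x)"
      using green_bounds[OF that] by (intro integral_nonneg_AE AE_I2) auto
    then show ?thesis using w0_eq[OF that] by simp
  qed
  have w0_lower: "2 * (l * (p * (1 - (p + l)))) \<le> w0 y" if "y \<in> {p..p + l}" for y
  proof -
    have "y \<in> {0..1}" using that p l by auto
    then show ?thesis using green_integral_interval[of p "p + l" y] that p l by (simp add: w0_eq J_def)
  qed
  have w0_big: "l * p / 2 < w0 y" if "y \<in> {p..p + l}" for y
  proof -
    have "l * p / 2 = (l * p) * (1 / 2)" by simp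
    also have "\<dots> < (l * p) * (2 * (1 - (p + l)))"
      using p l by (intro mult_strict_left_mono) auto
    also have "\<dots> = 2 * (l * (p * (1 - (p + l))))" by simp
    also have "\<dots> \<le> w0 y" by (rule w0_lower[OF that])
    finally show ?thesis .
  qed
  have v_second: "v_fun n x = - ((x - p) * (p - (x - p)) / 2)" if "x \<in> {p..2 * p}" for x
    using v_fun_piece[of 1 n x] n that by (simp add: p_def)
  have v_sign_second: "v_sign n x = - 1" and v_second_lower: "- (p / 2) * (x - p) \<le> v_fun n x" if "x \<in> {p..2 * p}" for x
  proof -
    have "0 \<le> (x - p) * (p - (x - p)) / 2" using that by (intro divide_nonneg_pos mult_nonneg_nonneg) auto
    then show "v_sign n x = - 1" using v_second[OF that] by (simp add: v_sign_def sg_def)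
    have "(x - p) * (p - (x - p)) \<le> (x - p) * p" using that by (intro mult_left_mono) auto
    then show "- (p / 2) * (x - p) \<le> v_fun n x" using v_second[OF that] by (simp add: mult.commute)
  qed
  have V_AE: "AE x in leb01. V x = v_fun n x" unfolding V_def by (rule v_fun_AE_synth[OF n0])
  interpret sub: subsolution f0 3
  proof
    show "AE x in leb01. f0 x \<le> sg (synth (\<lambda>k. sine_coeff f0 k / mu k) x)"
      using V_AE AE_space
    proof eventually_elim
      case (elim x)
      then have x: "x \<in> {0..1}" by simp
      have "f0 x \<le> sg (u0 x)"
      proof (cases "x \<in> J")
        case True
        then have x2: "x \<in> {p..2 * p}" "x \<in> {p..p + l}" using l by (auto simp: J_def)
        have "(p / 2) * (x - p) \<le> (p / 2) * l" using True p by (intro mult_left_mono) (auto simp: J_def)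
        then have "0 < u0 x" using v_second_lower[OF x2(1)] w0_big[OF x2(2)] elim by (simp add: u0 mult.commute)
        then show ?thesis using True v_sign_second[OF x2(1)] by (simp add: f0_def j_def sg_def)
      next
        case False
        have "sg (v_fun n x) \<le> sg (u0 x)" using w0_nonneg[OF x] elim by (intro sg_mono) (simp add: u0)
        then show ?thesis using False by (simp add: f0_def j_def v_sign_def)
      qed
      then show ?case by (simp add: u0_def)
    qed
  qed (use f0m f0b in auto)
  obtain g where mg: "mild_solution f0 g 3"
    and gU: "\<forall>t x. 0 \<le> t \<longrightarrow> x \<in> {0..1} \<longrightarrow>
        g t x = sg (mild_solution.U f0 g t x) \<and> sub.u0 x \<le> mild_solution.U f0 g t x"
    using sub.existence by (elim exE conjE)
  interpret m: mild_solution f0 g 3 by (rule mg)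
  have g_sg: "g t x = sg (m.U t x)" and U_ge: "u0 x \<le> m.U t x" if "0 \<le> t" "x \<in> {0..1}" for t x
    using gU[rule_format, OF that] by (auto simp: sub.u0_def u0_def)
  have strong: "strong_solution (c *\<^sub>R m.u 0) (\<lambda>t. c *\<^sub>R m.u t)"
  proof (rule m.strong_solution_scaled[OF c])
    show "AE x in leb01. g t x \<in> H0 (m.U t x)" if "0 < t" for t
      using g_sg[of t] that by (intro AE_I2) (auto simp: sg_in_H0)
  qed
  have vc: "inner (c *\<^sub>R v_plus n) (Sine k) = sine_coeff (\<lambda>x. c * v_sign n x) k / mu k" for k
    by (simp add: v_plus_coeff[OF n0] sine_coeff_cmult)
  have v_in: "c *\<^sub>R v_plus n \<in> V_H (2 * r)"
    using r by (intro V_H_I(1)[OF _ vc] square_integrable_cmult v_sign_square_integrable) auto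
  have u0c: "inner (c *\<^sub>R m.u 0) (Sine k) = sine_coeff (\<lambda>x. c * f0 x) k / mu k" for k
    by (simp add: m.u_coeff m.uk_def m.Yk_0 sine_coeff_cmult)
  have u0_in: "c *\<^sub>R m.u 0 \<in> V_H (2 * r)"
    using r by (intro V_H_I(1)[OF _ u0c] square_integrable_cmult sf0) auto
  have dc: "inner (c *\<^sub>R m.u 0 - c *\<^sub>R v_plus n) (Sine k) = sine_coeff (\<lambda>x. c * j x) k / mu k" for k
    unfolding inner_diff_left u0c vc by (simp add: sine_coeff_cmult cf0 add_divide_distrib distrib_left)
  have "(V_H_norm (2 * r) (c *\<^sub>R m.u 0 - c *\<^sub>R v_plus n))\<^sup>2 \<le> (LINT x|leb01. (c * j x)\<^sup>2)"
    using r by (intro V_H_I(2)[OF _ dc] square_integrable_cmult sj) auto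
  also have "\<dots> = (LINT x|leb01. 4 * indicat_real J x)"
    using c by (intro Bochner_Integration.integral_cong) (auto simp: j_def indicator_def power_mult_distrib)
  also have "\<dots> = 4 * l" using LINT_indicator[of p "p + l"] p l by (simp add: J_def)
  also have "\<dots> \<le> \<gamma>\<^sup>2" by (rule l)
  finally have near: "V_H_norm (2 * r) (c *\<^sub>R m.u 0 - c *\<^sub>R v_plus n) \<le> \<gamma>"
    by (rule power2_le_imp_le) (rule less_imp_le[OF \<gamma>])
  have "\<forall>t\<ge>0. c *\<^sub>R m.u t \<in> V_H (2 * r) \<and> V_H_norm (2 * r) (c *\<^sub>R m.u t - c *\<^sub>R v_plus n) \<le> \<epsilon>"
    by (rule mp[OF spec[where x="\<lambda>t. c *\<^sub>R m.u t", OF stab]], intro conjI strong u0_in near)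
  then have stay: "c *\<^sub>R m.u t \<in> V_H (2 * r)" "V_H_norm (2 * r) (c *\<^sub>R m.u t - c *\<^sub>R v_plus n) \<le> \<epsilon>"
    if "0 \<le> t" for t using that by blast+
  define W where "W t = synth (\<lambda>k. m.uk k t - sine_coeff (v_sign n) k / mu k)" for t
  have W: "W t x = m.U t x - V x" for t x
    unfolding W_def m.U_def V_def by (intro synth_diff m.uk_summable v_sign_summable)
  have W_lip: "\<bar>W t x - W t y\<bar> \<le> \<eta> * \<bar>x - y\<bar>" if t: "0 \<le> t" for t x y
    unfolding W_def \<epsilon>(2)[symmetric]
  proof (rule lip[rule_format, OF \<epsilon>(1) V_H_diff[OF stay(1)[OF t] v_in] stay(2)[OF t]])
    show "\<bar>m.uk k t - sine_coeff (v_sign n) k / mu k\<bar> = \<bar>inner (c *\<^sub>R m.u t - c *\<^sub>R v_plus n) (Sine k)\<bar>" for k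
      using c by (auto simp: inner_diff_left m.u_coeff v_plus_coeff[OF n0])
    show "summable (\<lambda>k. \<bar>m.uk k t - sine_coeff (v_sign n) k / mu k\<bar>)"
      by (rule summable_comparison_test'[OF summable_add[OF m.uk_summable[of t] v_sign_summable[of n]]])
        (simp only: real_norm_def abs_abs abs_triangle_ineq4)
  qed
  have W0: "W t 0 = 0" for t by (simp add: W_def synth_def)
  have W_p: "w0 p \<le> W t p" "W t p \<le> \<eta> * p" if "0 \<le> t" for t
    using U_ge[OF that p01] u0[of p] W[of t p] W_lip[OF that, of p 0] W0[of t] p by (auto simp: abs_le_iff)
  have w0p: "0 < w0 p"
  proof -
    have "0 < l * p / 2" using l p by simp
    also have "\<dots> < w0 p" using l by (intro w0_big) auto
    finally show ?thesis .
  qed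

  have rate: "w0 p / 2 \<le> (LINT x|leb01. green p x * (g t x - f0 x)) - m.Y t p" if t: "0 \<le> t" for t
  proof -
    define \<omega> where "\<omega> = W t p"
    have \<omega>: "w0 p \<le> \<omega>" "\<omega> \<le> \<eta> * p" "0 < \<omega>" using W_p[OF t] w0p by (auto simp: \<omega>_def)
    define q where "q = \<omega> / (p / 2 + \<eta>)"
    have den: "p / 2 + \<eta> = 17 * p / 32" by (simp add: \<eta>_def)
    have qp: "q * p = 32 / 17 * \<omega>" using p by (simp add: q_def den)
    have q: "0 < q" using \<omega> p \<eta> by (simp add: q_def)
    have "q * p \<le> (p / 17) * p" using \<omega>(2) unfolding qp \<eta>_def by simp
    then have q17: "q \<le> p / 17" using p(1) by (simp add: mult_le_cancel_right_pos)
    have sg: "square_integrable (\<lambda>x. g t x - v_sign n x)"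
      by (intro square_integrable_diff m.g_square_integrable v_sign_square_integrable)
    have sgreen: "square_integrable (green p)" by (rule green_square_integrable[OF p01])
    have "AE x in leb01. green p x * (2 * indicat_real {p<..<p + q} x) \<le> green p x * (g t x - v_sign n x)"
      using V_AE AE_space
    proof eventually_elim
      case (elim x)
      then have x: "x \<in> {0..1}" by simp
      have "2 * indicat_real {p<..<p + q} x \<le> g t x - v_sign n x"
      proof (cases "x \<in> {p<..<p + q}")
        case True
        then have x2: "x \<in> {p..2 * p}" using q17 p by auto
        have "\<omega> - \<eta> * (x - p) \<le> W t x"
          using W_lip[OF t, of x p] True by (simp add: \<omega>_def abs_le_iff)
        moreover have "(p / 2 + \<eta>) * (x - p) < (p / 2 + \<eta>) * q"
          using True p \<eta> by (intro mult_strict_left_mono) auto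
        moreover have "(p / 2 + \<eta>) * q = \<omega>" using p \<eta> by (simp add: q_def)
        ultimately have "0 < m.U t x"
          using v_second_lower[OF x2] W[of t x] elim by (simp add: algebra_simps)
        then show ?thesis using True g_sg[OF t x] v_sign_second[OF x2] by (simp add: sg_def)
      next
        case False
        have "v_fun n x \<le> m.U t x" using U_ge[OF t x] u0[of x] w0_nonneg[OF x] elim by simp
        then have "v_sign n x \<le> g t x" unfolding v_sign_def g_sg[OF t x] by (rule sg_mono)
        then show ?thesis using False by simp
      qed
      then show ?case using green_bounds[OF p01 x] by (intro mult_left_mono) auto
    qed
    then have "(LINT x|leb01. green p x * (2 * indicat_real {p<..<p + q} x)) \<le> (LINT x|leb01. green p x * (g t x - v_sign n x))"
      by (intro integral_mono_AE square_integrable_mult sgreen sg square_integrable_cmult indicator_square_integrable)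
    moreover have "2 * (q * (p * (1 - (p + q)))) \<le> (LINT x|leb01. green p x * (2 * indicat_real {p<..<p + q} x))"
    proof -
      have "(p + q - p) * (p * (1 - (p + q))) \<le> (LINT x|leb01. green p x * indicat_real {p<..<p + q} x)"
        using p q q17 by (intro green_integral_interval) auto
      then have "2 * (q * (p * (1 - (p + q)))) \<le> 2 * (LINT x|leb01. green p x * indicat_real {p<..<p + q} x)"
        by (simp only: add_diff_cancel_left' mult_le_cancel_left_pos zero_less_numeral)
      also have "\<dots> = (LINT x|leb01. green p x * (2 * indicat_real {p<..<p + q} x))"
        by (simp add: mult.left_commute)
      finally show ?thesis .
    qed
    moreover have "3 / 2 * \<omega> \<le> 2 * (q * (p * (1 - (p + q))))"
    proof -
      have "2 * (q * (p * (1 - (p + q)))) = (q * p) * (2 * (1 - (p + q)))" by simp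
      also have "\<dots> \<ge> (q * p) * (16 / 17)"
        using p q q17 by (intro mult_left_mono) auto
      finally have "(q * p) * (16 / 17) \<le> 2 * (q * (p * (1 - (p + q))))" .
      moreover have "3 / 2 * \<omega> \<le> (q * p) * (16 / 17)" unfolding qp using \<omega>(3) by simp
      ultimately show ?thesis by linarith
    qed
    moreover have "(LINT x|leb01. green p x * (g t x - f0 x)) - m.Y t p =
        (LINT x|leb01. green p x * (g t x - v_sign n x)) - \<omega>"
    proof -
      have i: "integrable leb01 (\<lambda>x. green p x * g t x)" "integrable leb01 (\<lambda>x. green p x * f0 x)"
        "integrable leb01 (\<lambda>x. green p x * v_sign n x)"
        by (intro square_integrable_mult sgreen m.g_square_integrable sf0 v_sign_square_integrable)+
      have "u0 p = (LINT x|leb01. green p x * f0 x)" "V p = (LINT x|leb01. green p x * v_sign n x)"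
        unfolding u0_def V_def by (intro green_synth p01 sf0 v_sign_square_integrable)+
      moreover have "m.U t p = u0 p + m.Y t p" unfolding u0_def by (rule m.U_eq)
      ultimately show ?thesis using W[of t p] i by (simp add: \<omega>_def right_diff_distrib)
    qed
    ultimately show ?thesis using \<omega>(1) by linarith
  qed
  define B where "B = (\<Sum>k. 4 * (1 + 3) * (1 / mu k))"
  have growth: "t * (w0 p / 2) \<le> B" if "0 \<le> t" for t
    unfolding B_def using m.green_pairing_growth[OF p01 that rate] m.green_pairing_bound[of t p] by (rule order_trans)
  define t where "t = (\<bar>B\<bar> + 1) / (w0 p / 2)"
  have "t * (w0 p / 2) = \<bar>B\<bar> + 1" "0 \<le> t" using w0p by (simp_all add: t_def)
  then show False using growth[of t] by linarith
qed

theorem theorem19: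
  fixes n :: nat and r :: real
  assumes "n \<ge> 2" and "3 / 4 < r" and "r < 1"
  shows "unstable_in_V_H (2 * r) (v_plus n) \<and> unstable_in_V_H (2 * r) (v_minus n)"
proof -
  have "unstable_in_V_H (2 * r) (c *\<^sub>R v_plus n)" if "c = 1 \<or> c = - 1" for c
    using instability[OF assms that] fixed_point_v[of n c] assms(1) that by (simp add: unstable_in_V_H_def)
  from this[of 1] this[of "- 1"] show ?thesis by (simp add: v_minus_def)
qed

end
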